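(* Let $K$ be a field and let ${\bf n}=(n_1,n_2,n_3,n_4)$ be a sequence of positive integers with $\gcd(n_1,n_2,n_3,n_4)=1$. For each $i$ let $a_i$ be the least positive integer such that $a_i n_i\in\sum_{j\neq i}\mathbb{N}n_j$. Suppose that $I({\bf n})$ is minimally generated by the three binomials $$x_1^{a_1}-x_2^{a_2},\qquad x_3^{a_3}-x_4^{a_4},\qquad x_1^{u_1}x_2^{u_2}-x_3^{u_3}x_4^{u_4},$$ where $u_1,u_2,u_3,u_4\in\mathbb{N}$, and that $n_1=\min\{n_1,n_2,n_3,n_4\}$, $a_3<a_4$, $u_2\le a_2$ and $u_3\le a_3$. Suppose that $u_3>0$ and $u_4>0$. Then $C({\bf n})$ has Cohen-Macaulay tangent cone at the origin if and only if the ideal $I({\bf n})_*$ is either a complete intersection or an almost complete intersection.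
   Context: $\mathbb{N}$ is the set of non-negative integers. For a sequence ${\bf n}=(n_1,\ldots,n_4)$ of positive integers with gcd $1$, $I({\bf n})$ is the toric ideal, i.e. the kernel of the $K$-algebra homomorphism $K[x_1,\ldots,x_4]\to K[t]$, $x_i\mapsto t^{n_i}$; it has height $3$ and is the defining ideal of the monomial curve $C({\bf n})$ parametrized by $x_i=t^{n_i}$. For a nonzero polynomial $f$, $f_*$ denotes the homogeneous summand of $f$ of least degree, and $I({\bf n})_*$ is the ideal generated by all $f_*$ with $f\in I({\bf n})$, $f\neq 0$; it is the defining ideal of the tangent cone of $C({\bf n})$ at $0$. $C({\bf n})$ has Cohen-Macaulay tangent cone at the origin if the ring $K[x_1,\ldots,x_4]/I({\bf n})_*$ is Cohen-Macaulay. The ideal $I({\bf n})_*$ (of height $3$) is a complete intersection if its minimal number of generators is $3$, and an almost complete intersection if its minimal number of generators is $4$. *)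

theory Defs
  imports
    "HOL-Library.Poly_Mapping"
    "HOL-Library.Numeral_Type"
    "HOL-Library.Extended_Nat"
    "HOL-Computational_Algebra.Polynomial"
    "HOL-Algebra.QuotRing"
    "HOL-Algebra.Ring_Divisibility"
    "HOL-Algebra.Algebraic_Closure_Type"
begin

section \<open>Commutative algebra\<close>

text \<open>The depth (grade) of an ideal P of R is the supremum of the lengths of the R-regular
  sequences contained in P; the height (codimension) of a prime P is the supremum of the lengths
  of the strict chains of primes ending in P.\<close>

definition regular_sequence :: "('a, 'm) ring_scheme \<Rightarrow> 'a list \<Rightarrow> bool" where
  "regular_sequence R rs \<longleftrightarrow>
     set rs \<subseteq> carrier R \<and>
     (\<forall>i<length rs. \<forall>y\<in>carrier R.
        rs ! i \<otimes>\<^bsub>R\<^esub> y \<in> Idl\<^bsub>R\<^esub> (set (take i rs)) \<longrightarrow> y \<in> Idl\<^bsub>R\<^esub> (set (take i rs))) \<and>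
     Idl\<^bsub>R\<^esub> (set rs) \<noteq> carrier R"

definition depth :: "('a, 'm) ring_scheme \<Rightarrow> 'a set \<Rightarrow> enat" where
  "depth R P = (SUP rs\<in>{rs. regular_sequence R rs \<and> set rs \<subseteq> P}. enat (length rs))"

definition prime_chain :: "('a, 'm) ring_scheme \<Rightarrow> nat \<Rightarrow> (nat \<Rightarrow> 'a set) \<Rightarrow> bool" where
  "prime_chain R l Q \<longleftrightarrow> (\<forall>i\<le>l. primeideal (Q i) R) \<and> (\<forall>i<l. Q i \<subset> Q (Suc i))"

definition height :: "('a, 'm) ring_scheme \<Rightarrow> 'a set \<Rightarrow> enat" where
  "height R P = (SUP l\<in>{l. \<exists>Q. prime_chain R l Q \<and> Q l = P}. enat l)"

text \<open>Cohen-Macaulay in the sense of Eisenbud, Section 18.2. Since R is Noetherian and P is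
  maximal, depth and height of P are the depth and the dimension of the localization of R at P, so
  this is the condition that all localizations at maximal ideals are Cohen-Macaulay local rings.\<close>

definition cohen_macaulay :: "('a, 'm) ring_scheme \<Rightarrow> bool" where
  "cohen_macaulay R \<longleftrightarrow>
     cring R \<and> noetherian_ring R \<and> (\<forall>P. maximalideal P R \<longrightarrow> depth R P = height R P)"

definition minimally_generated_by :: "('a, 'm) ring_scheme \<Rightarrow> 'a set \<Rightarrow> 'a set \<Rightarrow> bool" where
  "minimally_generated_by R I B \<longleftrightarrow>
     B \<subseteq> carrier R \<and> I = Idl\<^bsub>R\<^esub> B \<and> (\<forall>C. C \<subset> B \<longrightarrow> Idl\<^bsub>R\<^esub> C \<noteq> I)"

text \<open>The minimal number of generators; infinite if the ideal is not finitely generated.\<close>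

definition min_num_gens :: "('a, 'm) ring_scheme \<Rightarrow> 'a set \<Rightarrow> enat" where
  "min_num_gens R I =
     (INF B\<in>{B. finite B \<and> B \<subseteq> carrier R \<and> Idl\<^bsub>R\<^esub> B = I}. enat (card B))"


section \<open>Monomial curves in affine 4-space and their tangent cones\<close>

text \<open>The four variables are indexed by the type \<^typ>\<open>4\<close>, whose elements are 1, 2, 3 and 4 = 0.\<close>

type_synonym 'k poly4 = "(4 \<Rightarrow>\<^sub>0 nat) \<Rightarrow>\<^sub>0 'k"

abbreviation poly4_ring :: "'k::field poly4 ring" where
  "poly4_ring \<equiv> ring_of_type_algebra"

definition xvar :: "4 \<Rightarrow> 'k::field poly4" where
  "xvar i = Poly_Mapping.single (Poly_Mapping.single i 1) 1"

definition param_hom :: "(4 \<Rightarrow> nat) \<Rightarrow> 'k::field poly4 \<Rightarrow> 'k poly" where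
  "param_hom n f =
     (\<Sum>m\<in>Poly_Mapping.keys f.
        Polynomial.smult (Poly_Mapping.lookup f m)
          (\<Prod>i\<in>UNIV. (Polynomial.monom 1 (n i)) ^ Poly_Mapping.lookup m i))"

definition toric_ideal :: "(4 \<Rightarrow> nat) \<Rightarrow> 'k::field poly4 set" where
  "toric_ideal n = a_kernel poly4_ring ring_of_type_algebra (param_hom n)"

definition mon_degree :: "(4 \<Rightarrow>\<^sub>0 nat) \<Rightarrow> nat" where
  "mon_degree m = (\<Sum>i\<in>UNIV. Poly_Mapping.lookup m i)"

definition hom_component :: "nat \<Rightarrow> 'k::field poly4 \<Rightarrow> 'k poly4" where
  "hom_component d f =
     (\<Sum>m\<in>{m \<in> Poly_Mapping.keys f. mon_degree m = d}.
        Poly_Mapping.single m (Poly_Mapping.lookup f m))"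

text \<open>Only meaningful for nonzero polynomials.\<close>

definition initial_form :: "'k::field poly4 \<Rightarrow> 'k poly4" where
  "initial_form f = hom_component (Min (mon_degree ` Poly_Mapping.keys f)) f"

definition initial_ideal :: "'k::field poly4 set \<Rightarrow> 'k poly4 set" where
  "initial_ideal I = Idl\<^bsub>poly4_ring\<^esub> {initial_form f |f. f \<in> I \<and> f \<noteq> 0}"

definition cm_tangent_cone :: "'k::field itself \<Rightarrow> (4 \<Rightarrow> nat) \<Rightarrow> bool" where
  "cm_tangent_cone _ n \<longleftrightarrow>
     cohen_macaulay ((poly4_ring :: 'k poly4 ring) Quot initial_ideal (toric_ideal n))"

text \<open>Specific to ideals of height 3 in \<^typ>\<open>'k poly4\<close>, such as the initial ideal of the toric
  ideal of a monomial curve.\<close>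

definition complete_intersection3 :: "'k::field poly4 set \<Rightarrow> bool" where
  "complete_intersection3 I \<longleftrightarrow> min_num_gens poly4_ring I = 3"

definition almost_complete_intersection3 :: "'k::field poly4 set \<Rightarrow> bool" where
  "almost_complete_intersection3 I \<longleftrightarrow> min_num_gens poly4_ring I = 4"

definition crit_exponent :: "(4 \<Rightarrow> nat) \<Rightarrow> 4 \<Rightarrow> nat" where
  "crit_exponent n i =
     (LEAST a. 0 < a \<and> (\<exists>c :: 4 \<Rightarrow> nat. a * n i = (\<Sum>j\<in>UNIV - {i}. c j * n j)))"

end

theory Submission
  imports Defs
begin

text \<open>A monomial survives in the tangent cone iff its degree is maximal among the monomials of the same
  weight, and two surviving monomials of equal weight are identified. Hence the initial ideal is cut
  out by linear functionals that sum coefficients over the monomials of a given weight and maximal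
  degree. Modulo nilpotents the tangent cone is a polynomial ring in the variable of least weight, so
  it is Cohen--Macaulay iff multiplication by that variable preserves maximality of monomials.

  Two monomials have the same weight iff their exponents differ by an integer combination of the three
  given binomials, where one may assume u 2 < a 2. Both sides of the equivalence then reduce to the
  inequality a 4 + u 3 + u 4 \<le> u 1 + u 2 + a 3. If it holds, the tangent ideal is generated by binomials
  or monomials with leading terms x2^(a 2), x3^(a 3), x3^(u 3) x4^(u 4) and x4^(a 4 + u 4), and the normal
  forms are stable under x1. If it fails, x1^(u 1) x2^(u 2) x3^(a 3 - u 3) is not maximal although its
  quotient by x1 is, and five minimal generators are separated by functionals on the tangent ideal
  that vanish on its product with the irrelevant maximal ideal.\<close>

section \<open>Ideals of a commutative ring given by a type class\<close>

text \<open>The inequality compares the degrees of x4^(a 4 + u 4) and x1^(u 1) x2^(u 2) x3^(a 3 - u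
  3). Their weights agree: multiply the third binomial by x3^(a 3 - u 3) and exchange x3^(a 3) for
  x4^(a 4). This is the relation that resolves the overlap of x3^(a 3) and x3^(u 3) x4^(u 4).
  Cohen--Macaulayness is demanded at every maximal ideal, over an arbitrary field, and not only at
  the origin. Since primes contain the nilpotents, \<open>psi\<close> describes each maximal ideal
  by a nonzero nonunit of K[t]; all heights are 1, all depths are at most 1, and what remains is the
  existence of a nonzerodivisor in each maximal ideal. No single choice of five generators serves
  all cases. The least relevant powers of x2, x3 and x4 always give three; the other two depend on
  which term of the third binomial has the larger degree, and the corner monomial is critical only
  for u 3 + u 4 < u 1 + u 2 and u 3 < a 3. If n 1 = n 2, the first binomial is a linear form and x1
  no longer has strictly least weight; this case has to be kept apart.\<close>

definition tc_ideal :: "'a::comm_ring_1 set \<Rightarrow> bool" where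
  "tc_ideal A \<longleftrightarrow> 0 \<in> A \<and> (\<forall>x\<in>A. \<forall>y\<in>A. x + y \<in> A) \<and> (\<forall>r. \<forall>x\<in>A. r * x \<in> A)"

lemma tc_idealD:
  assumes "tc_ideal A"
  shows "0 \<in> A" "x \<in> A \<Longrightarrow> y \<in> A \<Longrightarrow> x + y \<in> A" "x \<in> A \<Longrightarrow> r * x \<in> A" "x \<in> A \<Longrightarrow> x * r \<in> A"
  using assms by (auto simp: tc_ideal_def mult.commute)

lemma tc_ideal_uminus: "tc_ideal A \<Longrightarrow> x \<in> A \<Longrightarrow> - x \<in> A"
  using tc_idealD(3)[of A x "-1"] by simp

lemma tc_ideal_diff: "tc_ideal A \<Longrightarrow> x \<in> A \<Longrightarrow> y \<in> A \<Longrightarrow> x - y \<in> A"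
  using tc_idealD(2)[of A x "-y"] tc_ideal_uminus[of A y] by simp

lemma tc_ideal_sum:
  assumes "tc_ideal A" "\<And>i. i \<in> S \<Longrightarrow> f i \<in> A"
  shows "sum f S \<in> A"
  using assms(2) by (induction S rule: infinite_finite_induct) (auto intro: tc_idealD[OF assms(1)])

lemma tc_ideal_diff_iff:
  assumes "tc_ideal A" "x - y \<in> A"
  shows "x \<in> A \<longleftrightarrow> y \<in> A"
proof
  assume "x \<in> A"
  then show "y \<in> A" using tc_ideal_diff[OF assms(1) _ assms(2), of x] by simp
next
  assume "y \<in> A"
  then show "x \<in> A" using tc_idealD(2)[OF assms(1) assms(2), of y] by simp
qed

lemma roa_simps [simp]:
  "carrier (ring_of_type_algebra :: 'a::comm_ring_1 ring) = UNIV"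
  "monoid.mult (ring_of_type_algebra :: 'a::comm_ring_1 ring) = (*)"
  "ring.add (ring_of_type_algebra :: 'a::comm_ring_1 ring) = (+)"
  "ring.zero (ring_of_type_algebra :: 'a::comm_ring_1 ring) = 0"
  "monoid.one (ring_of_type_algebra :: 'a::comm_ring_1 ring) = 1"
  by (auto simp: ring_of_type_algebra_def fun_eq_iff)

lemma cring_roa: "cring (ring_of_type_algebra :: 'a::comm_ring_1 ring)"
  by (rule cring_from_type_algebra)

lemma ring_roa: "ring (ring_of_type_algebra :: 'a::comm_ring_1 ring)"
  by (rule ring_from_type_algebra)

lemma a_inv_roa: "a_inv (ring_of_type_algebra :: 'a::comm_ring_1 ring) x = - x"
proof -
  interpret ring "ring_of_type_algebra :: 'a ring" by (rule ring_roa)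
  show ?thesis
    by (rule minus_equality) auto
qed

text \<open>The bridge between the carrier-based notion in the definitions and
  \<open>tc_ideal\<close>, in which all computations take place.\<close>

lemma ideal_roa_iff: "ideal A (ring_of_type_algebra :: 'a::comm_ring_1 ring) \<longleftrightarrow> tc_ideal A"
proof
  let ?P = "ring_of_type_algebra :: 'a ring"
  assume I: "ideal A ?P"
  interpret ideal A ?P by fact
  show "tc_ideal A"
    unfolding tc_ideal_def
    using additive_subgroup.zero_closed[OF is_additive_subgroup] additive_subgroup.a_closed[OF is_additive_subgroup]
      I_l_closed by auto
next
  let ?P = "ring_of_type_algebra :: 'a ring"
  assume A: "tc_ideal A"
  show "ideal A ?P"
  proof (rule idealI)
    show "ring ?P" by (rule ring_roa)
    interpret ring ?P by (rule ring_roa)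
    show "subgroup A (add_monoid ?P)"
      by (rule add.subgroupI)
         (use tc_idealD[OF A] tc_ideal_uminus[OF A] in \<open>auto simp flip: a_inv_def simp: a_inv_roa\<close>)
  qed (use tc_idealD[OF A] in auto)
qed

lemma tc_ideal_genideal: "tc_ideal (genideal (ring_of_type_algebra :: 'a::comm_ring_1 ring) S)"
proof -
  interpret ring "ring_of_type_algebra :: 'a ring" by (rule ring_roa)
  show ?thesis using genideal_ideal[of S] by (simp add: ideal_roa_iff)
qed

lemma genideal_roa_superset: "S \<subseteq> genideal (ring_of_type_algebra :: 'a::comm_ring_1 ring) S"
proof -
  interpret ring "ring_of_type_algebra :: 'a ring" by (rule ring_roa)
  show ?thesis by (rule genideal_self) simp
qed

lemma genideal_roa_least:
  assumes "tc_ideal A" "S \<subseteq> A"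
  shows "genideal (ring_of_type_algebra :: 'a::comm_ring_1 ring) S \<subseteq> A"
proof -
  interpret ring "ring_of_type_algebra :: 'a ring" by (rule ring_roa)
  show ?thesis by (rule genideal_minimal) (use assms in \<open>auto simp: ideal_roa_iff\<close>)
qed

text \<open>Minimality is tested against an arbitrary ideal \<open>G\<close> containing
  \<open>S\<close>, so no element ever has to be written as an explicit combination of
  generators.\<close>

lemma roa_genideal_eqI:
  assumes "tc_ideal A" "S \<subseteq> A" "\<And>G. tc_ideal G \<Longrightarrow> S \<subseteq> G \<Longrightarrow> A \<subseteq> G"
  shows "genideal (ring_of_type_algebra :: 'a::comm_ring_1 ring) S = A"
  using genideal_roa_least[OF assms(1,2)] assms(3)[OF tc_ideal_genideal genideal_roa_superset] by blast


section \<open>Coefficient sums over sets of monomials\<close>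

definition coeff_sum :: "'m set \<Rightarrow> ('m \<Rightarrow>\<^sub>0 'k::comm_monoid_add) \<Rightarrow> 'k" where
  "coeff_sum T f = (\<Sum>m\<in>Poly_Mapping.keys f. if m \<in> T then Poly_Mapping.lookup f m else 0)"

lemma coeff_sum_superset:
  assumes "finite A" "Poly_Mapping.keys f \<subseteq> A"
  shows "coeff_sum T f = (\<Sum>m\<in>A. if m \<in> T then Poly_Mapping.lookup f m else 0)"
  unfolding coeff_sum_def using assms
  by (intro sum.mono_neutral_left) (auto simp: in_keys_iff)

lemma coeff_sum_zero [simp]: "coeff_sum T 0 = 0"
  by (simp add: coeff_sum_def)

lemma coeff_sum_single [simp]: "coeff_sum T (Poly_Mapping.single m c) = (if m \<in> T then c else 0)"
  by (subst coeff_sum_superset[of "{m}"]) auto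

lemma coeff_sum_add: "coeff_sum T (f + g) = coeff_sum T f + coeff_sum T g"
proof -
  let ?A = "Poly_Mapping.keys f \<union> Poly_Mapping.keys g"
  have "Poly_Mapping.keys (f + g) \<subseteq> ?A" by (rule keys_add)
  then show ?thesis
    by (subst (1 2 3) coeff_sum_superset[of ?A])
       (auto simp: lookup_add sum.distrib [symmetric] intro!: sum.cong)
qed

lemma coeff_sum_uminus: "coeff_sum T (- f) = - coeff_sum T (f :: 'm \<Rightarrow>\<^sub>0 'k::ab_group_add)"
  using coeff_sum_add[of T f "-f"] by (simp add: eq_neg_iff_add_eq_0 add.commute)

lemma coeff_sum_diff: "coeff_sum T (f - g) = coeff_sum T f - coeff_sum T (g :: 'm \<Rightarrow>\<^sub>0 'k::ab_group_add)"
  using coeff_sum_add[of T f "-g"] by (simp add: coeff_sum_uminus)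

lemma coeff_sum_sum: "coeff_sum T (sum f S) = (\<Sum>i\<in>S. coeff_sum T (f i))"
  by (induction S rule: infinite_finite_induct) (auto simp: coeff_sum_add)

lemma coeff_sum_empty [simp]: "coeff_sum {} f = 0"
  by (simp add: coeff_sum_def)

lemma poly_mapping_eq_sum_single:
  "f = (\<Sum>m\<in>Poly_Mapping.keys f. Poly_Mapping.single m (Poly_Mapping.lookup f m))"
  by (rule poly_mapping_eqI) (auto simp: lookup_sum lookup_single when_def in_keys_iff)

lemma poly_mapping_add_induct [case_names zero single add]:
  fixes f :: "'m \<Rightarrow>\<^sub>0 'k::comm_monoid_add"
  assumes "P 0" "\<And>m c. P (Poly_Mapping.single m c)" "\<And>f g. P f \<Longrightarrow> P g \<Longrightarrow> P (f + g)"
  shows "P f"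
proof -
  have "P (\<Sum>m\<in>S. Poly_Mapping.single m (Poly_Mapping.lookup f m))" for S
    by (induction S rule: infinite_finite_induct) (auto intro: assms)
  from this[of "Poly_Mapping.keys f"] show ?thesis
    by (simp flip: poly_mapping_eq_sum_single)
qed

lemma coeff_sum_single_mult:
  fixes f :: "'m::cancel_comm_monoid_add \<Rightarrow>\<^sub>0 'k::comm_ring_1"
  shows "coeff_sum T (Poly_Mapping.single a c * f) = c * coeff_sum {m. a + m \<in> T} f"
  by (induction f rule: poly_mapping_add_induct)
     (auto simp: mult_single coeff_sum_add algebra_simps)

section \<open>Ideals cut out by coefficient sums\<close>

definition coeff_null :: "'m set set \<Rightarrow> ('m \<Rightarrow>\<^sub>0 'k::comm_monoid_add) set" where
  "coeff_null \<T> = {f. \<forall>T\<in>\<T>. coeff_sum T f = 0}"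

text \<open>Multiplication by a monomial \<open>a\<close> shifts the set of summation by
  \<open>a\<close>, so a family closed under shifts, up to the empty set, has an ideal as its common
  kernel. The tangent ideal and the ideal that controls the relation lattice are both obtained in
  this way.\<close>

lemma tc_ideal_coeff_null:
  fixes \<T> :: "'m::cancel_comm_monoid_add set set"
  assumes "\<And>T a. T \<in> \<T> \<Longrightarrow> {m. a + m \<in> T} = {} \<or> {m. a + m \<in> T} \<in> \<T>"
  shows "tc_ideal (coeff_null \<T> :: ('m \<Rightarrow>\<^sub>0 'k::comm_ring_1) set)"
  unfolding tc_ideal_def
proof (intro conjI ballI allI)
  fix r f :: "'m \<Rightarrow>\<^sub>0 'k" assume f: "f \<in> coeff_null \<T>"
  show "r * f \<in> coeff_null \<T>"
  proof (induction r rule: poly_mapping_add_induct)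
    case (single m c)
    show ?case
      unfolding coeff_null_def
    proof safe
      fix T assume "T \<in> \<T>"
      then show "coeff_sum T (Poly_Mapping.single m c * f) = 0"
        using assms[of T m] f by (auto simp: coeff_sum_single_mult coeff_null_def)
    qed
  qed (auto simp: coeff_null_def algebra_simps coeff_sum_add)
qed (auto simp: coeff_null_def coeff_sum_add)

abbreviation pmon :: "'m \<Rightarrow> ('m \<Rightarrow>\<^sub>0 'k::zero_neq_one)" where
  "pmon m \<equiv> Poly_Mapping.single m 1"

lemma single_eq_const_mult_pmon:
  "Poly_Mapping.single m c = Poly_Mapping.single 0 c * (pmon m :: 'm::comm_monoid_add \<Rightarrow>\<^sub>0 'k::comm_ring_1)"
  by (simp add: mult_single)

lemma tc_ideal_single:
  assumes "tc_ideal A" "(pmon m :: 'm::comm_monoid_add \<Rightarrow>\<^sub>0 'k::comm_ring_1) \<in> A"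
  shows "Poly_Mapping.single m c \<in> A"
  using tc_idealD(3)[OF assms] by (subst single_eq_const_mult_pmon)

lemma tc_ideal_single_diff:
  assumes "tc_ideal A" "(pmon m - pmon m' :: 'm::comm_monoid_add \<Rightarrow>\<^sub>0 'k::comm_ring_1) \<in> A"
  shows "Poly_Mapping.single m c - Poly_Mapping.single m' c \<in> A"
  using tc_idealD(3)[OF assms, of "Poly_Mapping.single 0 c"]
  by (simp add: right_diff_distrib mult_single)

lemma pmon_mult: "pmon a * pmon b = (pmon (a + b) :: 'm::comm_monoid_add \<Rightarrow>\<^sub>0 'k::comm_ring_1)"
  by (simp add: mult_single)

text \<open>Terms are collected fibrewise. In \<open>tangent_ideal_subset\<close> this shows that
  subtracting a representative from each monomial leaves the sum unchanged.\<close>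

lemma sum_single_representatives_eq_zero:
  assumes "\<And>s. s \<in> r ` S \<Longrightarrow> (\<Sum>m\<in>{m \<in> S. r m = s}. c m) = 0" "finite S"
  shows "(\<Sum>m\<in>S. Poly_Mapping.single (r m) (c m :: 'k::comm_monoid_add)) = 0"
proof (rule poly_mapping_eqI)
  fix s
  have "Poly_Mapping.lookup (\<Sum>m\<in>S. Poly_Mapping.single (r m) (c m)) s = (\<Sum>m\<in>S. if r m = s then c m else 0)"
    by (auto simp: lookup_sum lookup_single when_def intro!: sum.cong)
  also have "\<dots> = (\<Sum>m\<in>{m \<in> S. r m = s}. c m)"
    using assms(2) by (simp add: sum.If_cases Int_def)
  also have "\<dots> = 0"
  proof (cases "s \<in> r ` S")
    case False
    then have "{m \<in> S. r m = s} = {}" by auto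
    then show ?thesis by (simp del: Collect_empty_eq)
  qed (use assms(1) in auto)
  finally show "Poly_Mapping.lookup (\<Sum>m\<in>S. Poly_Mapping.single (r m) (c m)) s = Poly_Mapping.lookup 0 s"
    by simp
qed

section \<open>Dimension one quotients\<close>

lemma poly_tc_ideal_principal:
  assumes "tc_ideal (A :: 'k::field poly set)"
  obtains g where "g \<in> A" "\<And>x. x \<in> A \<Longrightarrow> g dvd x"
proof (cases "A \<subseteq> {0}")
  case True
  then show ?thesis using that[of 0] tc_idealD(1)[OF assms] by auto
next
  case False
  define g where "g = arg_min degree (\<lambda>x. x \<in> A \<and> x \<noteq> 0)"
  from False obtain x0 where "x0 \<in> A \<and> x0 \<noteq> 0" by auto
  then have g: "g \<in> A \<and> g \<noteq> 0" unfolding g_def by (rule arg_min_natI)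
  have le: "degree g \<le> degree y" if "y \<in> A \<and> y \<noteq> 0" for y
    unfolding g_def using arg_min_nat_le[of "\<lambda>x. x \<in> A \<and> x \<noteq> 0" y degree] that by simp
  have "g dvd x" if "x \<in> A" for x
  proof -
    have "x - g * (x div g) \<in> A"
      using that g by (intro tc_ideal_diff[OF assms]) (auto intro: tc_idealD[OF assms])
    then have m: "x mod g \<in> A" by (simp add: minus_mult_div_eq_mod)
    have "x mod g = 0"
    proof (rule ccontr)
      assume nz: "x mod g \<noteq> 0"
      then have "degree (x mod g) < degree g"
        using degree_mod_less[of g x] g by auto
      moreover have "degree g \<le> degree (x mod g)" using le m nz by blast
      ultimately show False by simp
    qed
    then show ?thesis by auto
  qed
  with g show ?thesis using that by blast
qed

lemma tc_ideal_power_diff: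
  assumes "tc_ideal A" "y \<in> A" "(x - y) ^ L \<in> A"
  shows "x ^ L \<in> A"
proof -
  have "x ^ k - (x - y) ^ k \<in> A" for k
  proof (induction k)
    case (Suc k)
    have "x ^ Suc k - (x - y) ^ Suc k = x * (x ^ k - (x - y) ^ k) + y * (x - y) ^ k"
      by (simp add: algebra_simps)
    then show ?case using Suc assms(2) by (auto intro: tc_idealD[OF assms(1)])
  qed (auto intro: tc_idealD[OF assms(1)])
  from tc_ideal_diff_iff[OF assms(1) this] assms(3) show ?thesis by blast
qed

text \<open>The ring R is the quotient of a type-class ring by J, with projection cls. The map psi
  identifies the reduction of R with a univariate polynomial ring.\<close>

locale quotient_presentation =
  fixes R :: "('b, 'm) ring_scheme" and cls :: "'a::comm_ring_1 \<Rightarrow> 'b" and J :: "'a set"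
    and psi :: "'a \<Rightarrow> 'k::field poly"
  assumes cring_R: "cring R"
    and carrier_R: "carrier R = range cls"
    and cls_add: "cls (f + g) = cls f \<oplus>\<^bsub>R\<^esub> cls g"
    and cls_mult: "cls (f * g) = cls f \<otimes>\<^bsub>R\<^esub> cls g"
    and cls_one: "cls 1 = \<one>\<^bsub>R\<^esub>"
    and cls_zero_iff: "cls f = \<zero>\<^bsub>R\<^esub> \<longleftrightarrow> f \<in> J"
    and psi_add: "psi (f + g) = psi f + psi g"
    and psi_mult: "psi (f * g) = psi f * psi g"
    and psi_one: "psi 1 = 1"
    and surj_psi: "surj psi"
    and psi_J: "f \<in> J \<Longrightarrow> psi f = 0"
    and nilpotent: "psi f = 0 \<Longrightarrow> \<exists>L. f ^ L \<in> J"
begin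

sublocale cring R by (rule cring_R)

lemma cls_carrier [simp]: "cls f \<in> carrier R"
  by (simp add: carrier_R)

lemma cls_zero: "cls 0 = \<zero>\<^bsub>R\<^esub>"
  using cls_add[of 0 0] by (simp add: local.add.r_cancel_one')

lemma cls_uminus: "cls (- f) = \<ominus>\<^bsub>R\<^esub> cls f"
  using cls_add[of "- f" f] by (simp add: cls_zero minus_equality)

lemma cls_eq_iff: "cls f = cls g \<longleftrightarrow> f - g \<in> J"
proof -
  have "cls (f - g) = cls f \<ominus>\<^bsub>R\<^esub> cls g"
    using cls_add[of f "- g"] by (simp add: cls_uminus a_minus_def)
  then show ?thesis
    using cls_zero_iff[of "f - g"] by (metis cls_carrier r_right_minus_eq)
qed

lemma tc_ideal_pre: "ideal A R \<Longrightarrow> tc_ideal {f. cls f \<in> A}"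
  unfolding tc_ideal_def
  by (auto simp: cls_zero cls_add cls_mult additive_subgroup.zero_closed[OF ideal.axioms(1)]
      additive_subgroup.a_closed[OF ideal.axioms(1)] ideal.I_l_closed)

lemma J_subset_pre: "ideal A R \<Longrightarrow> f \<in> J \<Longrightarrow> cls f \<in> A"
  using cls_zero_iff[of f] additive_subgroup.zero_closed[OF ideal.axioms(1)] by auto

lemma tc_ideal_J: "tc_ideal J"
  using tc_ideal_pre[OF zeroideal] cls_zero_iff by (simp cong: Collect_cong)

lemma mem_cls_image_iff:
  assumes "tc_ideal A" "J \<subseteq> A"
  shows "cls f \<in> cls ` A \<longleftrightarrow> f \<in> A"
proof
  assume "cls f \<in> cls ` A"
  then obtain g where "g \<in> A" "f - g \<in> A" using cls_eq_iff assms(2) by blast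
  then show "f \<in> A" using tc_ideal_diff_iff[OF assms(1)] by blast
qed auto

lemma ideal_cls_image:
  assumes "tc_ideal A" "J \<subseteq> A"
  shows "ideal (cls ` A) R"
proof (rule idealI)
  show "ring R" by (rule ring_axioms)
  have inv: "\<ominus>\<^bsub>R\<^esub> cls f = cls (- f)" for f by (simp add: cls_uminus)
  show "subgroup (cls ` A) (add_monoid R)"
  proof (rule add.subgroupI)
    show "cls ` A \<noteq> {}" using tc_idealD(1)[OF assms(1)] by auto
    fix a assume "a \<in> cls ` A"
    then show "\<ominus>\<^bsub>R\<^esub> a \<in> cls ` A"
      by (auto simp: inv intro!: imageI tc_ideal_uminus[OF assms(1)])
  qed (auto simp flip: cls_add intro!: imageI tc_idealD[OF assms(1)])
next
  fix a x assume "a \<in> cls ` A" "x \<in> carrier R"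
  then obtain f g where fg: "f \<in> A" "a = cls f" "x = cls g" by (auto simp: carrier_R)
  then show "x \<otimes>\<^bsub>R\<^esub> a \<in> cls ` A" "a \<otimes>\<^bsub>R\<^esub> x \<in> cls ` A"
    using tc_idealD(3,4)[OF assms(1) fg(1), of g] by (auto simp flip: cls_mult)
qed

lemma cls_image_pre: "A \<subseteq> carrier R \<Longrightarrow> cls ` {f. cls f \<in> A} = A"
  by (auto simp: carrier_R)

lemma ideal_eq_cls_pre: "ideal A R \<Longrightarrow> cls ` {f. cls f \<in> A} = A"
  by (rule cls_image_pre) (simp add: additive_subgroup.a_subset ideal.axioms(1))

lemma psi_zero: "psi 0 = 0"
  using psi_add[of 0 0] by (metis add_cancel_right_right add_0)

lemma psi_uminus: "psi (- f) = - psi f"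
  using psi_add[of f "- f"] by (simp add: psi_zero eq_neg_iff_add_eq_0 add.commute)

lemma psi_diff: "psi (f - g) = psi f - psi g"
  using psi_add[of f "- g"] by (simp add: psi_uminus)

lemma psi_power: "psi (f ^ k) = psi f ^ k"
  by (induction k) (auto simp: psi_one psi_mult)

lemma psi_obtain: obtains f where "psi f = p"
  using surj_psi by (metis surj_def)

lemma tc_ideal_psi_image: "tc_ideal A \<Longrightarrow> tc_ideal (psi ` A)"
  unfolding tc_ideal_def
proof (intro conjI ballI allI)
  assume A: "0 \<in> A \<and> (\<forall>x\<in>A. \<forall>y\<in>A. x + y \<in> A) \<and> (\<forall>r. \<forall>x\<in>A. r * x \<in> A)"
  show "0 \<in> psi ` A" using A psi_zero by force
  fix x assume x: "x \<in> psi ` A"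
  { fix y assume "y \<in> psi ` A" with x A show "x + y \<in> psi ` A" by (auto simp flip: psi_add) }
  fix r obtain s where "psi s = r" by (rule psi_obtain)
  with x A show "r * x \<in> psi ` A" by (auto simp flip: psi_mult)
qed

lemma mem_psi_image_iff:
  assumes "tc_ideal A" "\<And>f. psi f = 0 \<Longrightarrow> f \<in> A"
  shows "psi f \<in> psi ` A \<longleftrightarrow> f \<in> A"
proof
  assume "psi f \<in> psi ` A"
  then obtain g where "g \<in> A" "psi (f - g) = 0" by (auto simp: psi_diff)
  then show "f \<in> A" using tc_ideal_diff_iff[OF assms(1)] assms(2) by blast
qed auto

section \<open>Prime ideals of the quotient and its dimension\<close>

lemma prime_pre:
  assumes "primeideal Q R"
  shows "cls 1 \<notin> Q" "cls (f * g) \<in> Q \<longleftrightarrow> cls f \<in> Q \<or> cls g \<in> Q"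
proof -
  interpret primeideal Q R by fact
  show "cls 1 \<notin> Q" using I_notcarr one_imp_carrier by (auto simp: cls_one)
  show "cls (f * g) \<in> Q \<longleftrightarrow> cls f \<in> Q \<or> cls g \<in> Q"
    using I_prime[of "cls f" "cls g"] I_l_closed I_r_closed by (auto simp: cls_mult)
qed

lemma prime_pre_power:
  assumes "primeideal Q R" "cls (f ^ k) \<in> Q"
  shows "cls f \<in> Q"
  using assms(2) by (induction k) (use prime_pre[OF assms(1)] in auto)

lemma prime_pre_kernel:
  assumes "primeideal Q R" "psi f = 0"
  shows "cls f \<in> Q"
  using nilpotent[OF assms(2)] J_subset_pre[OF primeideal.axioms(1)[OF assms(1)]]
    prime_pre_power[OF assms(1)] by blast

text \<open>A prime contains the nilpotent elements, hence everything killed by \<open>psi\<close>;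
  it is therefore the pullback of an ideal of K[t], which is principal. The generator may be
  0.\<close>

lemma prime_generator:
  assumes "primeideal Q R"
  obtains g where "\<And>f. cls f \<in> Q \<longleftrightarrow> g dvd psi f" "\<not> g dvd 1"
proof -
  let ?A = "{f. cls f \<in> Q}"
  have A: "tc_ideal ?A" using assms by (intro tc_ideal_pre) (simp add: primeideal.axioms)
  obtain g where g: "g \<in> psi ` ?A" "\<And>x. x \<in> psi ` ?A \<Longrightarrow> g dvd x"
    using poly_tc_ideal_principal[OF tc_ideal_psi_image[OF A]] by blast
  have *: "cls f \<in> Q \<longleftrightarrow> g dvd psi f" for f
  proof -
    have "cls f \<in> Q \<longleftrightarrow> psi f \<in> psi ` ?A"
      using mem_psi_image_iff[OF A] prime_pre_kernel[OF assms] by auto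
    also have "\<dots> \<longleftrightarrow> g dvd psi f"
      using g tc_idealD(4)[OF tc_ideal_psi_image[OF A] g(1)] by (auto elim!: dvdE)
    finally show ?thesis .
  qed
  moreover have "\<not> g dvd 1" using * prime_pre(1)[OF assms] by (metis psi_one)
  ultimately show ?thesis using that by blast
qed

text \<open>Nonzero primes of K[t] are maximal: if g1 = g2 * h, then g1 divides g2 or h, and the
  second option makes g2 a unit.\<close>

lemma prime_chain_length_le_one:
  assumes "prime_chain R l Q"
  shows "l \<le> 1"
proof (rule ccontr)
  assume "\<not> l \<le> 1"
  then have Q: "primeideal (Q 0) R" "primeideal (Q (Suc 0)) R" "primeideal (Q (Suc (Suc 0))) R"
    "Q 0 \<subset> Q (Suc 0)" "Q (Suc 0) \<subset> Q (Suc (Suc 0))"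
    using assms by (auto simp: prime_chain_def)
  obtain g1 where g1: "\<And>f. cls f \<in> Q (Suc 0) \<longleftrightarrow> g1 dvd psi f" "\<not> g1 dvd 1"
    using prime_generator[OF Q(2)] by blast
  obtain g2 where g2: "\<And>f. cls f \<in> Q (Suc (Suc 0)) \<longleftrightarrow> g2 dvd psi f" "\<not> g2 dvd 1"
    using prime_generator[OF Q(3)] by blast
  have sub: "Q i \<subseteq> range cls" if "primeideal (Q i) R" for i
    using that by (metis additive_subgroup.a_subset carrier_R ideal.axioms(1) primeideal.axioms(1))
  obtain f where f: "cls f \<in> Q (Suc 0)" "cls f \<notin> Q 0" using Q(4) sub[OF Q(2)] by blast
  obtain e where e: "cls e \<in> Q (Suc (Suc 0))" "cls e \<notin> Q (Suc 0)" using Q(5) sub[OF Q(3)] by blast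
  \<comment> \<open>With generator 0 the element \<open>f\<close> would be killed by
    \<open>psi\<close> and hence lie in \<open>Q 0\<close>.\<close>
  have "g1 \<noteq> 0" using f g1(1)[of f] prime_pre_kernel[OF Q(1), of f] by auto
  obtain G1 where G1: "psi G1 = g1" by (rule psi_obtain)
  have "g2 dvd g1" using g1(1)[of G1] g2(1)[of G1] G1 Q(5) by auto
  then obtain h where h: "g1 = g2 * h" ..
  obtain G2 where G2: "psi G2 = g2" by (rule psi_obtain)
  obtain H where H: "psi H = h" by (rule psi_obtain)
  have "cls (G2 * H) \<in> Q (Suc 0)" using g1(1)[of "G2 * H"] by (simp add: psi_mult G2 H h)
  then consider "g1 dvd g2" | "g1 dvd h"
    using prime_pre(2)[OF Q(2)] g1(1) G2 H by blast
  then show False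
  proof cases
    case 1
    then show False using e g1(1) g2(1) dvd_trans by blast
  next
    case 2
    then obtain c where "h = g1 * c" ..
    with h have "g1 * 1 = g1 * (g2 * c)" by (simp add: ac_simps)
    then have "g2 * c = 1" using \<open>g1 \<noteq> 0\<close> by (metis mult_left_cancel)
    then show False using g2(2) by (metis dvd_triv_left)
  qed
qed

lemma maximal_imp_prime: "maximalideal P R \<Longrightarrow> primeideal P R"
  by (rule maximalideal_prime)

lemma tc_ideal_kernel: "tc_ideal {f. psi f = 0}"
  by (auto simp: tc_ideal_def psi_zero psi_add psi_mult)

lemma J_subset_kernel: "J \<subseteq> {f. psi f = 0}"
  using psi_J by auto

lemma primeideal_kernel: "primeideal (cls ` {f. psi f = 0}) R"
proof (rule primeidealI)
  show "ideal (cls ` {f. psi f = 0}) R" by (rule ideal_cls_image[OF tc_ideal_kernel J_subset_kernel])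
  show "cring R" by (rule cring_R)
  have "cls 1 \<notin> cls ` {f. psi f = 0}"
    by (subst mem_cls_image_iff[OF tc_ideal_kernel J_subset_kernel]) (simp add: psi_one)
  then show "carrier R \<noteq> cls ` {f. psi f = 0}" using cls_carrier by blast
  fix a b assume "a \<in> carrier R" "b \<in> carrier R" and ab: "a \<otimes>\<^bsub>R\<^esub> b \<in> cls ` {f. psi f = 0}"
  then obtain f g where fg: "a = cls f" "b = cls g" by (auto simp: carrier_R)
  with ab have "psi (f * g) = 0"
    using mem_cls_image_iff[OF tc_ideal_kernel J_subset_kernel, of "f * g"] by (simp add: cls_mult)
  then show "a \<in> cls ` {f. psi f = 0} \<or> b \<in> cls ` {f. psi f = 0}"
    using fg by (auto simp: psi_mult)
qed

text \<open>The generator is nonzero because the kernel of \<open>psi\<close> does not give a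
  maximal ideal: the elements with image divisible by t form a larger proper one.\<close>

lemma maximal_generator:
  assumes "maximalideal P R"
  obtains g where "\<And>f. cls f \<in> P \<longleftrightarrow> g dvd psi f" "\<not> g dvd 1" "g \<noteq> 0"
proof -
  obtain g where g: "\<And>f. cls f \<in> P \<longleftrightarrow> g dvd psi f" "\<not> g dvd 1"
    using prime_generator[OF maximal_imp_prime[OF assms]] by blast
  have "g \<noteq> 0"
  proof
    assume "g = 0"
    define A where "A = {f. [:0, 1:] dvd psi f}"
    have A: "tc_ideal A" by (auto simp: tc_ideal_def A_def psi_zero psi_add psi_mult)
    have JA: "J \<subseteq> A" using psi_J by (auto simp: A_def)
    obtain x where x: "psi x = [:0, 1:]" by (rule psi_obtain)
    have "ideal (cls ` A) R" by (rule ideal_cls_image[OF A JA])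
    moreover have "P \<subseteq> cls ` A"
      using g(1) \<open>g = 0\<close> ideal_eq_cls_pre[OF maximalideal.axioms(1)[OF assms]]
      by (auto simp: A_def)
    ultimately have "cls ` A = P \<or> cls ` A = carrier R"
      using maximalideal.I_maximal[OF assms, of "cls ` A"] cls_carrier by blast
    moreover have "x \<in> A" "cls x \<notin> P" using x g(1) \<open>g = 0\<close> by (auto simp: A_def)
    moreover have "cls 1 \<notin> cls ` A"
      by (subst mem_cls_image_iff[OF A JA]) (auto simp: A_def psi_one is_unit_iff_degree)
    ultimately show False using cls_carrier by blast
  qed
  with g show ?thesis using that by blast
qed

lemma height_maximal:
  assumes "maximalideal P R"
  shows "height R P = 1"
proof (rule antisym)
  show "height R P \<le> 1"
    unfolding height_def
    by (rule SUP_least) (auto dest!: prime_chain_length_le_one simp flip: one_enat_def simp: enat_1_iff one_enat_def)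
  define Q where "Q i = (if i = (0::nat) then cls ` {f. psi f = 0} else P)" for i
  have P: "primeideal P R" by (rule maximal_imp_prime[OF assms])
  obtain g where g: "\<And>f. cls f \<in> P \<longleftrightarrow> g dvd psi f" "\<not> g dvd 1" "g \<noteq> 0"
    using maximal_generator[OF assms] by blast
  obtain G where G: "psi G = g" by (rule psi_obtain)
  have "cls G \<in> P" "cls G \<notin> cls ` {f. psi f = 0}"
    using g G by (auto simp: mem_cls_image_iff[OF tc_ideal_kernel J_subset_kernel])
  moreover have "cls ` {f. psi f = 0} \<subseteq> P" using prime_pre_kernel[OF P] by auto
  ultimately have "cls ` {f. psi f = 0} \<subset> P" by blast
  then have "prime_chain R 1 Q"
    using P primeideal_kernel by (auto simp: prime_chain_def Q_def)
  then show "1 \<le> height R P"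
    unfolding height_def by (intro SUP_upper2[of 1]) (auto simp: Q_def one_enat_def)
qed

section \<open>Regular sequences and depth\<close>

lemma genideal_empty: "Idl\<^bsub>R\<^esub> {} = {\<zero>\<^bsub>R\<^esub>}"
proof
  show "Idl\<^bsub>R\<^esub> {} \<subseteq> {\<zero>\<^bsub>R\<^esub>}" by (rule genideal_minimal[OF zeroideal]) simp
  show "{\<zero>\<^bsub>R\<^esub>} \<subseteq> Idl\<^bsub>R\<^esub> {}"
    using additive_subgroup.zero_closed[OF ideal.axioms(1)[OF genideal_ideal[of "{}"]]] by simp
qed

lemma mem_genideal_singleton: "cls y \<in> Idl\<^bsub>R\<^esub> {cls f} \<longleftrightarrow> (\<exists>h. y - h * f \<in> J)"
proof -
  have "cls y \<in> Idl\<^bsub>R\<^esub> {cls f} \<longleftrightarrow> (\<exists>h. cls y = cls (h * f))"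
    by (subst cgenideal_eq_genideal[symmetric]) (auto simp: cgenideal_def carrier_R cls_mult)
  then show ?thesis by (simp add: cls_eq_iff)
qed

text \<open>Divide f by g as often as possible. The remaining factor is h, and each removed factor g
  divides rho.\<close>

lemma exists_power_mult_dvd:
  fixes f rho g :: "'k poly"
  assumes "f \<noteq> 0" "g dvd rho" "\<not> g dvd 1"
  shows "\<exists>h k. \<not> g dvd h \<and> f dvd rho ^ k * h"
  using assms(1)
proof (induction "degree f" arbitrary: f rule: less_induct)
  case less
  show ?case
  proof (cases "g dvd f")
    case False
    then show ?thesis by (intro exI[of _ f] exI[of _ 0]) auto
  next
    case True
    then obtain f' where f': "f = g * f'" ..
    with less.prems have nz: "g \<noteq> 0" "f' \<noteq> 0" by auto
    have "degree g > 0" using assms(3) nz(1) is_unit_iff_degree[of g] by auto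
    then have "degree f' < degree f" using f' nz by (simp add: degree_mult_eq)
    then obtain h k where hk: "\<not> g dvd h" "f' dvd rho ^ k * h" using less.hyps nz(2) by blast
    have "f dvd rho * (rho ^ k * h)" unfolding f' using assms(2) hk(2) by (rule mult_dvd_mono)
    with hk(1) show ?thesis by (intro exI[of _ h] exI[of _ "Suc k"]) (simp add: ac_simps)
  qed
qed

text \<open>Being a nonzerodivisor, \<open>f1\<close> is not nilpotent, so its image is nonzero.
  Some power of \<open>f2\<close> times an element \<open>H\<close> outside \<open>P\<close> is then
  a multiple of \<open>f1\<close> up to a nilpotent. A power of this relation lies in the ideal of
  \<open>f1\<close>; cancelling \<open>f2\<close> there puts a power of \<open>H\<close> into that
  ideal and so into \<open>P\<close>, a contradiction.\<close>

lemma regular_sequence_length_le_one: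
  assumes P: "maximalideal P R" and reg: "regular_sequence R rs" and sub: "set rs \<subseteq> P"
  shows "length rs \<le> 1"
proof (rule ccontr)
  assume "\<not> length rs \<le> 1"
  then obtain r1 r2 rs' where rs: "rs = r1 # r2 # rs'"
    by (metis One_nat_def le_numeral_extra(4) length_0_conv length_Suc_conv linorder_le_less_linear
        list.exhaust list.size(3) zero_le)
  obtain f1 f2 where f12: "r1 = cls f1" "r2 = cls f2"
    using reg by (auto simp: regular_sequence_def rs carrier_R)
  define A where "A = {y. \<exists>h. y - h * f1 \<in> J}"
  have A: "tc_ideal A"
  proof -
    have "A = {y. cls y \<in> Idl\<^bsub>R\<^esub> {cls f1}}" by (simp add: A_def mem_genideal_singleton)
    then show ?thesis using tc_ideal_pre[OF genideal_ideal[of "{cls f1}"]] by simp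
  qed
  have reg1: "y \<in> J" if "f1 * y \<in> J" for y
  proof -
    have "\<forall>y\<in>carrier R. r1 \<otimes>\<^bsub>R\<^esub> y \<in> Idl\<^bsub>R\<^esub> {} \<longrightarrow> y \<in> Idl\<^bsub>R\<^esub> {}"
      using reg unfolding regular_sequence_def rs by (auto dest!: spec[of _ 0])
    then show ?thesis using that by (auto simp: genideal_empty f12 simp flip: cls_mult cls_zero_iff)
  qed
  have reg2: "y \<in> A" if "f2 * y \<in> A" for y
  proof -
    have "\<forall>y\<in>carrier R. r2 \<otimes>\<^bsub>R\<^esub> y \<in> Idl\<^bsub>R\<^esub> {r1} \<longrightarrow> y \<in> Idl\<^bsub>R\<^esub> {r1}"
      using reg unfolding regular_sequence_def rs by (auto dest!: spec[of _ "Suc 0"])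
    then show ?thesis using that
      by (auto simp: f12 A_def simp flip: cls_mult mem_genideal_singleton)
  qed
  have pr: "primeideal P R" by (rule maximal_imp_prime[OF P])
  obtain g where g: "\<And>f. cls f \<in> P \<longleftrightarrow> g dvd psi f" "\<not> g dvd 1" "g \<noteq> 0"
    using maximal_generator[OF P] by blast
  have f1P: "cls f1 \<in> P" and f2P: "cls f2 \<in> P" using sub f12 rs by auto
  have AP: "cls y \<in> P" if y: "y \<in> A" for y
  proof -
    obtain h where "y - h * f1 \<in> J" using y unfolding A_def by blast
    then have "psi y = psi h * psi f1" using psi_J[of "y - h * f1"] by (simp add: psi_diff psi_mult)
    then show ?thesis using g(1) f1P by simp
  qed
  have "psi f1 \<noteq> 0"
  proof
    assume "psi f1 = 0"
    then obtain L where "f1 ^ L \<in> J" using nilpotent by blast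
    then have "1 \<in> J" by (induction L) (auto intro: reg1)
    then show False using psi_J[of 1] psi_one by simp
  qed
  then obtain h k where hk: "\<not> g dvd h" "psi f1 dvd psi f2 ^ k * h"
    using exists_power_mult_dvd[of "psi f1" g "psi f2"] g f2P by blast
  obtain H where H: "psi H = h" by (rule psi_obtain)
  from hk(2) obtain c where c: "psi f2 ^ k * h = psi f1 * c" ..
  obtain C where C: "psi C = c" by (rule psi_obtain)
  have "psi (f2 ^ k * H - C * f1) = 0"
    using c by (simp add: psi_diff psi_mult psi_power H C ac_simps)
  then obtain L where L: "(f2 ^ k * H - C * f1) ^ L \<in> J" using nilpotent by blast
  have "J \<subseteq> A" by (auto simp: A_def intro!: exI[of _ 0])
  moreover have "C * f1 \<in> A"
    using tc_idealD(1)[OF tc_ideal_J] by (auto simp: A_def intro!: exI[of _ C])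
  ultimately have "(f2 ^ k * H) ^ L \<in> A" using tc_ideal_power_diff[OF A] L by blast
  then have "f2 ^ (k * L) * H ^ L \<in> A" by (simp add: power_mult_distrib power_mult)
  moreover have "f2 ^ N * H ^ L \<in> A \<Longrightarrow> H ^ L \<in> A" for N
    by (induction N) (auto intro: reg2 simp: mult.assoc)
  ultimately have "H ^ L \<in> A" by blast
  then have "cls H \<in> P" using AP prime_pre_power[OF pr] by blast
  then show False using g(1) hk(1) H by blast
qed

lemma depth_maximal_eq_one_iff:
  assumes P: "maximalideal P R"
  shows "depth R P = 1 \<longleftrightarrow> (\<exists>f. cls f \<in> P \<and> (\<forall>y. f * y \<in> J \<longrightarrow> y \<in> J))"
proof
  assume d: "depth R P = 1"
  have "\<exists>rs. regular_sequence R rs \<and> set rs \<subseteq> P \<and> rs \<noteq> []"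
  proof (rule ccontr)
    assume "\<not> ?thesis"
    then have "depth R P \<le> 0" unfolding depth_def by (intro SUP_least) (auto simp: zero_enat_def)
    with d show False by simp
  qed
  then obtain r rs where rs: "regular_sequence R (r # rs)" "r \<in> P"
    by (metis list.exhaust list.set_intros(1) subset_code(1))
  then obtain f where f: "r = cls f" by (auto simp: regular_sequence_def carrier_R)
  have "\<forall>y\<in>carrier R. r \<otimes>\<^bsub>R\<^esub> y \<in> Idl\<^bsub>R\<^esub> {} \<longrightarrow> y \<in> Idl\<^bsub>R\<^esub> {}"
    using rs(1) unfolding regular_sequence_def by (auto dest!: spec[of _ 0])
  then have "\<forall>y. f * y \<in> J \<longrightarrow> y \<in> J"
    by (auto simp: genideal_empty f simp flip: cls_mult cls_zero_iff)
  with rs(2) f show "\<exists>f. cls f \<in> P \<and> (\<forall>y. f * y \<in> J \<longrightarrow> y \<in> J)" by blast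
next
  assume "\<exists>f. cls f \<in> P \<and> (\<forall>y. f * y \<in> J \<longrightarrow> y \<in> J)"
  then obtain f where f: "cls f \<in> P" "\<And>y. f * y \<in> J \<Longrightarrow> y \<in> J" by blast
  have I: "ideal P R" using P by (simp add: maximalideal.axioms)
  have "Idl\<^bsub>R\<^esub> {cls f} \<subseteq> P" by (rule genideal_minimal[OF I]) (use f in auto)
  then have "Idl\<^bsub>R\<^esub> {cls f} \<noteq> carrier R"
    using maximalideal.I_notcarr[OF P] additive_subgroup.a_subset[OF ideal.axioms(1)[OF I]] by blast
  then have "regular_sequence R [cls f]"
    using f(2) unfolding regular_sequence_def
    by (auto simp: genideal_empty carrier_R cls_zero_iff simp flip: cls_mult)
  then have "1 \<le> depth R P"
    unfolding depth_def by (intro SUP_upper2[of "[cls f]"]) (auto simp: one_enat_def f)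
  moreover have "depth R P \<le> 1"
    unfolding depth_def using regular_sequence_length_le_one[OF P]
    by (intro SUP_least) (auto simp: one_enat_def)
  ultimately show "depth R P = 1" by simp
qed

text \<open>Height is 1 and depth is at most 1 at every maximal ideal, so equality means that the
  ideal contains a nonzerodivisor.\<close>

lemma cohen_macaulay_iff:
  assumes "noetherian_ring R"
  shows "cohen_macaulay R \<longleftrightarrow>
    (\<forall>P. maximalideal P R \<longrightarrow> (\<exists>f. cls f \<in> P \<and> (\<forall>y. f * y \<in> J \<longrightarrow> y \<in> J)))"
  using assms cring_R height_maximal depth_maximal_eq_one_iff by (auto simp: cohen_macaulay_def)

text \<open>An element outside the set has an image with nonzero constant term and is therefore
  invertible modulo the set. This is the maximal ideal at which \<open>not_cohen_macaulay_if\<close>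
  finds the failure.\<close>

lemma maximalideal_origin: "maximalideal (cls ` {f. Polynomial.coeff (psi f) 0 = 0}) R"
proof -
  define A where "A = {f. Polynomial.coeff (psi f) 0 = 0}"
  have A: "tc_ideal A" by (auto simp: tc_ideal_def A_def psi_zero psi_add psi_mult coeff_mult)
  have JA: "J \<subseteq> A" using psi_J by (auto simp: A_def)
  have "maximalideal (cls ` A) R"
  proof (rule maximalidealI)
    show "ideal (cls ` A) R" by (rule ideal_cls_image[OF A JA])
    have "cls 1 \<notin> cls ` A"
      by (subst mem_cls_image_iff[OF A JA]) (auto simp: A_def psi_one)
    then show "carrier R \<noteq> cls ` A" using cls_carrier by blast
    fix B assume B: "ideal B R" "cls ` A \<subseteq> B" "B \<subseteq> carrier R"
    show "B = cls ` A \<or> B = carrier R"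
    proof (cases "B \<subseteq> cls ` A")
      case False
      then obtain x' where x': "x' \<in> B" "x' \<notin> cls ` A" by auto
      moreover from x'(1) B(3) obtain x where "x' = cls x" unfolding carrier_R by auto
      ultimately have x: "cls x \<in> B" "cls x \<notin> cls ` A" by auto
      define c where "c = Polynomial.coeff (psi x) 0"
      have "c \<noteq> 0" using x(2) by (auto simp: c_def A_def)
      obtain z where z: "psi z = [:inverse c:]" by (rule psi_obtain)
      have "1 - z * x \<in> A"
        using \<open>c \<noteq> 0\<close> by (simp add: A_def psi_diff psi_mult psi_one z c_def)
      then have "1 - z * x \<in> {f. cls f \<in> B}" using B(2) by auto
      moreover have "z * x \<in> {f. cls f \<in> B}" using tc_idealD(3)[OF tc_ideal_pre[OF B(1)]] x by blast
      ultimately have "1 \<in> {f. cls f \<in> B}" using tc_ideal_diff_iff[OF tc_ideal_pre[OF B(1)]] by blast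
      then show ?thesis using ideal.one_imp_carrier[OF B(1)] by (simp add: cls_one)
    qed (use B in auto)
  qed
  then show ?thesis by (simp add: A_def)
qed

text \<open>An ideal of \<open>R\<close> is a submodule of a finitely generated module over the
  principal ideal domain K[t]. The module generators are removed one at a time, each by means of the
  ideal of its possible coefficients.\<close>

lemma noetherian_if_finite_over_poly:
  fixes iota :: "'k poly \<Rightarrow> 'a"
  assumes iota: "iota 0 = 0" "\<And>p q. iota (p + q) = iota p + iota q" "\<And>p q. iota (p * q) = iota p * iota q"
    and B: "finite B" "\<And>f. \<exists>h. f - (\<Sum>b\<in>B. iota (h b) * b) \<in> J"
  shows "noetherian_ring R"
proof (rule noetherian_ringI)
  fix I assume I: "ideal I R"
  define A where "A = {f. cls f \<in> I}"
  have A: "tc_ideal A" and JA: "J \<subseteq> A"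
    using tc_ideal_pre[OF I] J_subset_pre[OF I] by (auto simp: A_def)
  define M where "M S = {f. \<exists>h. f - (\<Sum>b\<in>S. iota (h b) * b) \<in> J}" for S
  have iota_diff: "iota (p - q) = iota p - iota q" for p q
    using iota(2)[of "p - q" q] by simp
  have M_zero: "0 \<in> M S" for S
    using tc_idealD(1)[OF tc_ideal_J] by (auto simp: M_def iota intro!: exI[of _ "\<lambda>_. 0"])
  have M_diff: "f - g \<in> M S" if fg: "f \<in> M S" "g \<in> M S" for f g S
  proof -
    obtain h h' where "f - (\<Sum>b\<in>S. iota (h b) * b) \<in> J" "g - (\<Sum>b\<in>S. iota (h' b) * b) \<in> J"
      using fg by (auto simp: M_def)
    from tc_ideal_diff[OF tc_ideal_J this] have "f - g - (\<Sum>b\<in>S. iota (h b - h' b) * b) \<in> J"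
      by (simp add: iota_diff left_diff_distrib sum_subtractf algebra_simps)
    then show ?thesis by (auto simp: M_def intro!: exI[of _ "\<lambda>b. h b - h' b"])
  qed
  have M_mult: "iota c * f \<in> M S" if f: "f \<in> M S" for f S c
  proof -
    obtain h where "f - (\<Sum>b\<in>S. iota (h b) * b) \<in> J" using f by (auto simp: M_def)
    from tc_idealD(3)[OF tc_ideal_J this, of "iota c"]
    have "iota c * f - (\<Sum>b\<in>S. iota (c * h b) * b) \<in> J"
      by (simp add: iota sum_distrib_left right_diff_distrib ac_simps)
    then show ?thesis by (auto simp: M_def intro!: exI[of _ "\<lambda>b. c * h b"])
  qed
  have M_add: "f + g \<in> M S" if "f \<in> M S" "g \<in> M S" for f g S
    using M_diff[OF that(1) M_diff[OF M_zero that(2)]] by simp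
  have "\<exists>G. finite G \<and> G \<subseteq> A \<and> (\<forall>D. tc_ideal D \<longrightarrow> J \<subseteq> D \<longrightarrow> G \<subseteq> D \<longrightarrow> A \<inter> M S \<subseteq> D)"
    if "finite S" for S
    using that
  proof (induction S rule: finite_induct)
    case empty
    show ?case by (rule exI[of _ "{}"]) (auto simp: M_def)
  next
    case (insert b S)
    then obtain G where G: "finite G" "G \<subseteq> A"
      "\<And>D. tc_ideal D \<Longrightarrow> J \<subseteq> D \<Longrightarrow> G \<subseteq> D \<Longrightarrow> A \<inter> M S \<subseteq> D" by blast
    \<comment> \<open>The coefficients that \<open>b\<close> can have in an element of
      \<open>A\<close>, modulo the span of \<open>S\<close>. The element \<open>z\<close> below
      realizes a generator of this ideal and is the new generator of \<open>A\<close>.\<close>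
    define H where "H = {h. \<exists>f\<in>A. f - iota h * b \<in> M S}"
    have "tc_ideal H"
      unfolding tc_ideal_def
    proof (intro conjI ballI allI)
      show "0 \<in> H" using M_zero tc_idealD(1)[OF A] by (auto simp: H_def iota intro!: bexI[of _ 0])
      fix x assume "x \<in> H"
      then obtain f where f: "f \<in> A" "f - iota x * b \<in> M S" by (auto simp: H_def)
      {
        fix y assume "y \<in> H"
        then obtain g where g: "g \<in> A" "g - iota y * b \<in> M S" by (auto simp: H_def)
        from M_add[OF f(2) g(2)] have "(f + g) - iota (x + y) * b \<in> M S"
          by (simp add: iota algebra_simps)
        then show "x + y \<in> H" using tc_idealD(2)[OF A f(1) g(1)] by (auto simp: H_def)
      }
      fix r
      from M_mult[OF f(2), of r] have "iota r * f - iota (r * x) * b \<in> M S"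
        by (simp add: iota algebra_simps)
      then show "r * x \<in> H" using tc_idealD(3)[OF A f(1)] by (auto simp: H_def)
    qed
    then obtain g where g: "g \<in> H" "\<And>x. x \<in> H \<Longrightarrow> g dvd x"
      using poly_tc_ideal_principal by blast
    then obtain z where z: "z \<in> A" "z - iota g * b \<in> M S" by (auto simp: H_def)
    show ?case
    proof (intro exI[of _ "insert z G"] conjI allI impI)
      fix D assume D: "tc_ideal D" "J \<subseteq> D" "insert z G \<subseteq> D"
      show "A \<inter> M (insert b S) \<subseteq> D"
      proof
        fix y assume y: "y \<in> A \<inter> M (insert b S)"
        then obtain h where "y - (\<Sum>b\<in>insert b S. iota (h b) * b) \<in> J" by (auto simp: M_def)
        then have 1: "y - iota (h b) * b \<in> M S"
          using insert.hyps by (auto simp: M_def algebra_simps)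
        then have "h b \<in> H" using y by (auto simp: H_def)
        then obtain c where c: "h b = g * c" using g(2) unfolding dvd_def by blast
        have "(y - iota (h b) * b) - iota c * (z - iota g * b) \<in> M S"
          by (intro M_diff 1 M_mult z)
        then have "y - iota c * z \<in> M S" by (simp add: c iota algebra_simps)
        moreover have "y - iota c * z \<in> A"
          using y z by (auto intro!: tc_ideal_diff[OF A] intro: tc_idealD[OF A])
        ultimately have "y - iota c * z \<in> D" using G(3)[OF D(1,2)] D(3) by blast
        moreover have "iota c * z \<in> D" using D by (auto intro: tc_idealD)
        ultimately show "y \<in> D" using tc_ideal_diff_iff[OF D(1)] by blast
      qed
    qed (use G z in auto)
  qed
  from this[OF B(1)] obtain G where G: "finite G" "G \<subseteq> A"
    "\<And>D. tc_ideal D \<Longrightarrow> J \<subseteq> D \<Longrightarrow> G \<subseteq> D \<Longrightarrow> A \<inter> M B \<subseteq> D" by blast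
  have MB: "M B = UNIV" using B(2) by (auto simp: M_def)
  have GI: "ideal (Idl\<^bsub>R\<^esub> (cls ` G)) R" by (rule genideal_ideal) auto
  have "I = Idl\<^bsub>R\<^esub> (cls ` G)"
  proof
    show "Idl\<^bsub>R\<^esub> (cls ` G) \<subseteq> I" by (rule genideal_minimal[OF I]) (use G(2) in \<open>auto simp: A_def\<close>)
    have "G \<subseteq> {f. cls f \<in> Idl\<^bsub>R\<^esub> (cls ` G)}"
      using genideal_self[of "cls ` G"] cls_carrier by blast
    then have "A \<subseteq> {f. cls f \<in> Idl\<^bsub>R\<^esub> (cls ` G)}"
      using G(3)[OF tc_ideal_pre[OF GI]] J_subset_pre[OF GI] MB by auto
    then have "cls ` A \<subseteq> Idl\<^bsub>R\<^esub> (cls ` G)" by blast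
    then show "I \<subseteq> Idl\<^bsub>R\<^esub> (cls ` G)"
      using ideal_eq_cls_pre[OF I] by (simp add: A_def)
  qed
  then show "\<exists>A\<subseteq>carrier R. finite A \<and> I = Idl\<^bsub>R\<^esub> A"
    using G(1) by (intro exI[of _ "cls ` G"]) auto
qed

end

section \<open>The initial ideal of the toric ideal\<close>

lemma mon_degree_zero [simp]: "mon_degree 0 = 0"
  by (simp add: mon_degree_def)

lemma mon_degree_add [simp]: "mon_degree (m + m') = mon_degree m + mon_degree m'"
  by (simp add: mon_degree_def lookup_add sum.distrib)

lemma mon_degree_single [simp]: "mon_degree (Poly_Mapping.single i k) = k"
  by (simp add: mon_degree_def lookup_single when_def)

lemma mon_degree_eq_0_iff: "mon_degree m = 0 \<longleftrightarrow> m = 0"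
  by (auto simp: mon_degree_def poly_mapping_eq_iff fun_eq_iff)

lemma monomial_split:
  fixes m :: "4 \<Rightarrow>\<^sub>0 nat"
  assumes "k \<le> Poly_Mapping.lookup m i"
  obtains m' where "m = Poly_Mapping.single i k + m'"
proof
  show "m = Poly_Mapping.single i k + (m - Poly_Mapping.single i k)"
    by (rule poly_mapping_eqI) (use assms in \<open>auto simp: lookup_add lookup_minus lookup_single when_def\<close>)
qed

lemma lookup_hom_component:
  "Poly_Mapping.lookup (hom_component d f) m = (if mon_degree m = d then Poly_Mapping.lookup f m else 0)"
  unfolding hom_component_def
  by (auto simp: lookup_sum lookup_single when_def in_keys_iff)

lemma coeff_sum_hom_component:
  "coeff_sum T (hom_component d f) = coeff_sum {m \<in> T. mon_degree m = d} f"
proof -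
  have "Poly_Mapping.keys (hom_component d f) \<subseteq> Poly_Mapping.keys f"
    by (auto simp: in_keys_iff lookup_hom_component split: if_splits)
  then show ?thesis
    by (subst (1 2) coeff_sum_superset[of "Poly_Mapping.keys f"])
       (auto simp: lookup_hom_component intro!: sum.cong)
qed

lemma initial_form_pmon_diff:
  assumes "m \<noteq> m'" "mon_degree m \<le> mon_degree m'"
  shows "initial_form (pmon m - pmon m' :: 'k::field poly4) =
    (if mon_degree m = mon_degree m' then pmon m - pmon m' else pmon m)"
proof -
  have "Poly_Mapping.keys (pmon m - pmon m' :: 'k poly4) = {m, m'}"
    using assms(1) by (auto simp: in_keys_iff lookup_minus lookup_single when_def split: if_splits)
  then have "initial_form (pmon m - pmon m' :: 'k poly4) = hom_component (mon_degree m) (pmon m - pmon m')"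
    using assms by (simp add: initial_form_def)
  then show ?thesis
    using assms by (intro poly_mapping_eqI)
      (auto simp: lookup_hom_component lookup_minus lookup_single when_def)
qed

locale monomial_curve =
  fixes n :: "4 \<Rightarrow> nat"
  assumes n_pos: "0 < n i" and n1_min: "n 1 \<le> n i"
begin

definition wt :: "(4 \<Rightarrow>\<^sub>0 nat) \<Rightarrow> nat" where
  "wt m = (\<Sum>i\<in>UNIV. Poly_Mapping.lookup m i * n i)"

lemma wt_zero [simp]: "wt 0 = 0"
  by (simp add: wt_def)

lemma wt_add [simp]: "wt (m + m') = wt m + wt m'"
  by (simp add: wt_def lookup_add sum.distrib algebra_simps)

lemma wt_single [simp]: "wt (Poly_Mapping.single i k) = k * n i"
proof -
  have "wt (Poly_Mapping.single i k) = (\<Sum>j\<in>UNIV. if i = j then k * n j else 0)"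
    unfolding wt_def by (intro sum.cong) (auto simp: lookup_single when_def)
  then show ?thesis by simp
qed

lemma mon_degree_n1_le_wt: "n 1 * mon_degree m \<le> wt m"
  unfolding wt_def mon_degree_def sum_distrib_left
  by (intro sum_mono) (use n1_min in \<open>auto simp: mult.commute\<close>)

lemma mon_degree_le_wt: "mon_degree m \<le> wt m"
  using mon_degree_n1_le_wt[of m] n_pos[of 1]
  by (metis One_nat_def Suc_leI le_trans mult_le_mono1 nat_mult_1)

text \<open>In terms of the numerical semigroup generated by n, a monomial is maximal iff its degree is
  the order of its weight.\<close>

definition maximal :: "(4 \<Rightarrow>\<^sub>0 nat) \<Rightarrow> bool" where
  "maximal m \<longleftrightarrow> (\<forall>m'. wt m' = wt m \<longrightarrow> mon_degree m' \<le> mon_degree m)"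

definition fib :: "(4 \<Rightarrow>\<^sub>0 nat) \<Rightarrow> (4 \<Rightarrow>\<^sub>0 nat) set" where
  "fib m = {m'. wt m' = wt m \<and> mon_degree m' = mon_degree m}"

definition max_fibs :: "(4 \<Rightarrow>\<^sub>0 nat) set set" where
  "max_fibs = fib ` {m. maximal m}"

abbreviation tangent_ideal :: "'k::field poly4 set" where
  "tangent_ideal \<equiv> coeff_null max_fibs"

lemma maximal_fib_cong: "wt m = wt m' \<Longrightarrow> mon_degree m = mon_degree m' \<Longrightarrow> maximal m = maximal m'"
  by (simp add: maximal_def)

lemma maximal_wt_eqD: "maximal m \<Longrightarrow> maximal m' \<Longrightarrow> wt m = wt m' \<Longrightarrow> mon_degree m = mon_degree m'"
  unfolding maximal_def by (metis antisym)

lemma exists_maximal: "\<exists>t. wt t = wt m \<and> maximal t \<and> mon_degree m \<le> mon_degree t"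
proof -
  obtain t where "wt t = wt m" "\<forall>y. wt y = wt m \<longrightarrow> mon_degree y \<le> mon_degree t"
    using ex_has_greatest_nat[of "\<lambda>t. wt t = wt m" m mon_degree "Suc (wt m)"] mon_degree_le_wt
    by (metis le_imp_less_Suc)
  then show ?thesis by (auto simp: maximal_def)
qed

lemma not_maximalE:
  assumes "\<not> maximal m"
  obtains t where "wt t = wt m" "maximal t" "mon_degree m < mon_degree t"
  using exists_maximal[of m] assms maximal_fib_cong by (metis le_neq_implies_less)

lemma not_maximal_add: "\<not> maximal a \<Longrightarrow> \<not> maximal (b + a)"
  unfolding maximal_def by (metis add_le_cancel_left mon_degree_add wt_add)

text \<open>Divisors of maximal monomials are maximal, and cancelling \<open>a\<close> respects
  equality of weight and degree. So a shifted class is empty or again a class of maximal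
  monomials.\<close>

lemma max_fibs_shift:
  assumes "T \<in> max_fibs"
  shows "{m. a + m \<in> T} = {} \<or> {m. a + m \<in> T} \<in> max_fibs"
proof (cases "{m. a + m \<in> T} = {}")
  case False
  then obtain m1 where m1: "a + m1 \<in> T" by auto
  obtain t where t: "maximal t" "T = fib t" using assms by (auto simp: max_fibs_def)
  have "maximal m1"
    using not_maximal_add[of m1 a] m1 t maximal_fib_cong[of "a + m1" t] by (auto simp: fib_def)
  moreover have "{m. a + m \<in> T} = fib m1"
    using m1 t by (auto simp: fib_def)
  ultimately show ?thesis by (auto simp: max_fibs_def)
qed auto

lemma tc_ideal_tangent: "tc_ideal (tangent_ideal :: 'k::field poly4 set)"
  by (rule tc_ideal_coeff_null) (rule max_fibs_shift)

lemma mem_tangent_iff: "f \<in> tangent_ideal \<longleftrightarrow> (\<forall>m. maximal m \<longrightarrow> coeff_sum (fib m) f = 0)"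
  by (auto simp: coeff_null_def max_fibs_def)

lemma pmon_tangent_iff: "(pmon m :: 'k::field poly4) \<in> tangent_ideal \<longleftrightarrow> \<not> maximal m"
proof
  assume "(pmon m :: 'k poly4) \<in> tangent_ideal"
  then show "\<not> maximal m" by (auto simp: mem_tangent_iff fib_def)
next
  assume m: "\<not> maximal m"
  have "m \<notin> fib t" if "maximal t" for t
    using m that maximal_fib_cong[of m t] by (auto simp: fib_def)
  then show "(pmon m :: 'k poly4) \<in> tangent_ideal" by (simp add: mem_tangent_iff)
qed

lemma pmon_diff_tangent:
  "wt m = wt m' \<Longrightarrow> mon_degree m = mon_degree m' \<Longrightarrow> (pmon m - pmon m' :: 'k::field poly4) \<in> tangent_ideal"
  by (simp add: mem_tangent_iff fib_def coeff_sum_diff)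

text \<open>Nonmaximal monomials and differences of maximal monomials of equal weight span the
  tangent ideal: after each maximal monomial of f is replaced by a representative of its weight, the
  coefficients are exactly the functionals that vanish on f.\<close>

lemma tangent_ideal_subset:
  assumes G: "tc_ideal (G :: 'k::field poly4 set)"
    and 1: "\<And>m. \<not> maximal m \<Longrightarrow> pmon m \<in> G"
    and 2: "\<And>m m'. maximal m \<Longrightarrow> maximal m' \<Longrightarrow> wt m = wt m' \<Longrightarrow> pmon m - pmon m' \<in> G"
  shows "tangent_ideal \<subseteq> G"
proof
  fix f :: "'k poly4" assume f: "f \<in> tangent_ideal"
  define r where "r m = (SOME t. maximal t \<and> wt t = wt m)" for m
  have r: "maximal (r m) \<and> wt (r m) = wt m" for m
    unfolding r_def by (rule someI_ex) (use exists_maximal[of m] in auto)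
  have r_eq: "r m = r m' \<longleftrightarrow> wt m = wt m'" for m m'
  proof
    show "r m = r m' \<Longrightarrow> wt m = wt m'" using r[of m] r[of m'] by simp
    show "wt m = wt m' \<Longrightarrow> r m = r m'" by (simp add: r_def)
  qed
  let ?c = "Poly_Mapping.lookup f"
  define S where "S = {m \<in> Poly_Mapping.keys f. maximal m}"
  have "finite S" by (simp add: S_def)
  have zero: "(\<Sum>m\<in>S. Poly_Mapping.single (r m) (?c m)) = 0"
  proof (rule sum_single_representatives_eq_zero[where r = r and S = S and c = ?c])
    show "finite S" by fact
    fix s assume "s \<in> r ` S"
    then obtain m0 where m0: "maximal m0" "s = r m0" by (auto simp: S_def)
    have eq: "m \<in> fib m0 \<longleftrightarrow> maximal m \<and> r m = s" for m
    proof
      assume "m \<in> fib m0"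
      then show "maximal m \<and> r m = s"
        using m0 maximal_fib_cong[of m m0] by (simp add: fib_def r_eq)
    next
      assume "maximal m \<and> r m = s"
      then show "m \<in> fib m0" using m0 maximal_wt_eqD[of m m0] by (simp add: fib_def r_eq)
    qed
    have "(\<Sum>m\<in>{m \<in> S. r m = s}. ?c m) = (\<Sum>m\<in>Poly_Mapping.keys f. if m \<in> fib m0 then ?c m else 0)"
      unfolding eq by (rule sum.mono_neutral_cong_left) (auto simp: S_def)
    also have "\<dots> = 0"
      using f m0(1) unfolding mem_tangent_iff coeff_sum_def by blast
    finally show "(\<Sum>m\<in>{m \<in> S. r m = s}. ?c m) = 0" .
  qed
  define A where "A = (\<Sum>m\<in>S. Poly_Mapping.single m (?c m))"
  define B where "B = (\<Sum>m\<in>Poly_Mapping.keys f - S. Poly_Mapping.single m (?c m))"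
  have A_eq: "A = (\<Sum>m\<in>S. Poly_Mapping.single m (?c m) - Poly_Mapping.single (r m) (?c m))"
    by (simp add: A_def sum_subtractf zero)
  have "Poly_Mapping.single m (?c m) - Poly_Mapping.single (r m) (?c m) \<in> G" if "m \<in> S" for m
    using that r[of m] by (intro tc_ideal_single_diff[OF G 2]) (auto simp: S_def)
  then have "A \<in> G" unfolding A_eq by (rule tc_ideal_sum[OF G])
  moreover have "B \<in> G"
    unfolding B_def by (intro tc_ideal_sum[OF G] tc_ideal_single[OF G 1]) (auto simp: S_def)
  moreover have "f = B + A"
    unfolding A_def B_def
    by (subst sum.subset_diff[symmetric]) (auto simp: S_def simp flip: poly_mapping_eq_sum_single)
  ultimately show "f \<in> G" using tc_idealD(2)[OF G] by blast
qed

lemma prod_monom_one: "(\<Prod>i\<in>S. monom 1 (e i)) = (monom 1 (\<Sum>i\<in>S. e i) :: 'k::field poly)"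
  by (induction S rule: infinite_finite_induct) (auto simp: mult_monom)

lemma coeff_param_hom: "coeff (param_hom n f) s = coeff_sum {m. wt m = s} f"
proof -
  have "(\<Prod>i\<in>UNIV. (monom 1 (n i) :: 'a poly) ^ Poly_Mapping.lookup m i) = monom 1 (wt m)" for m
    by (simp add: monom_power prod_monom_one wt_def mult.commute)
  then show ?thesis
    by (auto simp: param_hom_def coeff_sum_def coeff_sum intro!: sum.cong)
qed

lemma toric_ideal_eq: "toric_ideal n = coeff_null (range (\<lambda>s. {m. wt m = s}))"
  by (auto simp: toric_ideal_def a_kernel_def' poly_eq_iff coeff_param_hom coeff_null_def)

lemma pmon_diff_toric: "wt m = wt m' \<Longrightarrow> (pmon m - pmon m' :: 'k::field poly4) \<in> toric_ideal n"
  by (auto simp: toric_ideal_eq coeff_null_def coeff_sum_diff)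

text \<open>For the inclusion from right to left the initial forms of binomials suffice: comparing a
  nonmaximal monomial with a maximal one of the same weight yields the monomial, and comparing two
  maximal ones yields their difference.\<close>

lemma initial_ideal_toric_eq: "initial_ideal (toric_ideal n) = (tangent_ideal :: 'k::field poly4 set)"
  unfolding initial_ideal_def
proof (rule roa_genideal_eqI)
  show "tc_ideal (tangent_ideal :: 'k poly4 set)" by (rule tc_ideal_tangent)
  show "{initial_form f |f. f \<in> toric_ideal n \<and> f \<noteq> 0} \<subseteq> (tangent_ideal :: 'k poly4 set)"
  proof safe
    fix f :: "'k poly4" assume f: "f \<in> toric_ideal n" "f \<noteq> 0"
    define d where "d = Min (mon_degree ` Poly_Mapping.keys f)"
    have d: "d \<le> mon_degree m" if "m \<in> Poly_Mapping.keys f" for m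
      unfolding d_def using that by auto
    have "coeff_sum (fib m) (hom_component d f) = 0" if m: "maximal m" for m
    proof (cases "mon_degree m = d")
      case True
      \<comment> \<open>In this weight no monomial has degree above that of \<open>m\<close>, and no
        monomial of \<open>f\<close> has degree below \<open>d\<close>. The two bounds coincide, so
        the sum over the class is a full coefficient of \<open>param_hom n f\<close>.\<close>
      have "coeff_sum (fib m) (hom_component d f) = coeff_sum {m'. wt m' = wt m} f"
        unfolding coeff_sum_hom_component unfolding coeff_sum_def
        using True m d by (intro sum.cong) (auto simp: fib_def maximal_def intro: antisym)
      also have "\<dots> = 0" using f by (auto simp: toric_ideal_eq coeff_null_def)
      finally show ?thesis .
    next
      case False
      then have "{m' \<in> fib m. mon_degree m' = d} = {}" by (auto simp: fib_def)
      then show ?thesis unfolding coeff_sum_hom_component by (simp only: coeff_sum_empty)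
    qed
    then show "initial_form f \<in> tangent_ideal"
      by (simp add: mem_tangent_iff initial_form_def flip: d_def)
  qed
next
  fix G :: "'k poly4 set"
  assume G: "tc_ideal G" "{initial_form f |f. f \<in> toric_ideal n \<and> f \<noteq> 0} \<subseteq> G"
  have *: "initial_form (pmon m - pmon m') \<in> G" if "wt m = wt m'" "m \<noteq> m'" for m m'
  proof -
    have "Poly_Mapping.lookup (pmon m - pmon m' :: 'k poly4) m = 1"
      using that(2) by (simp add: lookup_minus lookup_single)
    then have "(pmon m - pmon m' :: 'k poly4) \<noteq> 0" by auto
    then show ?thesis using G(2) pmon_diff_toric[OF that(1)] by blast
  qed
  show "tangent_ideal \<subseteq> G"
  proof (rule tangent_ideal_subset[OF G(1)])
    fix m assume "\<not> maximal m"
    then obtain t where "wt t = wt m" "mon_degree m < mon_degree t" by (rule not_maximalE)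
    then show "pmon m \<in> G" using *[of m t] by (auto simp: initial_form_pmon_diff)
  next
    fix m m' assume "maximal m" "maximal m'" "wt m = wt m'"
    then have "mon_degree m = mon_degree m'" by (rule maximal_wt_eqD)
    then show "pmon m - pmon m' \<in> G"
      using *[OF \<open>wt m = wt m'\<close>] tc_idealD(1)[OF G(1)]
      by (cases "m = m'") (auto simp: initial_form_pmon_diff)
  qed
qed

end

section \<open>Cohen--Macaulayness of the tangent cone\<close>

text \<open>The exponent is described through additive functions, so that one witness gives both the
  weight and the degree of the power.\<close>

lemma single_power:
  fixes c :: "'k::comm_ring_1"
  shows "\<exists>m'. Poly_Mapping.single m c ^ k = Poly_Mapping.single m' (c ^ k) \<and>
    (\<forall>\<phi>. \<phi> 0 = (0::nat) \<longrightarrow> (\<forall>a b. \<phi> (a + b) = \<phi> a + \<phi> b) \<longrightarrow> \<phi> m' = k * \<phi> (m::'m::comm_monoid_add))"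
proof (induction k)
  case 0
  show ?case by (intro exI[of _ 0]) (auto simp flip: single_one)
next
  case (Suc k)
  then obtain m' where "Poly_Mapping.single m c ^ k = Poly_Mapping.single m' (c ^ k)"
    "\<And>\<phi>. \<phi> 0 = (0::nat) \<Longrightarrow> (\<forall>a b. \<phi> (a + b) = \<phi> a + \<phi> b) \<Longrightarrow> \<phi> m' = k * \<phi> m" by blast
  then show ?case by (intro exI[of _ "m + m'"]) (simp add: mult_single)
qed

lemma tc_ideal_nilpotent_add:
  assumes J: "tc_ideal (J :: 'a::comm_ring_1 set)" and "f ^ a \<in> J" "g ^ b \<in> J"
  shows "(f + g) ^ (a + b) \<in> J"
proof -
  have "f ^ i * g ^ (a + b - i) \<in> J" for i
  proof (cases "a \<le> i")
    case True
    then have "f ^ i = f ^ (i - a) * f ^ a" by (simp flip: power_add)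
    then show ?thesis using assms(2) by (simp add: tc_idealD[OF J])
  next
    case False
    then have "g ^ (a + b - i) = g ^ (a - i) * g ^ b" by (simp flip: power_add)
    then show ?thesis using assms(3) by (simp add: tc_idealD[OF J])
  qed
  then show ?thesis
    unfolding binomial_ring by (intro tc_ideal_sum[OF J]) (simp add: mult.assoc tc_idealD[OF J])
qed

lemma rcos_eq_zero_iff:
  assumes "tc_ideal (J :: 'a::comm_ring_1 set)"
  shows "a_r_coset ring_of_type_algebra J f = J \<longleftrightarrow> f \<in> J"
proof -
  interpret ideal J "ring_of_type_algebra :: 'a ring" using assms by (simp add: ideal_roa_iff)
  show ?thesis using a_rcos_const[of f] a_rcos_self[of f] by auto
qed

text \<open>Substitution of a monomial for the variable of \<open>p\<close>. With x1 as the monomial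
  it embeds K[t] as K[x1] and is a section of \<open>psi\<close>.\<close>

definition poly_at :: "'k::comm_ring_1 poly \<Rightarrow> ('m::comm_monoid_add) \<Rightarrow> ('m \<Rightarrow>\<^sub>0 'k)" where
  "poly_at p e = poly (map_poly (Poly_Mapping.single 0) p) (pmon e)"

lemma poly_at_zero: "poly_at 0 e = 0"
  by (simp add: poly_at_def)

lemma poly_at_pCons: "poly_at (pCons c p) e = Poly_Mapping.single 0 c + pmon e * poly_at p e"
  by (simp add: poly_at_def map_poly_pCons)

lemma poly_at_add: "poly_at (p + q) e = poly_at p e + poly_at q e"
proof (induction p q rule: poly_induct2)
  case (pCons a p b q)
  then show ?case by (simp add: poly_at_pCons single_add algebra_simps)
qed (simp add: poly_at_zero)

lemma poly_at_smult: "poly_at (Polynomial.smult c p) e = Poly_Mapping.single 0 c * poly_at p e"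
  by (induction p) (simp_all add: poly_at_zero poly_at_pCons mult_single distrib_left mult.left_commute)

lemma poly_at_mult: "poly_at (p * q) e = poly_at p e * poly_at q e"
  by (induction p)
     (simp_all add: poly_at_zero poly_at_pCons poly_at_add poly_at_smult distrib_right mult.assoc)

context monomial_curve
begin

section \<open>The reduction of the tangent cone\<close>

definition on_face :: "(4 \<Rightarrow>\<^sub>0 nat) \<Rightarrow> bool" where
  "on_face m \<longleftrightarrow> wt m = n 1 * mon_degree m"

definition face :: "nat \<Rightarrow> (4 \<Rightarrow>\<^sub>0 nat) set" where
  "face d = {m. on_face m \<and> mon_degree m = d}"

text \<open>The monomials killed by psi are nilpotent modulo the tangent ideal; the others only involve
  variables of minimal weight.\<close>

definition psi :: "'k::field poly4 \<Rightarrow> 'k poly" where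
  "psi f = (\<Sum>m\<in>Poly_Mapping.keys f.
     monom (if on_face m then Poly_Mapping.lookup f m else 0) (mon_degree m))"

lemma coeff_psi: "Polynomial.coeff (psi f) d = coeff_sum (face d) f"
  unfolding psi_def coeff_sum coeff_sum_def
  by (intro sum.cong) (auto simp: face_def)

lemma psi_add': "psi (f + g) = psi f + psi g"
  by (rule poly_eqI) (simp add: coeff_psi coeff_sum_add)

lemma psi_single: "psi (Poly_Mapping.single m c) = (if on_face m then monom c (mon_degree m) else 0)"
  by (rule poly_eqI) (auto simp: coeff_psi face_def)

lemma on_face_add: "on_face (a + b) \<longleftrightarrow> on_face a \<and> on_face b"
  using mon_degree_n1_le_wt[of a] mon_degree_n1_le_wt[of b]
  by (auto simp: on_face_def distrib_left)

lemma on_face_zero: "on_face 0"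
  by (simp add: on_face_def)

lemma on_face_single_one: "on_face (Poly_Mapping.single 1 k)"
  by (simp add: on_face_def mult.commute)

lemma psi_zero': "psi 0 = 0"
  by (simp add: psi_def)

lemma psi_mult': "psi (f * g) = psi f * psi g"
proof -
  have "psi (Poly_Mapping.single m c * g) = psi (Poly_Mapping.single m c) * psi g" for m c
    by (induction g rule: poly_mapping_add_induct)
       (simp_all add: on_face_add psi_zero' psi_add' mult_single psi_single mult_monom distrib_left)
  then show ?thesis
    by (induction f rule: poly_mapping_add_induct) (simp_all add: psi_zero' psi_add' distrib_right)
qed

lemma psi_poly_at: "psi (poly_at p (Poly_Mapping.single 1 1)) = p"
proof (induction p)
  case (pCons c p)
  show ?case
    by (simp add: poly_at_pCons psi_add' psi_mult' psi_single pCons.IH monom_0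
        on_face_zero on_face_single_one del: One_nat_def) (simp add: monom_0 monom_Suc)
qed (simp add: poly_at_zero psi_def)

text \<open>The degree is at most the weight divided by \<open>n 1\<close>, and the face consists of
  the monomials attaining this bound.\<close>

lemma face_maximal:
  assumes "m \<in> face d"
  shows "maximal m" "face d = fib m"
proof -
  have m: "mon_degree m = d" "wt m = n 1 * d" using assms by (auto simp: face_def on_face_def)
  have "mon_degree m' \<le> d" if "wt m' = wt m" for m'
    using mon_degree_n1_le_wt[of m'] that m n_pos[of 1] by simp
  then show "maximal m" using m by (simp add: maximal_def)
  show "face d = fib m" using m by (auto simp: face_def on_face_def fib_def)
qed

lemma psi_tangent:
  assumes "f \<in> tangent_ideal"
  shows "psi f = 0"
proof (rule poly_eqI)
  fix d
  have "(Poly_Mapping.single 1 d :: 4 \<Rightarrow>\<^sub>0 nat) \<in> face d" by (simp add: face_def on_face_single_one)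
  then have "coeff_sum (face d) f = 0"
    using assms face_maximal unfolding mem_tangent_iff by metis
  then show "Polynomial.coeff (psi f) d = Polynomial.coeff 0 d"
    by (simp add: coeff_psi)
qed

text \<open>The power of \<open>m\<close> with exponent \<open>n 1\<close> has the weight of x1^(wt
  m), whose degree \<open>wt m\<close> exceeds \<open>n 1 * mon_degree m\<close> off the face. So
  this power is not maximal.\<close>

lemma single_not_face_nilpotent:
  assumes "\<not> on_face m"
  shows "\<exists>L. (Poly_Mapping.single m c :: 'k::field poly4) ^ L \<in> tangent_ideal"
proof -
  obtain m' where m': "Poly_Mapping.single m c ^ n 1 = Poly_Mapping.single m' (c ^ n 1)"
    "\<And>\<phi>. \<phi> 0 = (0::nat) \<Longrightarrow> (\<forall>a b. \<phi> (a + b) = \<phi> a + \<phi> b) \<Longrightarrow> \<phi> m' = n 1 * \<phi> m"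
    using single_power[of m c "n 1"] by blast
  have "wt m' = n 1 * wt m" "mon_degree m' = n 1 * mon_degree m"
    using m'(2)[of wt] m'(2)[of mon_degree] by auto
  moreover have "n 1 * mon_degree m < wt m"
    using assms mon_degree_n1_le_wt[of m] by (simp add: on_face_def)
  ultimately have "\<not> maximal m'"
    unfolding maximal_def by (intro notI, drule_tac spec[of _ "Poly_Mapping.single 1 (wt m)"]) simp
  then have "Poly_Mapping.single m' (c ^ n 1) \<in> tangent_ideal"
    by (simp add: tc_ideal_single[OF tc_ideal_tangent] pmon_tangent_iff)
  then show ?thesis using m'(1) by (intro exI[of _ "n 1"]) simp
qed

text \<open>Split off the sum \<open>g\<close> of the terms outside the face, which is a sum of
  nilpotents. The functionals of the remaining part are coefficients of \<open>psi f\<close>, hence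
  0.\<close>

lemma psi_zero_nilpotent:
  fixes f :: "'k::field poly4"
  assumes "psi f = 0"
  shows "\<exists>L. f ^ L \<in> tangent_ideal"
proof -
  define N where "N = {f :: 'k poly4. \<exists>L. f ^ L \<in> tangent_ideal}"
  have N_add: "f + g \<in> N" if "f \<in> N" "g \<in> N" for f g
    using that tc_ideal_nilpotent_add[OF tc_ideal_tangent] unfolding N_def by blast
  let ?F = on_face
  define g where "g = (\<Sum>m\<in>{m \<in> Poly_Mapping.keys f. \<not> ?F m}. Poly_Mapping.single m (Poly_Mapping.lookup f m))"
  have "0 \<in> N" using tc_idealD(1)[OF tc_ideal_tangent] unfolding N_def
    by (simp, intro exI[of _ 1]) simp
  have "(\<Sum>m\<in>S. Poly_Mapping.single m (Poly_Mapping.lookup f m)) \<in> N"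
    if "finite S" "\<forall>m\<in>S. \<not> ?F m" for S
    using that
  proof (induction S rule: finite_induct)
    case (insert x S)
    have "Poly_Mapping.single x (Poly_Mapping.lookup f x) \<in> N"
      using single_not_face_nilpotent[of x] insert.prems by (simp add: N_def)
    then show ?case using insert by (simp add: N_add)
  qed (simp add: \<open>0 \<in> N\<close>)
  then have "g \<in> N" by (simp add: g_def)
  moreover have "f - g \<in> tangent_ideal"
    unfolding mem_tangent_iff
  proof (intro allI impI)
    fix m assume m: "maximal m"
    have F: "?F m' \<longleftrightarrow> ?F m" if "m' \<in> fib m" for m' using that by (simp add: fib_def on_face_def)
    have lg: "Poly_Mapping.lookup g m' = (if ?F m' then 0 else Poly_Mapping.lookup f m')" for m'
      by (auto simp: g_def lookup_sum lookup_single when_def in_keys_iff)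
    have cs: "coeff_sum (fib m) g = (if ?F m then 0 else coeff_sum (fib m) f)"
    proof -
      have "Poly_Mapping.keys g \<subseteq> Poly_Mapping.keys f" by (auto simp: in_keys_iff lg split: if_splits)
      then have "coeff_sum (fib m) g =
          (\<Sum>m'\<in>Poly_Mapping.keys f. if m' \<in> fib m then Poly_Mapping.lookup g m' else 0)"
        by (intro coeff_sum_superset) auto
      also have "\<dots> = (\<Sum>m'\<in>Poly_Mapping.keys f. if ?F m then 0 else if m' \<in> fib m then Poly_Mapping.lookup f m' else 0)"
        using F by (intro sum.cong) (auto simp: lg)
      finally show ?thesis by (simp add: coeff_sum_def)
    qed
    show "coeff_sum (fib m) (f - g) = 0"
    proof (cases "?F m")
      case True
      have "coeff_sum (fib m) f = Polynomial.coeff (psi f) (mon_degree m)"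
        using face_maximal(2)[of m "mon_degree m"] True by (simp add: coeff_psi face_def)
      then show ?thesis using True cs assms by (simp add: coeff_sum_diff)
    qed (simp add: cs coeff_sum_diff)
  qed
  then have "f - g \<in> N" unfolding N_def by (simp, intro exI[of _ 1]) simp
  ultimately have "(f - g) + g \<in> N" by (intro N_add)
  then show ?thesis by (simp add: N_def)
qed

definition tangent_cone :: "'k::field itself \<Rightarrow> 'k poly4 set ring" where
  "tangent_cone _ = poly4_ring Quot tangent_ideal"

lemma quotient_presentation_tangent_cone:
  "quotient_presentation (tangent_cone TYPE('k::field))
     (a_r_coset poly4_ring tangent_ideal) (tangent_ideal :: 'k poly4 set) psi"
proof -
  interpret ideal "tangent_ideal :: 'k poly4 set" "ring_of_type_algebra :: 'k poly4 ring"
    using tc_ideal_tangent by (simp add: ideal_roa_iff)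
  let ?P = "ring_of_type_algebra :: 'k poly4 ring"
  note hom = rcos_ring_hom
  show ?thesis
    unfolding tangent_cone_def
  proof (rule quotient_presentation.intro)
    show "cring (?P Quot tangent_ideal)" by (rule quotient_is_cring[OF cring_roa])
    show "carrier (?P Quot tangent_ideal) = range (a_r_coset ?P tangent_ideal)"
      by (simp add: FactRing_def A_RCOSETS_def' image_def) blast
    fix f g :: "'k poly4"
    show "a_r_coset ?P tangent_ideal (f + g) =
        a_r_coset ?P tangent_ideal f \<oplus>\<^bsub>?P Quot tangent_ideal\<^esub> a_r_coset ?P tangent_ideal g"
      using ring_hom_add[OF hom, of f g] by simp
    show "a_r_coset ?P tangent_ideal (f * g) =
        a_r_coset ?P tangent_ideal f \<otimes>\<^bsub>?P Quot tangent_ideal\<^esub> a_r_coset ?P tangent_ideal g"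
      using ring_hom_mult[OF hom, of f g] by simp
    show "a_r_coset ?P tangent_ideal 1 = \<one>\<^bsub>?P Quot tangent_ideal\<^esub>"
      using ring_hom_one[OF hom] by simp
    show "a_r_coset ?P tangent_ideal f = \<zero>\<^bsub>?P Quot tangent_ideal\<^esub> \<longleftrightarrow> f \<in> tangent_ideal"
      using rcos_eq_zero_iff[OF tc_ideal_tangent, of f] by (simp add: FactRing_def)
    show "psi (f + g) = psi f + psi g" by (rule psi_add')
    show "psi (f * g) = psi f * psi g" by (rule psi_mult')
    show "psi (1 :: 'k poly4) = 1"
      using psi_single[of 0 "1 :: 'k"] by (simp add: on_face_zero one_pCons monom_0)
    show "surj (psi :: 'k poly4 \<Rightarrow> 'k poly)" 
      by (rule surjI[of psi "\<lambda>p. poly_at p (Poly_Mapping.single 1 1)"]) (rule psi_poly_at)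
    show "psi f = 0" if "f \<in> tangent_ideal" using that by (rule psi_tangent)
    show "\<exists>L. f ^ L \<in> tangent_ideal" if "psi f = 0" using that by (rule psi_zero_nilpotent)
  qed
qed

end

section \<open>Finiteness over the polynomial ring in x1\<close>

lemma pmon_single_power:
  "(pmon (Poly_Mapping.single i 1) :: 'k::comm_ring_1 poly4) ^ k = pmon (Poly_Mapping.single i k)"
proof (induction k)
  case (Suc k)
  then show ?case by (simp add: mult_single del: One_nat_def) (simp flip: single_add)
qed simp

lemma poly_at_altdef:
  "poly_at p (Poly_Mapping.single i 1) =
    (\<Sum>j\<le>Polynomial.degree p. Poly_Mapping.single (Poly_Mapping.single i j) (Polynomial.coeff p j) :: 'k::field poly4)"
proof -
  have "Polynomial.degree (map_poly (Poly_Mapping.single (0 :: 4 \<Rightarrow>\<^sub>0 nat)) p) = Polynomial.degree p"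
    by (rule degree_map_poly) (metis lookup_single_eq lookup_zero)
  then show ?thesis
    unfolding poly_at_def poly_altdef
    by (intro sum.cong)
       (simp_all add: coeff_map_poly pmon_single_power mult_single del: One_nat_def)
qed

context monomial_curve
begin

definition box :: "(4 \<Rightarrow>\<^sub>0 nat) set" where
  "box = {m. \<forall>i. Poly_Mapping.lookup m i < n 1}"

lemma finite_box: "finite box"
proof (rule finite_imageD)
  have "Poly_Mapping.lookup ` box \<subseteq> {g. \<forall>i. (i \<in> UNIV \<longrightarrow> g i \<in> {..<n 1}) \<and> (i \<notin> UNIV \<longrightarrow> g i = 0)}"
    by (auto simp: box_def)
  then show "finite (Poly_Mapping.lookup ` box)"
    by (rule finite_subset) (rule finite_set_of_finite_funs, auto)
  show "inj_on Poly_Mapping.lookup box" by (rule inj_onI) (metis poly_mapping_eq_iff)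
qed

text \<open>A factor with exponent \<open>n 1\<close> in any variable can be removed. If the
  variable has weight \<open>n 1\<close>, the factor is exchanged for x1^(n 1), a scalar from K[x1];
  otherwise x1^(n i) has the same weight and larger degree, and the monomial lies in the tangent
  ideal.\<close>

lemma finite_over_poly:
  fixes f :: "'k::field poly4"
  defines "iota \<equiv> \<lambda>p :: 'k poly. poly_at p (Poly_Mapping.single 1 1 :: 4 \<Rightarrow>\<^sub>0 nat)"
  shows "\<exists>h. f - (\<Sum>b\<in>pmon ` box. iota (h b) * b) \<in> tangent_ideal"
proof -
  note J = tc_ideal_tangent
  let ?B = "pmon ` box :: 'k poly4 set"
  define M where "M = {f. \<exists>h. f - (\<Sum>b\<in>?B. iota (h b) * b) \<in> tangent_ideal}"
  have iota_0: "iota 0 = 0" and iota_add: "iota (p + q) = iota p + iota q"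
    and iota_mult: "iota (p * q) = iota p * iota q" for p q
    by (simp_all add: iota_def poly_at_zero poly_at_add poly_at_mult)
  have M_J: "f \<in> M" if "f \<in> tangent_ideal" for f
    using that unfolding M_def by (intro CollectI exI[of _ "\<lambda>_. 0"]) (simp add: iota_0)
  have M_add: "f + g \<in> M" if fg: "f \<in> M" "g \<in> M" for f g
  proof -
    obtain h h' where "f - (\<Sum>b\<in>?B. iota (h b) * b) \<in> tangent_ideal"
      "g - (\<Sum>b\<in>?B. iota (h' b) * b) \<in> tangent_ideal"
      using fg by (auto simp: M_def)
    from tc_idealD(2)[OF J this]
    have "f + g - (\<Sum>b\<in>?B. iota (h b + h' b) * b) \<in> tangent_ideal"
      by (simp add: iota_add distrib_right sum.distrib algebra_simps)
    then show ?thesis unfolding M_def by (intro CollectI exI[of _ "\<lambda>b. h b + h' b"])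
  qed
  have M_mult: "iota c * f \<in> M" if f: "f \<in> M" for c f
  proof -
    obtain h where "f - (\<Sum>b\<in>?B. iota (h b) * b) \<in> tangent_ideal" using f by (auto simp: M_def)
    from tc_idealD(3)[OF J this, of "iota c"]
    have "iota c * f - (\<Sum>b\<in>?B. iota (c * h b) * b) \<in> tangent_ideal"
      by (simp add: iota_mult sum_distrib_left right_diff_distrib mult.assoc)
    then show ?thesis unfolding M_def by (intro CollectI exI[of _ "\<lambda>b. c * h b"])
  qed
  have iota_const: "iota [:c:] = Poly_Mapping.single 0 c" for c
    by (simp add: iota_def poly_at_pCons poly_at_zero)
  have iota_monom: "iota (monom 1 k) = pmon (Poly_Mapping.single 1 k)" for k
  proof -
    have "iota (monom 1 k) = iota [:0, 1:] ^ k"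
    proof (induction k)
      case 0
      then show ?case using iota_const[of 1] by (simp add: monom_0)
    next
      case (Suc k)
      have "iota (monom 1 (Suc k)) = iota ([:0, 1:] * monom 1 k)" by (simp add: monom_Suc)
      then show ?case by (simp only: iota_mult Suc power_Suc)
    qed
    moreover have "iota [:0, 1:] = pmon (Poly_Mapping.single 1 1)"
      unfolding iota_def poly_at_pCons poly_at_zero
      by (simp add: mult_single)
    ultimately show ?thesis by (simp only: pmon_single_power)
  qed
  have M_box: "pmon b \<in> M" if "b \<in> box" for b
  proof -
    have "(\<Sum>b'\<in>?B. iota (if b' = pmon b then 1 else 0) * b') = (\<Sum>b'\<in>?B. if b' = pmon b then b' else 0)"
      using iota_const[of 1] by (intro sum.cong) (auto simp: iota_0 one_pCons)
    also have "\<dots> = pmon b" using that finite_box by simp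
    finally have "pmon b - (\<Sum>b'\<in>?B. iota (if b' = pmon b then 1 else 0) * b') = 0" by simp
    then show ?thesis unfolding M_def
      using tc_idealD(1)[OF J] by (intro CollectI exI[of _ "\<lambda>b'. if b' = pmon b then 1 else 0"]) simp
  qed
  have "pmon m \<in> M" for m
  proof (induction "mon_degree m" arbitrary: m rule: less_induct)
    case less
    show ?case
    proof (cases "m \<in> box")
      case False
      then obtain i where i: "n 1 \<le> Poly_Mapping.lookup m i" by (auto simp: box_def not_less)
      then obtain m' where m': "m = Poly_Mapping.single i (n 1) + m'" by (rule monomial_split)
      define m2 where "m2 = Poly_Mapping.single 1 (n 1) + m'"
      have "mon_degree m' < mon_degree m" using m' n_pos[of 1] by simp
      then have "pmon m' \<in> M" by (rule less)
      then have "iota (monom 1 (n 1)) * pmon m' \<in> M" by (rule M_mult)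
      then have m2M: "pmon m2 \<in> M" by (simp add: iota_monom mult_single m2_def)
      show ?thesis
      proof (cases "n i = n 1")
        case True
        then have "pmon m - pmon m2 \<in> tangent_ideal"
          by (intro pmon_diff_tangent) (simp_all add: m' m2_def)
        then have "(pmon m - pmon m2) + pmon m2 \<in> M" by (intro M_add M_J m2M)
        then show ?thesis by simp
      next
        case False
        with n1_min[of i] have "n 1 < n i" by simp
        have "\<not> maximal m"
          unfolding maximal_def
        proof
          assume *: "\<forall>m'. wt m' = wt m \<longrightarrow> mon_degree m' \<le> mon_degree m"
          have "wt (Poly_Mapping.single 1 (n i) + m') = wt m" by (simp add: m' mult.commute)
          with * have "mon_degree (Poly_Mapping.single 1 (n i) + m') \<le> mon_degree m" by blast
          with \<open>n 1 < n i\<close> show False by (simp add: m')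
        qed
        then show ?thesis by (intro M_J) (simp add: pmon_tangent_iff)
      qed
    qed (rule M_box)
  qed
  then have "Poly_Mapping.single m c \<in> M" for m c
    using M_mult[of "pmon m" "[:c:]"] by (simp add: iota_const mult_single)
  then have "f \<in> M" for f
    by (induction f rule: poly_mapping_add_induct) (auto intro: M_add M_J tc_idealD(1)[OF J])
  then show ?thesis by (simp add: M_def)
qed

lemma noetherian_tangent_cone: "noetherian_ring (tangent_cone TYPE('k::field))"
proof -
  interpret quotient_presentation "tangent_cone TYPE('k)"
    "a_r_coset (poly4_ring :: 'k poly4 ring) tangent_ideal" "tangent_ideal :: 'k poly4 set" psi
    by (rule quotient_presentation_tangent_cone)
  show ?thesis
  proof (rule noetherian_if_finite_over_poly[where iota = "\<lambda>p. poly_at p (Poly_Mapping.single 1 1)"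
        and B = "pmon ` box"])
    show "finite (pmon ` box :: 'k poly4 set)" by (simp add: finite_box)
    show "\<exists>h. f - (\<Sum>b\<in>pmon ` box. poly_at (h b) (Poly_Mapping.single 1 1) * b) \<in> tangent_ideal"
      for f :: "'k poly4"
      by (rule finite_over_poly)
  qed (simp_all add: poly_at_zero poly_at_add poly_at_mult)
qed

section \<open>Nonzerodivisors and socle monomials\<close>

lemma fib_shift:
  assumes "maximal t" "a + m \<in> fib t"
  shows "{m'. a + m' \<in> fib t} = fib m" "maximal m"
  using assms not_maximal_add[of m a] maximal_fib_cong[of "a + m" t] by (auto simp: fib_def)

text \<open>The lowest terms of p and y have a nonzero product.\<close>

lemma poly_at_nonzerodivisor:
  fixes y :: "'k::field poly4"
  assumes max: "\<And>m. maximal m \<Longrightarrow> maximal (Poly_Mapping.single 1 1 + m)"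
    and p: "p \<noteq> 0" and py: "poly_at p (Poly_Mapping.single 1 1) * y \<in> tangent_ideal"
  shows "y \<in> tangent_ideal"
proof (rule ccontr)
  assume "y \<notin> tangent_ideal"
  then obtain m0 where m0: "maximal m0 \<and> coeff_sum (fib m0) y \<noteq> 0" by (auto simp: mem_tangent_iff)
  define m where "m = arg_min wt (\<lambda>m. maximal m \<and> coeff_sum (fib m) y \<noteq> 0)"
  have m: "maximal m" "coeff_sum (fib m) y \<noteq> 0"
    using arg_min_natI[of "\<lambda>m. maximal m \<and> coeff_sum (fib m) y \<noteq> 0", OF m0, of wt] by (auto simp: m_def)
  have least: "coeff_sum (fib m') y = 0" if "maximal m'" "wt m' < wt m" for m'
  proof (rule ccontr)
    assume "coeff_sum (fib m') y \<noteq> 0"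
    with that(1) have "wt m \<le> wt m'"
      using arg_min_nat_le[of "\<lambda>m. maximal m \<and> coeff_sum (fib m) y \<noteq> 0" m' wt] by (simp add: m_def)
    with that(2) show False by simp
  qed
  have max_k: "maximal (Poly_Mapping.single 1 k + m)" for k
  proof (induction k)
    case (Suc k)
    have "Poly_Mapping.single 1 (Suc k) + m = Poly_Mapping.single 1 1 + (Poly_Mapping.single 1 k + m)"
      by (simp flip: single_add add: add.assoc[symmetric])
    then show ?case using max[OF Suc] by (simp only:)
  qed (use m in simp)
  define d where "d = (LEAST i. Polynomial.coeff p i \<noteq> 0)"
  have d: "Polynomial.coeff p d \<noteq> 0" unfolding d_def
    by (rule LeastI[of _ "Polynomial.degree p"]) (use p in simp)
  have d_le: "d \<le> Polynomial.degree p" using d by (rule le_degree)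
  let ?t = "Poly_Mapping.single 1 d + m"
  have low: "Polynomial.coeff p j * coeff_sum {m'. Poly_Mapping.single 1 j + m' \<in> fib ?t} y
      = (if j = d then Polynomial.coeff p d * coeff_sum (fib m) y else 0)" for j
  proof (cases j d rule: linorder_cases)
    case less
    then have "Polynomial.coeff p j = 0" using not_less_Least by (auto simp: d_def)
    then show ?thesis using less by simp
  next
    case equal
    have "?t \<in> fib ?t" by (simp add: fib_def)
    then show ?thesis using fib_shift(1)[OF max_k] equal by simp
  next
    case greater
    show ?thesis
    proof (cases "{m'. Poly_Mapping.single 1 j + m' \<in> fib ?t} = {}")
      case True
      then show ?thesis using greater by (simp only: coeff_sum_empty) simp
    next
      case False
      then obtain m' where m': "Poly_Mapping.single 1 j + m' \<in> fib ?t" by auto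
      then have "j * n 1 + wt m' = d * n 1 + wt m" by (simp add: fib_def)
      moreover have "d * n 1 < j * n 1" using greater n_pos[of 1] by simp
      ultimately have "wt m' < wt m" by linarith
      then show ?thesis using fib_shift[OF max_k m'] least greater by simp
    qed
  qed
  have "coeff_sum (fib ?t) (poly_at p (Poly_Mapping.single 1 1) * y) =
      (\<Sum>j\<le>Polynomial.degree p. Polynomial.coeff p j * coeff_sum {m'. Poly_Mapping.single 1 j + m' \<in> fib ?t} y)"
    by (simp only: poly_at_altdef sum_distrib_right coeff_sum_sum coeff_sum_single_mult)
  also have "\<dots> = Polynomial.coeff p d * coeff_sum (fib m) y"
    using d_le by (simp add: low)
  finally have "coeff_sum (fib ?t) (poly_at p (Poly_Mapping.single 1 1) * y) \<noteq> 0"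
    using d m(2) by simp
  with py max_k show False by (auto simp: mem_tangent_iff)
qed

text \<open>The maximal ideal described by g contains g(x1), since \<open>psi\<close> sends this
  element to g, and every nonzero polynomial in x1 is a nonzerodivisor.\<close>

lemma cohen_macaulay_if:
  assumes "\<And>m. maximal m \<Longrightarrow> maximal (Poly_Mapping.single 1 1 + m)"
  shows "cohen_macaulay (tangent_cone TYPE('k::field))"
proof -
  interpret quotient_presentation "tangent_cone TYPE('k)"
    "a_r_coset (poly4_ring :: 'k poly4 ring) tangent_ideal" "tangent_ideal :: 'k poly4 set" psi
    by (rule quotient_presentation_tangent_cone)
  show ?thesis
    unfolding cohen_macaulay_iff[OF noetherian_tangent_cone]
  proof (intro allI impI)
    fix P assume P: "maximalideal P (tangent_cone TYPE('k))"
    obtain g where g: "\<And>f. a_r_coset poly4_ring tangent_ideal f \<in> P \<longleftrightarrow> g dvd psi f" "g \<noteq> 0"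
      using maximal_generator[OF P] by blast
    let ?f = "poly_at g (Poly_Mapping.single 1 1) :: 'k poly4"
    have "a_r_coset poly4_ring tangent_ideal ?f \<in> P" using g(1)[of ?f] psi_poly_at[of g] by simp
    moreover have "\<forall>y. ?f * y \<in> tangent_ideal \<longrightarrow> y \<in> tangent_ideal"
      using poly_at_nonzerodivisor[OF assms g(2)] by blast
    ultimately show "\<exists>f. a_r_coset poly4_ring tangent_ideal f \<in> P \<and>
        (\<forall>y. f * y \<in> tangent_ideal \<longrightarrow> y \<in> (tangent_ideal :: 'k poly4 set))" by blast
  qed
qed

text \<open>For each variable in turn, multiply by it as long as the monomial stays maximal; this
  stops before exponent \<open>n 1\<close> if the variable is heavier than x1. A variable of weight
  \<open>n 1\<close> acts on classes like x1. Conditions already reached persist because multiples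
  of nonmaximal monomials are nonmaximal.\<close>

lemma socle_monomial:
  assumes "maximal m" "\<not> maximal (Poly_Mapping.single 1 1 + m)" "finite A"
  shows "\<exists>m'. maximal m' \<and> \<not> maximal (Poly_Mapping.single 1 1 + m') \<and>
    (\<forall>i\<in>A. \<not> maximal (Poly_Mapping.single i 1 + m'))"
  using assms(3)
proof (induction A rule: finite_induct)
  case empty
  then show ?case using assms by blast
next
  case (insert i A)
  then obtain m' where m': "maximal m'" "\<not> maximal (Poly_Mapping.single 1 1 + m')"
    "\<And>i. i \<in> A \<Longrightarrow> \<not> maximal (Poly_Mapping.single i 1 + m')" by blast
  show ?case
  proof (cases "n i = n 1")
    case True
    then have "\<not> maximal (Poly_Mapping.single i 1 + m')"
      using m'(2) maximal_fib_cong[of "Poly_Mapping.single i 1 + m'" "Poly_Mapping.single 1 1 + m'"] by simp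
    then show ?thesis using m' by blast
  next
    case False
    with n1_min[of i] have lt: "n 1 < n i" by simp
    let ?Q = "\<lambda>k. \<not> maximal (Poly_Mapping.single i k + m')"
    have "?Q (n 1)"
      unfolding maximal_def
    proof
      assume *: "\<forall>x. wt x = wt (Poly_Mapping.single i (n 1) + m') \<longrightarrow>
        mon_degree x \<le> mon_degree (Poly_Mapping.single i (n 1) + m')"
      have "wt (Poly_Mapping.single 1 (n i) + m') = wt (Poly_Mapping.single i (n 1) + m')"
        by (simp add: mult.commute)
      with * have "mon_degree (Poly_Mapping.single 1 (n i) + m') \<le> mon_degree (Poly_Mapping.single i (n 1) + m')"
        by blast
      with lt show False by simp
    qed
    then have Q: "?Q (LEAST k. ?Q k)" by (rule LeastI)
    moreover have "\<not> ?Q 0" using m'(1) by simp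
    ultimately obtain k where k: "(LEAST k. ?Q k) = Suc k" by (metis not0_implies_Suc)
    then have Qk: "\<not> ?Q k" using not_less_Least[of k ?Q] by simp
    define m2 where "m2 = Poly_Mapping.single i k + m'"
    have "Poly_Mapping.single i 1 + m2 = Poly_Mapping.single i (Suc k) + m'"
      by (simp add: m2_def add.assoc[symmetric] flip: single_add)
    then have 1: "\<not> maximal (Poly_Mapping.single i 1 + m2)" using Q k by (simp only:) simp
    have up: "\<not> maximal (Poly_Mapping.single j 1 + m2)" if "\<not> maximal (Poly_Mapping.single j 1 + m')" for j
      using not_maximal_add[OF that, of "Poly_Mapping.single i k"] by (simp only: m2_def add.left_commute) simp
    show ?thesis using Qk 1 up m' by (intro exI[of _ m2]) (auto simp: m2_def)
  qed
qed

text \<open>A socle monomial is not in the tangent ideal but is multiplied into it by every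
  polynomial without constant term, so the maximal ideal of the origin contains no
  nonzerodivisor.\<close>

lemma not_cohen_macaulay_if:
  assumes "maximal m" "\<not> maximal (Poly_Mapping.single 1 1 + m)"
  shows "\<not> cohen_macaulay (tangent_cone TYPE('k::field))"
proof
  assume cm: "cohen_macaulay (tangent_cone TYPE('k))"
  interpret quotient_presentation "tangent_cone TYPE('k)"
    "a_r_coset (poly4_ring :: 'k poly4 ring) tangent_ideal" "tangent_ideal :: 'k poly4 set" psi
    by (rule quotient_presentation_tangent_cone)
  have "tc_ideal {f :: 'k poly4. Polynomial.coeff (psi f) 0 = 0}"
    by (auto simp: tc_ideal_def psi_zero psi_add psi_mult coeff_mult)
  moreover have "tangent_ideal \<subseteq> {f :: 'k poly4. Polynomial.coeff (psi f) 0 = 0}" using psi_J by auto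
  ultimately have mem: "a_r_coset poly4_ring tangent_ideal f \<in>
      a_r_coset poly4_ring tangent_ideal ` {f :: 'k poly4. Polynomial.coeff (psi f) 0 = 0} \<longleftrightarrow>
      Polynomial.coeff (psi f) 0 = 0" for f
    by (subst mem_cls_image_iff) auto
  obtain f :: "'k poly4" where "a_r_coset poly4_ring tangent_ideal f \<in>
      a_r_coset poly4_ring tangent_ideal ` {f :: 'k poly4. Polynomial.coeff (psi f) 0 = 0}"
    and nzd: "\<And>y. f * y \<in> tangent_ideal \<Longrightarrow> y \<in> tangent_ideal"
    using cm maximalideal_origin unfolding cohen_macaulay_iff[OF noetherian_tangent_cone] by blast
  then have "Polynomial.coeff (psi f) 0 = 0" using mem by blast
  \<comment> \<open>Only the trivial monomial has degree 0, so the constant term of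
    \<open>psi f\<close> is that of \<open>f\<close>.\<close>
  moreover have "face 0 = {0}" by (auto simp: face_def mon_degree_eq_0_iff on_face_zero)
  ultimately have "coeff_sum {0} f = 0" by (simp add: coeff_psi)
  then have f0: "Poly_Mapping.lookup f 0 = 0"
    by (subst (asm) coeff_sum_superset[of "insert 0 (Poly_Mapping.keys f)"]) (auto simp: sum.If_cases)
  obtain t where t: "maximal t" "\<And>i. \<not> maximal (Poly_Mapping.single i 1 + t)"
    using socle_monomial[OF assms, of UNIV] by auto
  have mult_t: "Poly_Mapping.single a c * pmon t \<in> (tangent_ideal :: 'k poly4 set)" if a: "a \<noteq> 0" for a c
  proof -
    obtain i where "Poly_Mapping.lookup a i \<noteq> 0" using a by (auto simp: poly_mapping_eq_iff fun_eq_iff)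
    then have "1 \<le> Poly_Mapping.lookup a i" by simp
    then obtain a' where a': "a = Poly_Mapping.single i 1 + a'" by (rule monomial_split)
    have "\<not> maximal (a + t)"
      using not_maximal_add[OF t(2)[of i], of a'] by (simp only: a' ac_simps) simp
    then show ?thesis
      by (simp add: mult_single tc_ideal_single[OF tc_ideal_tangent] pmon_tangent_iff)
  qed
  have "(\<Sum>a\<in>Poly_Mapping.keys f. Poly_Mapping.single a (Poly_Mapping.lookup f a)) * pmon t \<in> tangent_ideal"
    unfolding sum_distrib_right
  proof (rule tc_ideal_sum[OF tc_ideal_tangent])
    fix a assume "a \<in> Poly_Mapping.keys f"
    then have "a \<noteq> 0" using f0 by (auto simp: in_keys_iff)
    then show "Poly_Mapping.single a (Poly_Mapping.lookup f a) * pmon t \<in> tangent_ideal" by (rule mult_t)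
  qed
  then have "f * pmon t \<in> tangent_ideal" by (simp flip: poly_mapping_eq_sum_single)
  then show False using nzd[of "pmon t"] t(1) by (simp add: pmon_tangent_iff)
qed

end

section \<open>A lower bound for the number of generators\<close>

text \<open>Gaussian elimination by induction on the equations: the pivot unknown \<open>i0\<close>
  of equation \<open>b\<close> is solved for and substituted in the others.\<close>

lemma underdetermined_system:
  fixes A :: "'i \<Rightarrow> 'b \<Rightarrow> 'k::field"
  assumes "finite B" "finite I" "card B < card I"
  shows "\<exists>c. (\<exists>i\<in>I. c i \<noteq> 0) \<and> (\<forall>b\<in>B. (\<Sum>i\<in>I. c i * A i b) = 0)"
  using assms
proof (induction B arbitrary: I A rule: finite_induct)
  case empty
  then have "I \<noteq> {}" by auto
  then show ?case by (intro exI[of _ "\<lambda>_. 1"]) auto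
next
  case (insert b B)
  show ?case
  proof (cases "\<forall>i\<in>I. A i b = 0")
    case True
    have "card B < card I" using insert.prems insert.hyps by simp
    from insert.IH[OF insert.prems(1) this, of A] True show ?thesis by auto
  next
    case False
    then obtain i0 where i0: "i0 \<in> I" "A i0 b \<noteq> 0" by blast
    let ?I = "I - {i0}"
    have fin: "finite ?I" using insert.prems by simp
    have "card B < card ?I" using insert.prems insert.hyps i0 by simp
    from insert.IH[OF fin this, of "\<lambda>i b'. A i b' - A i b / A i0 b * A i0 b'"]
    obtain c where c: "\<exists>i\<in>?I. c i \<noteq> 0"
      "\<And>b'. b' \<in> B \<Longrightarrow> (\<Sum>i\<in>?I. c i * (A i b' - A i b / A i0 b * A i0 b')) = 0" by blast
    define s where "s = (\<Sum>i\<in>?I. c i * A i b)"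
    define c' where "c' = c(i0 := - s / A i0 b)"
    have split: "(\<Sum>i\<in>I. c' i * A i b') = - s / A i0 b * A i0 b' + (\<Sum>i\<in>?I. c i * A i b')" for b'
      using insert.prems(1) i0(1) by (simp add: sum.remove c'_def)
    have "(\<Sum>i\<in>I. c' i * A i b') = 0" if "b' \<in> insert b B" for b'
    proof (cases "b' = b")
      case True
      then show ?thesis using split[of b] i0(2) by (simp add: s_def)
    next
      case False
      with that have "b' \<in> B" by simp
      have "(\<Sum>i\<in>?I. c i * (A i b' - A i b / A i0 b * A i0 b')) =
          (\<Sum>i\<in>?I. c i * A i b') - (\<Sum>i\<in>?I. c i * A i b) / A i0 b * A i0 b'"
        unfolding sum_divide_distrib sum_distrib_right sum_subtractf[symmetric]
        by (intro sum.cong) (simp_all add: right_diff_distrib)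
      with c(2)[OF \<open>b' \<in> B\<close>] split[of b'] show ?thesis by (simp add: s_def)
    qed
    moreover have "\<exists>i\<in>I. c' i \<noteq> 0" using c(1) by (auto simp: c'_def)
    ultimately show ?thesis by blast
  qed
qed

section \<open>Functionals on minimal generators\<close>

context monomial_curve
begin

definition crit_set :: "(4 \<Rightarrow>\<^sub>0 nat) set \<Rightarrow> bool" where
  "crit_set T \<longleftrightarrow> (\<forall>i. {m. Poly_Mapping.single i 1 + m \<in> T} \<in> insert {} max_fibs)"

text \<open>Coefficient sums over critical sets vanish on the product of the irrelevant maximal ideal and
  the tangent ideal, so they induce functionals on the space of minimal generators.\<close>

lemma crit_set_coeff_sum_mult:
  fixes f h :: "'k::field poly4"
  assumes T: "crit_set T" and f: "f \<in> tangent_ideal"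
  shows "coeff_sum T (h * f) = Poly_Mapping.lookup h 0 * coeff_sum T f"
proof (induction h rule: poly_mapping_add_induct)
  case (single a c)
  show ?case
  proof (cases "a = 0")
    case True
    then show ?thesis by (simp add: coeff_sum_single_mult)
  next
    case False
    then obtain i where "Poly_Mapping.lookup a i \<noteq> 0" by (auto simp: poly_mapping_eq_iff fun_eq_iff)
    then have "1 \<le> Poly_Mapping.lookup a i" by simp
    then obtain a' where a': "a = Poly_Mapping.single i 1 + a'" by (rule monomial_split)
    define g where "g = Poly_Mapping.single a' c * f"
    have g: "g \<in> tangent_ideal" unfolding g_def by (rule tc_idealD(3)[OF tc_ideal_tangent f])
    have "Poly_Mapping.single a c * f = pmon (Poly_Mapping.single i 1) * g"
      by (simp add: g_def a' mult.assoc[symmetric] mult_single)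
    then have "coeff_sum T (Poly_Mapping.single a c * f) = coeff_sum {m. Poly_Mapping.single i 1 + m \<in> T} g"
      by (simp only: coeff_sum_single_mult mult_1)
    also have "\<dots> = 0"
    proof -
      have "{m. Poly_Mapping.single i 1 + m \<in> T} \<in> insert {} max_fibs" using T by (simp add: crit_set_def)
      moreover have "coeff_sum S g = 0" if "S \<in> insert {} max_fibs" for S
        using that g by (auto simp: coeff_null_def)
      ultimately show ?thesis by blast
    qed
    finally show ?thesis using False by (simp add: lookup_single)
  qed
qed (simp_all add: distrib_right coeff_sum_add lookup_add)

text \<open>With fewer than \<open>card I\<close> generators, some nontrivial combination of the
  functionals kills all of them. Modulo the irrelevant ideal the functionals are K-linear, so the
  kernel of the combination is an ideal and contains the whole tangent ideal, contrary to the dual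
  elements \<open>g\<close>.\<close>

lemma min_num_gens_ge:
  fixes g :: "'i \<Rightarrow> 'k::field poly4"
  assumes fin: "finite I" and T: "\<And>i. i \<in> I \<Longrightarrow> crit_set (T i)"
    and g: "\<And>i. i \<in> I \<Longrightarrow> g i \<in> tangent_ideal"
    and diag: "\<And>i. i \<in> I \<Longrightarrow> coeff_sum (T i) (g i) \<noteq> 0"
    and off: "\<And>i j. i \<in> I \<Longrightarrow> j \<in> I \<Longrightarrow> i \<noteq> j \<Longrightarrow> coeff_sum (T i) (g j) = 0"
  shows "enat (card I) \<le> min_num_gens poly4_ring (tangent_ideal :: 'k poly4 set)"
  unfolding min_num_gens_def
proof (rule INF_greatest)
  fix B assume "B \<in> {B. finite B \<and> B \<subseteq> carrier (poly4_ring :: 'k poly4 ring) \<and>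
    genideal poly4_ring B = (tangent_ideal :: 'k poly4 set)}"
  then have B: "finite B" "genideal poly4_ring B = (tangent_ideal :: 'k poly4 set)" by auto
  have "card I \<le> card B"
  proof (rule ccontr)
    assume "\<not> card I \<le> card B"
    then obtain c where c: "\<exists>i\<in>I. c i \<noteq> 0" "\<And>b. b \<in> B \<Longrightarrow> (\<Sum>i\<in>I. c i * coeff_sum (T i) b) = 0"
      using underdetermined_system[OF B(1) fin, of "\<lambda>i b. coeff_sum (T i) b"] by auto
    define A where "A = {f \<in> tangent_ideal. (\<Sum>i\<in>I. c i * coeff_sum (T i) f) = 0}"
    have "tc_ideal A"
      unfolding tc_ideal_def
    proof (intro conjI ballI allI)
      show "0 \<in> A" by (simp add: A_def tc_idealD(1)[OF tc_ideal_tangent])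
      fix x assume x: "x \<in> A"
      show "x + y \<in> A" if "y \<in> A" for y
        using x that
        by (simp add: A_def coeff_sum_add distrib_left sum.distrib tc_idealD(2)[OF tc_ideal_tangent])
      fix r
      have xJ: "x \<in> tangent_ideal" and x0: "(\<Sum>i\<in>I. c i * coeff_sum (T i) x) = 0"
        using x by (simp_all add: A_def)
      have "(\<Sum>i\<in>I. c i * coeff_sum (T i) (r * x)) =
          (\<Sum>i\<in>I. Poly_Mapping.lookup r 0 * (c i * coeff_sum (T i) x))"
        using T xJ by (intro sum.cong) (simp_all add: crit_set_coeff_sum_mult)
      also have "\<dots> = 0" by (simp add: x0 flip: sum_distrib_left)
      finally show "r * x \<in> A" by (simp add: A_def tc_idealD(3)[OF tc_ideal_tangent xJ])
    qed
    moreover have "B \<subseteq> A"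
      using genideal_roa_superset[of B] B(2) c(2) by (auto simp: A_def)
    ultimately have A: "tangent_ideal \<subseteq> A" using genideal_roa_least B(2) by metis
    obtain j where j: "j \<in> I" "c j \<noteq> 0" using c(1) by blast
    have "(\<Sum>i\<in>I. c i * coeff_sum (T i) (g j)) = 0" using A g[OF j(1)] by (auto simp: A_def)
    also have "(\<Sum>i\<in>I. c i * coeff_sum (T i) (g j)) = c j * coeff_sum (T j) (g j)"
      using fin j(1) off by (subst sum.remove[of _ j]) (auto intro!: sum.neutral)
    finally show False using j diag by simp
  qed
  then show "enat (card I) \<le> enat (card B)" by simp
qed

definition bad :: "(4 \<Rightarrow>\<^sub>0 nat) \<Rightarrow> bool" where
  "bad m \<longleftrightarrow> (\<exists>m'. m' \<noteq> m \<and> wt m' = wt m \<and> mon_degree m \<le> mon_degree m')"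

text \<open>Bad monomials are those that lie in the tangent ideal or occur in a homogeneous binomial
  of it. They are closed under multiples, and the minimal ones take the part of minimal leading
  monomials without a choice of term order.\<close>

definition minimal_bad :: "(4 \<Rightarrow>\<^sub>0 nat) \<Rightarrow> bool" where
  "minimal_bad m \<longleftrightarrow> bad m \<and> (\<forall>i m'. m = Poly_Mapping.single i 1 + m' \<longrightarrow> \<not> bad m')"

lemma not_bad:
  assumes "\<not> bad m"
  shows "maximal m" "fib m = {m}"
proof -
  have *: "m' = m" if "wt m' = wt m" "mon_degree m \<le> mon_degree m'" for m'
    using assms that by (auto simp: bad_def)
  then show "fib m = {m}" by (auto simp: fib_def)
  show "maximal m" unfolding maximal_def
  proof (intro allI impI)
    fix m' assume "wt m' = wt m"
    then show "mon_degree m' \<le> mon_degree m" using *[of m'] by (cases "mon_degree m \<le> mon_degree m'") auto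
  qed
qed

lemma not_maximal_imp_bad: "\<not> maximal m \<Longrightarrow> bad m"
  using not_bad(1) by blast

text \<open>The quotient by a variable is not bad, hence maximal and alone in its class.\<close>

lemma minimal_bad_crit_set:
  assumes "minimal_bad m"
  shows "crit_set {m}"
  unfolding crit_set_def
proof
  fix i
  show "{m'. Poly_Mapping.single i 1 + m' \<in> {m}} \<in> insert {} max_fibs"
  proof (cases "\<exists>m'. m = Poly_Mapping.single i 1 + m'")
    case True
    then obtain m' where m': "m = Poly_Mapping.single i 1 + m'" by blast
    then have nb: "\<not> bad m'" using assms by (auto simp: minimal_bad_def)
    have "{m''. Poly_Mapping.single i 1 + m'' \<in> {m}} = fib m'" using m' not_bad(2)[OF nb] by auto
    then show ?thesis using not_bad(1)[OF nb] by (auto simp: max_fibs_def)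
  qed auto
qed

lemma exists_minimal_bad:
  assumes "bad m"
  obtains m' m'' where "minimal_bad m'" "m = m' + m''"
proof -
  have "\<exists>m' m''. minimal_bad m' \<and> m = m' + m''"
    using assms
  proof (induction "mon_degree m" arbitrary: m rule: less_induct)
    case less
    show ?case
    proof (cases "minimal_bad m")
      case True
      then show ?thesis by (intro exI[of _ m] exI[of _ 0]) simp
    next
      case False
      then obtain i m1 where m1: "m = Poly_Mapping.single i 1 + m1" "bad m1"
        using less.prems by (auto simp: minimal_bad_def)
      then obtain m' m'' where "minimal_bad m'" "m1 = m' + m''" using less.hyps[of m1] by auto
      then show ?thesis using m1 by (intro exI[of _ m'] exI[of _ "Poly_Mapping.single i 1 + m''"])
        (simp add: ac_simps)
    qed
  qed
  then show ?thesis using that by blast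
qed

text \<open>A common variable could be cancelled from the relation, contradicting minimality.\<close>

lemma minimal_bad_unrelated:
  assumes "minimal_bad m" "minimal_bad m'" "m \<noteq> m'"
    and "0 < Poly_Mapping.lookup m i" "0 < Poly_Mapping.lookup m' i"
  shows "\<not> (wt m = wt m' \<and> mon_degree m = mon_degree m')"
proof
  assume *: "wt m = wt m' \<and> mon_degree m = mon_degree m'"
  obtain m1 where m1: "m = Poly_Mapping.single i 1 + m1" using assms(4) monomial_split[of 1 m i] by auto
  obtain m2 where m2: "m' = Poly_Mapping.single i 1 + m2" using assms(5) monomial_split[of 1 m' i] by auto
  have "bad m1" unfolding bad_def using * m1 m2 assms(3) by (intro exI[of _ m2]) auto
  then show False using assms(1) m1 by (auto simp: minimal_bad_def)
qed

text \<open>The first alternative covers minimal bad monomials, which may be maximal; the second is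
  meant for \<open>corner\<close>, which can have several elements.\<close>

definition admissible :: "(4 \<Rightarrow>\<^sub>0 nat) set \<Rightarrow> bool" where
  "admissible T \<longleftrightarrow> crit_set T \<and> T \<noteq> {} \<and> ((\<exists>m. T = {m} \<and> bad m) \<or> (\<forall>m\<in>T. \<not> maximal m))"

text \<open>The element attached to \<open>T\<close> must not be seen by the functional of
  \<open>T'\<close>. Maximality depends only on weight and degree, so the relation is
  symmetric.\<close>

definition unrelated :: "(4 \<Rightarrow>\<^sub>0 nat) set \<Rightarrow> (4 \<Rightarrow>\<^sub>0 nat) set \<Rightarrow> bool" where
  "unrelated T T' \<longleftrightarrow> T \<inter> T' = {} \<and>
     (\<forall>m\<in>T. \<forall>m'\<in>T'. maximal m \<longrightarrow> \<not> (wt m = wt m' \<and> mon_degree m = mon_degree m'))"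

lemma unrelated_sym: "unrelated T T' \<Longrightarrow> unrelated T' T"
  unfolding unrelated_def by (metis Int_commute maximal_fib_cong)

lemma minimal_bad_admissible: "minimal_bad m \<Longrightarrow> admissible {m}"
  using minimal_bad_crit_set by (auto simp: admissible_def minimal_bad_def)

text \<open>A nonmaximal monomial of \<open>T\<close> is itself in the tangent ideal. Otherwise
  \<open>T\<close> is a single maximal bad monomial, and the element is its difference with another
  monomial of its class; an unrelated set contains neither.\<close>

lemma admissible_generator:
  assumes "admissible T"
  obtains g :: "'k::field poly4" where "g \<in> tangent_ideal" "coeff_sum T g \<noteq> 0"
    "\<And>T'. unrelated T T' \<Longrightarrow> coeff_sum T' g = 0"
proof (cases "\<exists>m\<in>T. \<not> maximal m")
  case True
  then obtain m where m: "m \<in> T" "\<not> maximal m" by blast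
  show ?thesis
  proof (rule that[of "pmon m"])
    show "coeff_sum T' (pmon m :: 'k poly4) = 0" if "unrelated T T'" for T'
      using that m(1) by (auto simp: unrelated_def)
  qed (use m in \<open>auto simp: pmon_tangent_iff\<close>)
next
  case False
  with assms obtain m where m: "T = {m}" "bad m" "maximal m" by (auto simp: admissible_def)
  then obtain m' where m': "m' \<noteq> m" "wt m' = wt m" "mon_degree m \<le> mon_degree m'"
    by (auto simp: bad_def)
  with m(3) have deg: "mon_degree m' = mon_degree m" by (auto simp: maximal_def intro: antisym)
  show ?thesis
  proof (rule that[of "pmon m - pmon m'"])
    show "pmon m - pmon m' \<in> tangent_ideal" using m' deg by (intro pmon_diff_tangent) auto
    show "coeff_sum T (pmon m - pmon m' :: 'k poly4) \<noteq> 0" using m m' by (simp add: coeff_sum_diff)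
    show "coeff_sum T' (pmon m - pmon m' :: 'k poly4) = 0" if "unrelated T T'" for T'
      using that m m' deg by (auto simp: unrelated_def coeff_sum_diff)
  qed
qed

lemma min_num_gens_ge_admissible:
  assumes "\<And>T. T \<in> set Ts \<Longrightarrow> admissible T" "sorted_wrt unrelated Ts"
  shows "enat (length Ts) \<le> min_num_gens poly4_ring (tangent_ideal :: 'k::field poly4 set)"
proof -
  let ?I = "{..<length Ts}"
  have unrel: "unrelated (Ts ! i) (Ts ! j)" if "i \<in> ?I" "j \<in> ?I" "i \<noteq> j" for i j
    using that assms(2) unrelated_sym by (cases i j rule: linorder_cases) (auto simp: sorted_wrt_iff_nth_less)
  have "\<forall>i\<in>?I. \<exists>g :: 'k poly4. g \<in> tangent_ideal \<and> coeff_sum (Ts ! i) g \<noteq> 0 \<and>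
      (\<forall>T'. unrelated (Ts ! i) T' \<longrightarrow> coeff_sum T' g = 0)"
    using assms(1) by (metis admissible_generator lessThan_iff nth_mem)
  then obtain g :: "nat \<Rightarrow> 'k poly4" where g: "\<And>i. i \<in> ?I \<Longrightarrow> g i \<in> tangent_ideal \<and>
      coeff_sum (Ts ! i) (g i) \<noteq> 0 \<and> (\<forall>T'. unrelated (Ts ! i) T' \<longrightarrow> coeff_sum T' (g i) = 0)"
    using bchoice[of ?I "\<lambda>i g. g \<in> tangent_ideal \<and> coeff_sum (Ts ! i) g \<noteq> 0 \<and>
      (\<forall>T'. unrelated (Ts ! i) T' \<longrightarrow> coeff_sum T' g = 0)"] by blast
  have "enat (card ?I) \<le> min_num_gens poly4_ring (tangent_ideal :: 'k poly4 set)"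
    by (rule min_num_gens_ge[where T = "\<lambda>i. Ts ! i" and g = g])
       (use g unrel assms(1) in \<open>auto simp: admissible_def\<close>)
  then show ?thesis by simp
qed

end

section \<open>Combinatorics of the relation lattice\<close>

definition mo :: "nat \<Rightarrow> nat \<Rightarrow> nat \<Rightarrow> nat \<Rightarrow> 4 \<Rightarrow>\<^sub>0 nat" where
  "mo i j k l = Poly_Mapping.single 1 i + Poly_Mapping.single 2 j + Poly_Mapping.single 3 k + Poly_Mapping.single 4 l"

lemma UNIV_4': "(UNIV :: 4 set) = {1, 2, 3, 4}"
proof (rule sym, rule card_subset_eq)
  have "distinct [1, 2, 3, 4 :: 4]" by simp
  from distinct_card[OF this] show "card {1, 2, 3, 4 :: 4} = card (UNIV :: 4 set)" by simp
qed auto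

lemma exhaust_4': obtains "x = (1::4)" | "x = 2" | "x = 3" | "x = 4"
proof -
  have "x \<in> {1, 2, 3, 4}" unfolding UNIV_4'[symmetric] by simp
  then show ?thesis using that by blast
qed

lemma lookup_mo [simp]:
  "Poly_Mapping.lookup (mo i j k l) 1 = i" "Poly_Mapping.lookup (mo i j k l) 2 = j"
  "Poly_Mapping.lookup (mo i j k l) 3 = k" "Poly_Mapping.lookup (mo i j k l) 4 = l"
  by (simp_all add: mo_def lookup_add lookup_single)

lemma mo_lookup: "mo (Poly_Mapping.lookup m 1) (Poly_Mapping.lookup m 2) (Poly_Mapping.lookup m 3) (Poly_Mapping.lookup m 4) = m"
proof (rule poly_mapping_eqI)
  fix x
  show "Poly_Mapping.lookup (mo (Poly_Mapping.lookup m 1) (Poly_Mapping.lookup m 2) (Poly_Mapping.lookup m 3)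
    (Poly_Mapping.lookup m 4)) x = Poly_Mapping.lookup m x"
    by (cases x rule: exhaust_4') (simp_all only: lookup_mo)
qed

lemma mo_cases: obtains i j k l where "m = mo i j k l"
  using mo_lookup[of m] by metis

lemma mo_eq_iff [simp]: "mo i j k l = mo i' j' k' l' \<longleftrightarrow> i = i' \<and> j = j' \<and> k = k' \<and> l = l'"
  by (metis lookup_mo)

lemma mo_add [simp]: "mo i j k l + mo i' j' k' l' = mo (i + i') (j + j') (k + k') (l + l')"
  by (simp add: mo_def single_add ac_simps)

lemma single_eq_mo:
  "Poly_Mapping.single 1 c = mo c 0 0 0" "Poly_Mapping.single 2 c = mo 0 c 0 0"
  "Poly_Mapping.single 3 c = mo 0 0 c 0" "Poly_Mapping.single 4 c = mo 0 0 0 c"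
  by (simp_all add: mo_def)

lemma mon_degree_mo [simp]: "mon_degree (mo i j k l) = i + j + k + l"
  by (simp add: mo_def)

lemma mult_bounds:
  fixes z :: int and u :: nat
  shows "1 \<le> z \<Longrightarrow> int u \<le> z * int u" "z \<le> -1 \<Longrightarrow> z * int u \<le> - int u"
proof -
  show "1 \<le> z \<Longrightarrow> int u \<le> z * int u" using mult_right_mono[of 1 z "int u"] by simp
  show "z \<le> -1 \<Longrightarrow> z * int u \<le> - int u" using mult_right_mono[of z "-1" "int u"] by simp
qed

text \<open>The products of an unknown integer with an exponent are bounded according to the sign of
  the integer; with these facts the lattice equations become accessible to linear
  arithmetic.\<close>

lemma mult_cases:
  fixes z :: int and u :: nat
  shows "1 \<le> z \<and> int u \<le> z * int u \<or> z = 0 \<and> z * int u = 0 \<or> z \<le> -1 \<and> z * int u \<le> - int u"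
  using mult_bounds(1,2)[of z u] by (cases z "0 :: int" rule: linorder_cases) auto

lemma (in monomial_curve) wt_mo [simp]: "wt (mo i j k l) = i * n 1 + j * n 2 + k * n 3 + l * n 4"
  by (simp add: mo_def)

text \<open>The hypotheses on the toric ideal enter only through these arithmetic consequences;
  \<open>weight12_cong\<close> stands for generation by the three binomials. The exponents
  \<open>u\<close> are those obtained after the reduction to \<open>u 2 < a 2\<close>.\<close>

locale complete_intersection_curve = monomial_curve +
  fixes a u :: "4 \<Rightarrow> nat"
  assumes crit: "c < a x \<Longrightarrow> wt m = c * n x \<Longrightarrow> m = Poly_Mapping.single x c"
    and rel12: "a 1 * n 1 = a 2 * n 2"
    and rel34: "a 3 * n 3 = a 4 * n 4"
    and rel1234: "u 1 * n 1 + u 2 * n 2 = u 3 * n 3 + u 4 * n 4"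
    and weight12_cong: "wt (mo i j k l) = wt (mo i' j' k' l') \<Longrightarrow>
      \<exists>z::int. int (i' * n 1 + j' * n 2) = int (i * n 1 + j * n 2) + z * int (u 1 * n 1 + u 2 * n 2)"
    and a_pos: "0 < a x"
    and a34: "a 3 < a 4"
    and u1_pos: "0 < u 1" and u2_less: "u 2 < a 2"
    and u3_pos: "0 < u 3" and u3_le: "u 3 \<le> a 3" and u4_pos: "0 < u 4"
begin

text \<open>Division of \<open>x\<close> by \<open>a i\<close> leaves a relation below the critical
  exponent, which \<open>crit\<close> forces to be trivial.\<close>

lemma ratio_nat:
  assumes ij: "i \<noteq> j" "a i * n i = a j * n j" and xy: "x * n i = y * n j"
  shows "\<exists>t. x = t * a i \<and> y = t * a j"
proof -
  define t r where "t = x div a i" and "r = x mod a i"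
  have x: "x = t * a i + r" by (simp add: t_def r_def)
  have r: "r < a i" using a_pos[of i] by (simp add: r_def)
  have "t * (a i * n i) + r * n i = y * n j" using xy unfolding x by (simp add: algebra_simps)
  then have eq: "t * a j * n j + r * n i = y * n j" by (simp add: ij(2))
  then have "t * a j * n j \<le> y * n j" by linarith
  then have "t * a j \<le> y" using n_pos[of j] by simp
  then obtain y' where y': "y = t * a j + y'" using le_Suc_ex by blast
  from eq have "y' * n j = r * n i" by (simp add: y' distrib_right)
  then have "Poly_Mapping.single j y' = Poly_Mapping.single i r" by (intro crit[OF r]) simp
  then have "y' = 0 \<and> r = 0"
    using ij(1) by (metis lookup_single_eq lookup_single_not_eq)
  then show ?thesis using x y' by auto
qed

lemma ratio_int:
  fixes x y :: int
  assumes ij: "i \<noteq> j" "a i * n i = a j * n j" and xy: "x * int (n i) + y * int (n j) = 0"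
  shows "\<exists>t. x = t * int (a i) \<and> y = - t * int (a j)"
proof -
  have *: "\<exists>t. x = t * int (a i) \<and> y = - t * int (a j)"
    if "0 \<le> x" "x * int (n i) + y * int (n j) = 0" for x y :: int
  proof -
    have "y * int (n j) \<le> 0" using that by (metis add_nonneg_eq_0_iff linear mult_nonneg_nonneg of_nat_0_le_iff order_refl)
    then have "y \<le> 0" using n_pos[of j] by (simp add: mult_le_0_iff)
    define x' y' where "x' = nat x" and "y' = nat (- y)"
    have x': "x = int x'" and y': "y = - int y'" using that(1) \<open>y \<le> 0\<close> by (simp_all add: x'_def y'_def)
    have "int (x' * n i) = int (y' * n j)" using that(2) by (simp add: x' y')
    then have "x' * n i = y' * n j" by (simp only: of_nat_eq_iff)
    then obtain t where "x' = t * a i" "y' = t * a j" using ratio_nat[OF ij] by blast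
    then show ?thesis by (intro exI[of _ "int t"]) (simp add: x' y')
  qed
  show ?thesis
  proof (cases "0 \<le> x")
    case False
    then have "0 \<le> - x" "(- x) * int (n i) + (- y) * int (n j) = 0" using xy by auto
    from *[OF this] obtain t where "- x = t * int (a i)" "- y = - t * int (a j)" by blast
    then show ?thesis by (intro exI[of _ "- t"]) simp
  qed (use * xy in blast)
qed

text \<open>The multiple \<open>z\<close> of the third binomial is fixed first. Then the weights in
  x1, x2 and in x3, x4 balance separately, and what is left consists of multiples \<open>t\<close>
  and \<open>s\<close> of the first two binomials. The last equation links \<open>z\<close> to the
  weight carried by x1 and x2.\<close>

lemma lattice:
  assumes "wt (mo i j k l) = wt (mo i' j' k' l')"
  obtains z t s :: int where
    "int i' = int i + z * int (u 1) - t * int (a 1)"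
    "int j' = int j + z * int (u 2) + t * int (a 2)"
    "int k' = int k - z * int (u 3) + s * int (a 3)"
    "int l' = int l - z * int (u 4) - s * int (a 4)"
    "int (i' * n 1 + j' * n 2) = int (i * n 1 + j * n 2) + z * int (u 1 * n 1 + u 2 * n 2)"
proof -
  obtain z where z: "int (i' * n 1 + j' * n 2) = int (i * n 1 + j * n 2) + z * int (u 1 * n 1 + u 2 * n 2)"
    using weight12_cong[OF assms] by blast
  have "(int i + z * int (u 1) - int i') * int (n 1) + (int j + z * int (u 2) - int j') * int (n 2) = 0"
    using z by (simp add: algebra_simps)
  from ratio_int[OF _ rel12 this] obtain t where
    t: "int i + z * int (u 1) - int i' = t * int (a 1)" "int j + z * int (u 2) - int j' = - t * int (a 2)"
    by auto
  have "int (i * n 1 + j * n 2 + k * n 3 + l * n 4) = int (i' * n 1 + j' * n 2 + k' * n 3 + l' * n 4)"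
    using assms by simp
  moreover have "z * int (u 1 * n 1 + u 2 * n 2) = z * int (u 3 * n 3 + u 4 * n 4)"
    using rel1234 by simp
  ultimately have "(int k' - int k + z * int (u 3)) * int (n 3) + (int l' - int l + z * int (u 4)) * int (n 4) = 0"
    using z by (simp add: algebra_simps)
  from ratio_int[OF _ rel34 this] obtain s where
    s: "int k' - int k + z * int (u 3) = s * int (a 3)" "int l' - int l + z * int (u 4) = - s * int (a 4)"
    by auto
  show ?thesis by (rule that[of z t s]) (use z t s in auto)
qed

section \<open>Comparison of weights and the three pure powers\<close>

lemma a2_le_a1: "a 2 \<le> a 1"
proof -
  have "a 2 * n 1 \<le> a 2 * n 2" using n1_min[of 2] by simp
  also have "\<dots> = a 1 * n 1" using rel12 by simp
  finally show ?thesis using n_pos[of 1] by simp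
qed

text \<open>Equal exponents force equal weights, and then x1 and x2 already satisfy a relation of
  degree 1.\<close>

lemma a1_eq_a2D:
  assumes "a 1 = a 2"
  shows "n 1 = n 2" "a 2 = 1" "u 2 = 0"
proof -
  show n: "n 1 = n 2" using rel12 assms a_pos[of 1] by simp
  show "a 2 = 1"
  proof (rule ccontr)
    assume "a 2 \<noteq> 1"
    then have "1 < a 1" using a_pos[of 2] assms by simp
    then have "mo 0 1 0 0 = Poly_Mapping.single 1 1" by (rule crit) (simp add: n)
    then show False by (simp add: single_eq_mo)
  qed
  then show "u 2 = 0" using u2_less by simp
qed

text \<open>Here \<open>1 < a 1\<close>, so by \<open>crit\<close> no other variable has the weight
  of x1.\<close>

lemma a1_neq_a2D:
  assumes "a 1 \<noteq> a 2"
  shows "j \<noteq> 1 \<Longrightarrow> n 1 < n j"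
proof -
  assume "j \<noteq> 1"
  have "1 < a 1" using assms a2_le_a1 a_pos[of 2] by linarith
  have "n 1 \<noteq> n j"
  proof
    assume "n 1 = n j"
    then have "Poly_Mapping.single j (1::nat) = Poly_Mapping.single 1 1"
      using crit[OF \<open>1 < a 1\<close>, of "Poly_Mapping.single j 1"] by (simp del: One_nat_def)
    then show False using \<open>j \<noteq> 1\<close> by (metis lookup_single_eq lookup_single_not_eq zero_neq_one)
  qed
  then show "n 1 < n j" using n1_min[of j] by simp
qed

lemma n4_less_n3: "n 4 < n 3"
proof (rule ccontr)
  assume "\<not> n 4 < n 3"
  then have "a 3 * n 3 \<le> a 3 * n 4" by simp
  also have "\<dots> < a 4 * n 4" using a34 n_pos[of 4] by simp
  finally show False using rel34 by simp
qed

lemma not_bad_less_crit: "c < a i \<Longrightarrow> \<not> bad (Poly_Mapping.single i c)"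
  unfolding bad_def using crit[of c i] by auto

lemma minimal_bad_single:
  assumes "bad (Poly_Mapping.single i c)" "\<And>c'. c' < c \<Longrightarrow> \<not> bad (Poly_Mapping.single i c')"
  shows "minimal_bad (Poly_Mapping.single i c)"
  unfolding minimal_bad_def
proof (intro conjI allI impI)
  fix x m' assume *: "Poly_Mapping.single i c = Poly_Mapping.single x 1 + m'"
  have eq: "Poly_Mapping.lookup (Poly_Mapping.single i c) y =
      Poly_Mapping.lookup (Poly_Mapping.single x 1) y + Poly_Mapping.lookup m' y" for y
    by (simp add: * lookup_add)
  have "x = i" using eq[of x] by (cases "x = i") (auto simp: lookup_single)
  then have "c = Suc (Poly_Mapping.lookup m' i)" using eq[of i] by (simp add: lookup_single)
  moreover have "m' = Poly_Mapping.single i (Poly_Mapping.lookup m' i)"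
  proof (rule poly_mapping_eqI)
    fix y
    show "Poly_Mapping.lookup m' y = Poly_Mapping.lookup (Poly_Mapping.single i (Poly_Mapping.lookup m' i)) y"
      using eq[of y] \<open>x = i\<close> by (cases "y = i") (auto simp: lookup_single)
  qed
  ultimately show "\<not> bad m'" using assms(2)[of "Poly_Mapping.lookup m' i"] by simp
qed (rule assms(1))

lemma minimal_bad_2: "minimal_bad (mo 0 (a 2) 0 0)"
proof -
  have "bad (mo 0 (a 2) 0 0)"
    unfolding bad_def using rel12 a2_le_a1 a_pos[of 2] by (intro exI[of _ "mo (a 1) 0 0 0"]) simp
  then show ?thesis
    using minimal_bad_single[of 2 "a 2"] not_bad_less_crit[of _ 2] by (simp add: single_eq_mo)
qed

lemma not_maximal_3: "\<not> maximal (mo 0 0 (a 3) 0)"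
  unfolding maximal_def using rel34 a34 by (auto intro!: exI[of _ "mo 0 0 0 (a 4)"])

lemma minimal_bad_3: "minimal_bad (mo 0 0 (a 3) 0)"
  using minimal_bad_single[of 3 "a 3"] not_bad_less_crit[of _ 3] not_maximal_imp_bad[OF not_maximal_3]
  by (simp add: single_eq_mo)

lemma maximal_2D: "maximal (mo 0 (a 2) 0 0) \<Longrightarrow> a 1 = a 2"
  unfolding maximal_def using a2_le_a1 rel12 by (auto dest!: spec[of _ "mo (a 1) 0 0 0"])

text \<open>Unlike for x2 and x3, the least bad power is not read off a binomial: x4^(a 4) is the
  term of larger degree in the second one, so \<open>c4\<close> may exceed
  \<open>a 4\<close>.\<close>

definition c4 :: nat where
  "c4 = (LEAST c. bad (mo 0 0 0 c))"

lemma bad_c4: "bad (mo 0 0 0 c4)"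
  unfolding c4_def
proof (rule LeastI)
  \<comment> \<open>The monomial x1^(n 4) has the same weight and at least the same degree.\<close>
  show "bad (mo 0 0 0 (n 1))"
    unfolding bad_def using n_pos n1_min[of 4]
    by (intro exI[of _ "mo (n 4) 0 0 0"]) (auto simp: mult.commute)
qed

lemma not_bad_less_c4: "c < c4 \<Longrightarrow> \<not> bad (mo 0 0 0 c)"
  unfolding c4_def by (rule not_less_Least)

lemma minimal_bad_4: "minimal_bad (mo 0 0 0 c4)"
  using minimal_bad_single[of 4 c4] bad_c4 not_bad_less_c4 by (simp add: single_eq_mo)

lemma a4_le_c4: "a 4 \<le> c4"
  using bad_c4 not_bad_less_crit[of c4 4] by (auto simp: single_eq_mo not_less[symmetric])

text \<open>If x2^(a 2) is maximal, it is the variable x2 itself, of degree too small to share a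
  class with a member of \<open>T\<close>.\<close>

lemma unrelated_2:
  assumes "\<And>m. m \<in> T \<Longrightarrow> 2 \<le> mon_degree m" "mo 0 (a 2) 0 0 \<notin> T"
  shows "unrelated {mo 0 (a 2) 0 0} T"
  unfolding unrelated_def
proof (intro conjI ballI impI)
  fix m m' assume m: "m \<in> {mo 0 (a 2) 0 0}" "m' \<in> T" "maximal m"
  then have "a 2 = 1" using maximal_2D a1_eq_a2D by auto
  with m assms(1)[OF m(2)] show "\<not> (wt m = wt m' \<and> mon_degree m = mon_degree m')" by auto
qed (use assms in auto)

lemma unrelated_if_not_maximal:
  "(\<And>m. m \<in> T \<Longrightarrow> \<not> maximal m) \<Longrightarrow> T \<inter> T' = {} \<Longrightarrow> unrelated T T'"
  by (auto simp: unrelated_def)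

lemma unrelated_3: "mo 0 0 (a 3) 0 \<notin> T \<Longrightarrow> unrelated {mo 0 0 (a 3) 0} T"
  using not_maximal_3 by (intro unrelated_if_not_maximal) auto

lemma unrelated_share:
  assumes "minimal_bad m" "minimal_bad m'" "m \<noteq> m'"
    and "0 < Poly_Mapping.lookup m i" "0 < Poly_Mapping.lookup m' i"
  shows "unrelated {m} {m'}"
  using minimal_bad_unrelated[OF assms] assms(3) by (auto simp: unrelated_def)

lemma two_le_c4: "2 \<le> c4"
  using a4_le_c4 a34 a_pos[of 3] by linarith

lemma three_le_min_num_gens: "3 \<le> min_num_gens poly4_ring (tangent_ideal :: 'k::field poly4 set)"
proof -
  let ?Ts = "[{mo 0 0 (a 3) 0}, {mo 0 (a 2) 0 0}, {mo 0 0 0 c4}]"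
  have "enat (length ?Ts) \<le> min_num_gens poly4_ring (tangent_ideal :: 'k poly4 set)"
  proof (rule min_num_gens_ge_admissible)
    show "admissible T" if "T \<in> set ?Ts" for T
      using that minimal_bad_admissible[OF minimal_bad_2] minimal_bad_admissible[OF minimal_bad_3]
        minimal_bad_admissible[OF minimal_bad_4] by auto
    have "unrelated {mo 0 (a 2) 0 0} {mo 0 0 0 c4}"
      by (rule unrelated_2) (use two_le_c4 a_pos[of 2] in auto)
    then show "sorted_wrt unrelated ?Ts"
      using a_pos[of 3] by (auto intro!: unrelated_3)
  qed
  then show ?thesis by (simp add: numeral_eq_enat eval_nat_numeral)
qed

end

section \<open>Normal forms and the tame case\<close>

context complete_intersection_curve
begin

text \<open>The difference of the degrees of the two terms of the third binomial is at least that of the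
  second binomial.\<close>

definition tame :: bool where
  "tame \<longleftrightarrow> a 4 + u 3 + u 4 \<le> u 1 + u 2 + a 3"

definition normal :: "(4 \<Rightarrow>\<^sub>0 nat) \<Rightarrow> bool" where
  "normal m \<longleftrightarrow> Poly_Mapping.lookup m 2 < a 2 \<and> Poly_Mapping.lookup m 3 < a 3 \<and>
     Poly_Mapping.lookup m 4 < a 4 + u 4 \<and> \<not> (u 3 \<le> Poly_Mapping.lookup m 3 \<and> u 4 \<le> Poly_Mapping.lookup m 4)"

definition wt12 :: "(4 \<Rightarrow>\<^sub>0 nat) \<Rightarrow> nat" where
  "wt12 m = Poly_Mapping.lookup m 1 * n 1 + Poly_Mapping.lookup m 2 * n 2"

lemma wt12_mo [simp]: "wt12 (mo i j k l) = i * n 1 + j * n 2"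
  by (simp add: wt12_def)

lemma w_pos: "0 < u 1 * n 1 + u 2 * n 2"
  using u1_pos n_pos[of 1] by simp

text \<open>By the assumed order of \<open>wt12\<close>, \<open>z\<close> is nonnegative. For z = 0
  the bounds on the exponents of x2 and x3 leave no room for \<open>t\<close> or \<open>s\<close>.
  For z at least 1, each sign of \<open>s\<close> contradicts one condition on the exponents of x3
  and x4.\<close>

lemma normal_unique_aux:
  assumes "normal m" "normal m'" "wt m = wt m'" "wt12 m \<le> wt12 m'"
  shows "m = m'"
proof -
  obtain i j k l where m: "m = mo i j k l" by (rule mo_cases)
  obtain i' j' k' l' where m': "m' = mo i' j' k' l'" by (rule mo_cases)
  obtain z t s where eqs:
    "int i' = int i + z * int (u 1) - t * int (a 1)"
    "int j' = int j + z * int (u 2) + t * int (a 2)"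
    "int k' = int k - z * int (u 3) + s * int (a 3)"
    "int l' = int l - z * int (u 4) - s * int (a 4)"
    "int (i' * n 1 + j' * n 2) = int (i * n 1 + j * n 2) + z * int (u 1 * n 1 + u 2 * n 2)"
    using lattice[of i j k l i' j' k' l'] assms(3) m m' by metis
  have nm: "j < a 2" "k < a 3" "l < a 4 + u 4" "\<not> (u 3 \<le> k \<and> u 4 \<le> l)"
    using assms(1) by (simp_all add: m normal_def)
  have nm': "j' < a 2" "k' < a 3"
    using assms(2) by (simp_all add: m' normal_def)
  have "0 \<le> z * int (u 1 * n 1 + u 2 * n 2)" using eqs(5) assms(4) unfolding m m' wt12_mo by linarith
  then have "0 \<le> z" using mult_cases[of z "u 1 * n 1 + u 2 * n 2"] w_pos by linarith
  show ?thesis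
  proof (cases "z = 0")
    case True
    have "t = 0"
    proof (rule ccontr)
      assume "t \<noteq> 0"
      moreover have "int j' = int j + t * int (a 2)" using eqs(2) True by simp
      ultimately show False using mult_cases[of t "a 2"] nm(1) nm'(1) by linarith
    qed
    moreover have "s = 0"
    proof (rule ccontr)
      assume "s \<noteq> 0"
      moreover have "int k' = int k + s * int (a 3)" using eqs(3) True by simp
      ultimately show False using mult_cases[of s "a 3"] nm(2) nm'(2) by linarith
    qed
    ultimately show ?thesis using eqs True by (simp add: m m')
  next
    case False
    then have z: "1 \<le> z" using \<open>0 \<le> z\<close> by linarith
    note zu = mult_bounds(1)[OF z, of "u 3"] mult_bounds(1)[OF z, of "u 4"]
    consider "1 \<le> s" | "s = 0" | "s \<le> -1" by linarith
    then have False
    proof cases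
      case 1
      then show False using mult_cases[of s "a 4"] eqs(4) zu nm(3) by linarith
    next
      case 2
      then have "s * int (a 3) = 0" "s * int (a 4) = 0" by simp_all
      then have "u 3 \<le> k" "u 4 \<le> l" using eqs(3,4) zu by linarith+
      then show False using nm(4) by blast
    next
      case 3
      then show False using mult_cases[of s "a 3"] eqs(3) zu nm(2) by linarith
    qed
    then show ?thesis ..
  qed
qed

lemma normal_unique: "normal m \<Longrightarrow> normal m' \<Longrightarrow> wt m = wt m' \<Longrightarrow> m = m'"
  using normal_unique_aux[of m m'] normal_unique_aux[of m' m] by (metis linear)

text \<open>Oriented relations: the three binomials and the one from the overlap of x3^(a 3) with
  x3^(u 3) x4^(u 4). Their left sides are the monomials excluded by \<open>normal\<close>.\<close>

definition rules :: "((4 \<Rightarrow>\<^sub>0 nat) \<times> (4 \<Rightarrow>\<^sub>0 nat)) set" where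
  "rules = {(mo 0 (a 2) 0 0, mo (a 1) 0 0 0), (mo 0 0 (a 3) 0, mo 0 0 0 (a 4)),
     (mo 0 0 (u 3) (u 4), mo (u 1) (u 2) 0 0),
     (mo 0 0 0 (a 4 + u 4), mo (u 1) (u 2) (a 3 - u 3) 0)}"

text \<open>For a rule that does not lower the degree, this is the initial form of the
  binomial.\<close>

definition rule_form :: "(4 \<Rightarrow>\<^sub>0 nat) \<times> (4 \<Rightarrow>\<^sub>0 nat) \<Rightarrow> 'k::field poly4" where
  "rule_form = (\<lambda>(x, y). if mon_degree x < mon_degree y then pmon x else pmon x - pmon y)"

lemma wt_a4_u4: "(a 4 + u 4) * n 4 = u 1 * n 1 + u 2 * n 2 + (a 3 - u 3) * n 3"
proof -
  obtain e where e: "a 3 = u 3 + e" using u3_le le_Suc_ex by blast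
  have "(a 4 + u 4) * n 4 = a 3 * n 3 + u 4 * n 4" using rel34 by (simp add: distrib_right)
  also have "\<dots> = u 3 * n 3 + u 4 * n 4 + e * n 3" by (simp add: e distrib_right)
  finally show ?thesis using rel1234 e by simp
qed

lemma rules_wt: "(x, y) \<in> rules \<Longrightarrow> wt x = wt y"
  using rel12 rel34 rel1234 wt_a4_u4 by (auto simp: rules_def)

lemma rules_degree:
  assumes "tame" "(x, y) \<in> rules"
  shows "mon_degree x \<le> mon_degree y"
  using assms a34 a2_le_a1 u3_le by (auto simp: rules_def tame_def)

text \<open>The last two rules move weight from x3, x4 to x1, x2. The first two keep that
  distribution and lower the exponent of x2, respectively keep it and lower that of x3; hence the
  lexicographic measure.\<close>

lemma reducible:
  assumes "\<not> normal m"
  obtains x y r where "(x, y) \<in> rules" "m = x + r"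
    "(y + r, m) \<in> measures [\<lambda>m. wt m - wt12 m, \<lambda>m. Poly_Mapping.lookup m 2, \<lambda>m. Poly_Mapping.lookup m 3]"
proof -
  obtain i j k l where m: "m = mo i j k l" by (rule mo_cases)
  note * = that[unfolded m]
  consider "a 2 \<le> j" | "a 3 \<le> k" | "u 3 \<le> k" "u 4 \<le> l" | "a 4 + u 4 \<le> l"
    using assms by (auto simp: normal_def m not_less)
  then show ?thesis
  proof cases
    case 1
    then obtain j' where j': "j = a 2 + j'" using le_Suc_ex by blast
    show ?thesis
    proof (rule *[of "mo 0 (a 2) 0 0" "mo (a 1) 0 0 0" "mo i j' k l"])
      show "(mo (a 1) 0 0 0 + mo i j' k l, mo i j k l)
        \<in> measures [\<lambda>m. wt m - wt12 m, \<lambda>m. Poly_Mapping.lookup m 2, \<lambda>m. Poly_Mapping.lookup m 3]"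
        using rel12 a_pos[of 2] by (simp add: j' distrib_right)
    qed (simp_all add: rules_def j')
  next
    case 2
    then obtain k' where k': "k = a 3 + k'" using le_Suc_ex by blast
    show ?thesis
    proof (rule *[of "mo 0 0 (a 3) 0" "mo 0 0 0 (a 4)" "mo i j k' l"])
      show "(mo 0 0 0 (a 4) + mo i j k' l, mo i j k l)
        \<in> measures [\<lambda>m. wt m - wt12 m, \<lambda>m. Poly_Mapping.lookup m 2, \<lambda>m. Poly_Mapping.lookup m 3]"
        using rel34 a_pos[of 3] by (simp add: k' distrib_right)
    qed (simp_all add: rules_def k')
  next
    case 3
    then obtain k' l' where kl: "k = u 3 + k'" "l = u 4 + l'" using le_Suc_ex by metis
    show ?thesis
    proof (rule *[of "mo 0 0 (u 3) (u 4)" "mo (u 1) (u 2) 0 0" "mo i j k' l'"])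
      show "(mo (u 1) (u 2) 0 0 + mo i j k' l', mo i j k l)
        \<in> measures [\<lambda>m. wt m - wt12 m, \<lambda>m. Poly_Mapping.lookup m 2, \<lambda>m. Poly_Mapping.lookup m 3]"
        using rel1234 w_pos by (simp add: kl distrib_right)
    qed (simp_all add: rules_def kl)
  next
    case 4
    then obtain l' where l': "l = a 4 + u 4 + l'" using le_Suc_ex by blast
    show ?thesis
    proof (rule *[of "mo 0 0 0 (a 4 + u 4)" "mo (u 1) (u 2) (a 3 - u 3) 0" "mo i j k l'"])
      show "(mo (u 1) (u 2) (a 3 - u 3) 0 + mo i j k l', mo i j k l)
        \<in> measures [\<lambda>m. wt m - wt12 m, \<lambda>m. Poly_Mapping.lookup m 2, \<lambda>m. Poly_Mapping.lookup m 3]"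
        using wt_a4_u4 w_pos by (simp add: l' distrib_right)
    qed (simp_all add: rules_def l')
  qed
qed

text \<open>Degrees never drop along the reduction. One strict increase puts the monomial itself
  into \<open>G\<close>; without any, its difference with the normal form lies there.\<close>

lemma normal_form:
  assumes "tame" and G: "tc_ideal (G :: 'k::field poly4 set)" "rule_form ` rules \<subseteq> G"
  shows "\<exists>m0. normal m0 \<and> wt m0 = wt m \<and>
    (mon_degree m < mon_degree m0 \<and> pmon m \<in> G \<or> mon_degree m = mon_degree m0 \<and> pmon m - pmon m0 \<in> G)"
proof (induction m rule: wf_induct_rule[OF wf_measures[of
      "[\<lambda>m. wt m - wt12 m, \<lambda>m. Poly_Mapping.lookup m 2, \<lambda>m. Poly_Mapping.lookup m 3]"]])
  case (1 m)
  show ?case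
  proof (cases "normal m")
    case True
    then show ?thesis using tc_idealD(1)[OF G(1)] by (intro exI[of _ m]) simp
  next
    case False
    then obtain x y r where xy: "(x, y) \<in> rules" and m: "m = x + r"
      and less: "(y + r, m) \<in> measures [\<lambda>m. wt m - wt12 m, \<lambda>m. Poly_Mapping.lookup m 2, \<lambda>m. Poly_Mapping.lookup m 3]"
      by (rule reducible)
    from 1[OF less] obtain m0 where m0: "normal m0" "wt m0 = wt (y + r)"
      and disj: "mon_degree (y + r) < mon_degree m0 \<and> pmon (y + r) \<in> G \<or>
        mon_degree (y + r) = mon_degree m0 \<and> pmon (y + r) - pmon m0 \<in> G" by blast
    have wt: "wt m0 = wt m" using m0(2) rules_wt[OF xy] by (simp add: m)
    have deg: "mon_degree x \<le> mon_degree y" by (rule rules_degree[OF assms(1) xy])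
    have form: "rule_form (x, y) \<in> G" using G(2) xy by auto
    show ?thesis
    proof (cases "mon_degree x < mon_degree y")
      case True
      then have "(pmon x :: 'k poly4) * pmon r \<in> G"
        using form by (intro tc_idealD(4)[OF G(1)]) (simp add: rule_form_def)
      then have "(pmon m :: 'k poly4) \<in> G" by (simp add: m mult_single)
      moreover have "mon_degree m < mon_degree m0" using True disj by (auto simp: m)
      ultimately show ?thesis using m0(1) wt by blast
    next
      case False
      with deg have eq: "mon_degree x = mon_degree y" by simp
      have "(pmon x - pmon y :: 'k poly4) * pmon r \<in> G"
        using form False by (intro tc_idealD(4)[OF G(1)]) (simp add: rule_form_def)
      then have diff: "(pmon m - pmon (y + r) :: 'k poly4) \<in> G" by (simp add: m mult_single left_diff_distrib)
      from disj show ?thesis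
      proof
        assume "mon_degree (y + r) < mon_degree m0 \<and> pmon (y + r) \<in> G"
        then have "mon_degree m < mon_degree m0 \<and> pmon m \<in> G"
          using eq tc_ideal_diff_iff[OF G(1) diff] by (simp add: m)
        then show ?thesis using m0(1) wt by blast
      next
        assume *: "mon_degree (y + r) = mon_degree m0 \<and> pmon (y + r) - pmon m0 \<in> G"
        then have "(pmon m - pmon (y + r)) + (pmon (y + r) - pmon m0) \<in> G"
          using diff by (intro tc_idealD(2)[OF G(1)]) auto
        then have "mon_degree m = mon_degree m0 \<and> pmon m - pmon m0 \<in> G"
          using * eq by (simp add: m)
        then show ?thesis using m0(1) wt by blast
      qed
    qed
  qed
qed

text \<open>The degree statement involves neither field nor ideal, so it is read off for the unit
  ideal over the rationals.\<close>

lemma normal_form_degree: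
  assumes "tame"
  obtains m0 where "normal m0" "wt m0 = wt m" "mon_degree m \<le> mon_degree m0"
  using normal_form[OF assms, of "UNIV :: rat poly4 set" m] by (auto simp: tc_ideal_def)

text \<open>Every monomial of the same weight reduces, without loss of degree, to the unique normal
  monomial of that weight.\<close>

lemma normal_imp_maximal:
  assumes "tame" "normal m"
  shows "maximal m"
  unfolding maximal_def
proof (intro allI impI)
  fix m' assume wt: "wt m' = wt m"
  obtain m0 where m0: "normal m0" "wt m0 = wt m'" "mon_degree m' \<le> mon_degree m0"
    using normal_form_degree[OF assms(1), of m'] by blast
  have "m = m0" by (rule normal_unique) (use assms(2) m0 wt in simp_all)
  then show "mon_degree m' \<le> mon_degree m" using m0(3) by simp
qed

lemma tame_maximal:
  assumes "tame" "maximal m"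
  shows "maximal (Poly_Mapping.single 1 1 + m)"
proof -
  obtain m0 where m0: "normal m0" "wt m0 = wt m" "mon_degree m \<le> mon_degree m0"
    using normal_form_degree[OF assms(1), of m] by blast
  then have deg: "mon_degree m = mon_degree m0"
    using maximal_wt_eqD[OF assms(2) normal_imp_maximal[OF assms(1) m0(1)]] by simp
  obtain i j k l where m0_eq: "m0 = mo i j k l" by (rule mo_cases)
  have "normal (Poly_Mapping.single 1 1 + m0)"
    using m0(1) by (simp add: m0_eq single_eq_mo normal_def)
  then have "maximal (Poly_Mapping.single 1 1 + m0)" by (rule normal_imp_maximal[OF assms(1)])
  then show ?thesis using maximal_fib_cong[of "Poly_Mapping.single 1 1 + m" "Poly_Mapping.single 1 1 + m0"] deg m0(2) by simp
qed

lemma tame_generators: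
  assumes "tame"
  shows "genideal poly4_ring (rule_form ` rules) = (tangent_ideal :: 'k::field poly4 set)"
proof (rule roa_genideal_eqI)
  show "tc_ideal (tangent_ideal :: 'k poly4 set)" by (rule tc_ideal_tangent)
  have "rule_form xy \<in> (tangent_ideal :: 'k poly4 set)" if "xy \<in> rules" for xy
  proof -
    obtain x y where xy: "xy = (x, y)" by (cases xy)
    then have wt: "wt x = wt y" and deg: "mon_degree x \<le> mon_degree y"
      using rules_wt rules_degree[OF assms] that by auto
    show ?thesis
    proof (cases "mon_degree x < mon_degree y")
      case True
      then have "\<not> maximal x" using wt unfolding maximal_def by (metis not_less)
      with True show ?thesis by (simp add: rule_form_def xy pmon_tangent_iff)
    next
      case False
      with wt deg show ?thesis by (simp add: rule_form_def xy pmon_diff_tangent)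
    qed
  qed
  then show "rule_form ` rules \<subseteq> (tangent_ideal :: 'k poly4 set)" by blast
next
  fix G :: "'k poly4 set" assume G: "tc_ideal G" "rule_form ` rules \<subseteq> G"
  note nf = normal_form[OF assms G]
  show "tangent_ideal \<subseteq> G"
  proof (rule tangent_ideal_subset[OF G(1)])
    fix m assume m: "\<not> maximal m"
    obtain m0 where m0: "normal m0" "wt m0 = wt m" and disj: "mon_degree m < mon_degree m0 \<and> pmon m \<in> G \<or>
        mon_degree m = mon_degree m0 \<and> pmon m - pmon m0 \<in> G" using nf[of m] by blast
    have "mon_degree m \<noteq> mon_degree m0"
      using m maximal_fib_cong[of m m0] m0 normal_imp_maximal[OF assms] by auto
    with disj show "pmon m \<in> G" by blast
  next
    fix m m' assume m: "maximal m" "maximal m'" "wt m = wt m'"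
    have *: "\<exists>m0. normal m0 \<and> wt m0 = wt x \<and> pmon x - pmon m0 \<in> G" if "maximal x" for x
    proof -
      obtain m0 where m0: "normal m0" "wt m0 = wt x" and disj: "mon_degree x < mon_degree m0 \<and> pmon x \<in> G \<or>
        mon_degree x = mon_degree m0 \<and> pmon x - pmon m0 \<in> G" using nf[of x] by blast
      moreover have "\<not> mon_degree x < mon_degree m0"
        using maximal_wt_eqD[OF that normal_imp_maximal[OF assms m0(1)]] m0(2) by simp
      ultimately show ?thesis by blast
    qed
    obtain m0 where m0: "normal m0" "wt m0 = wt m" "pmon m - pmon m0 \<in> G" using *[OF m(1)] by blast
    obtain m1 where m1: "normal m1" "wt m1 = wt m'" "pmon m' - pmon m1 \<in> G" using *[OF m(2)] by blast
    have "m0 = m1" by (rule normal_unique) (use m0 m1 m in auto)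
    then show "pmon m - pmon m' \<in> G" using tc_ideal_diff[OF G(1) m0(3) m1(3)] by simp
  qed
qed

lemma tame_min_num_gens:
  assumes "tame"
  shows "min_num_gens poly4_ring (tangent_ideal :: 'k::field poly4 set) \<le> 4"
proof -
  have fin: "finite rules" by (simp add: rules_def)
  have "card (rule_form ` rules :: 'k poly4 set) \<le> card rules" by (rule card_image_le[OF fin])
  also have "\<dots> \<le> 4" by (simp add: rules_def card_insert_if)
  finally have c: "enat (card (rule_form ` rules :: 'k poly4 set)) \<le> 4" by (simp add: numeral_eq_enat)
  show ?thesis
    unfolding min_num_gens_def
    by (rule INF_lower2[of "rule_form ` rules"]) (use fin c tame_generators[OF assms] in auto)
qed

text \<open>The full monomial is beaten by x4^(a 4 + u 4). With one x1 less, only the first binomial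
  can still be applied, and trading x1^(a 1) for x2^(a 2) gains no degree.\<close>

lemma not_tame_maximal:
  assumes "\<not> tame"
  shows "maximal (mo (u 1 - 1) (u 2) (a 3 - u 3) 0)"
    and "\<not> maximal (mo (u 1) (u 2) (a 3 - u 3) 0)"
proof -
  show "\<not> maximal (mo (u 1) (u 2) (a 3 - u 3) 0)"
    unfolding maximal_def using assms wt_a4_u4 u3_le
    by (auto simp: tame_def intro!: exI[of _ "mo 0 0 0 (a 4 + u 4)"])
  show "maximal (mo (u 1 - 1) (u 2) (a 3 - u 3) 0)"
    unfolding maximal_def
  proof (intro allI impI)
    fix m' assume wt: "wt m' = wt (mo (u 1 - 1) (u 2) (a 3 - u 3) 0)"
    obtain i' j' k' l' where m': "m' = mo i' j' k' l'" by (rule mo_cases)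
    obtain z t s where eqs:
      "int i' = int (u 1 - 1) + z * int (u 1) - t * int (a 1)"
      "int j' = int (u 2) + z * int (u 2) + t * int (a 2)"
      "int k' = int (a 3 - u 3) - z * int (u 3) + s * int (a 3)"
      "int l' = int 0 - z * int (u 4) - s * int (a 4)"
      using lattice[of "u 1 - 1" "u 2" "a 3 - u 3" 0 i' j' k' l'] wt m' by metis
    note mc = mult_cases[of z "u 1"] mult_cases[of z "u 2"] mult_cases[of z "u 3"] mult_cases[of z "u 4"]
      mult_cases[of t "a 1"] mult_cases[of t "a 2"] mult_cases[of s "a 3"] mult_cases[of s "a 4"]
    \<comment> \<open>Removing x1^(u 1) is no longer possible, so x1 would have to be regained from
      x2 by a negative \<open>t\<close>; but \<open>u 2 < a 2\<close> leaves too little x2.\<close>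
    have "\<not> z \<le> -1"
    proof
      assume z: "z \<le> -1"
      have "t \<le> -1" using z eqs(1) mc(1,5) u1_pos by linarith
      then show False using z eqs(2) mc(2,6) a_pos[of 2] by linarith
    qed
    moreover have "0 \<le> z \<Longrightarrow> 0 \<le> s" using eqs(3) mc(3,7) u3_pos u3_le by linarith
    moreover have "0 \<le> z \<Longrightarrow> \<not> 1 \<le> s" using eqs(4) mc(4,8) a_pos[of 4] by linarith
    moreover have "s = 0 \<Longrightarrow> \<not> 1 \<le> z" using eqs(4) mc(4,8) u4_pos by linarith
    ultimately have "s = 0 \<and> z = 0" by linarith
    then have eqs': "int i' = int (u 1 - 1) - t * int (a 1)" "int j' = int (u 2) + t * int (a 2)"
      "k' = a 3 - u 3" "l' = 0" using eqs by auto
    have "0 \<le> t" using mc(6) eqs'(2) u2_less by linarith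
    then have "t * int (a 2) \<le> t * int (a 1)" using a2_le_a1 by (intro mult_left_mono) auto
    then show "mon_degree m' \<le> mon_degree (mo (u 1 - 1) (u 2) (a 3 - u 3) 0)"
      using eqs' by (simp add: m')
  qed
qed

lemma cohen_macaulay_iff_tame: "cohen_macaulay (tangent_cone TYPE('k::field)) \<longleftrightarrow> tame"
proof
  show "tame \<Longrightarrow> cohen_macaulay (tangent_cone TYPE('k))"
    by (rule cohen_macaulay_if) (rule tame_maximal)
  have "Poly_Mapping.single 1 1 + mo (u 1 - 1) (u 2) (a 3 - u 3) 0 = mo (u 1) (u 2) (a 3 - u 3) 0"
    using u1_pos by (simp add: single_eq_mo)
  then show "cohen_macaulay (tangent_cone TYPE('k)) \<Longrightarrow> tame"
    using not_cohen_macaulay_if not_tame_maximal by metis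
qed

end

section \<open>Five minimal generators when the inequality fails\<close>

context complete_intersection_curve
begin

lemma minimal_bad_divisor:
  assumes "bad (mo i j k l)"
  obtains i' j' k' l' where "minimal_bad (mo i' j' k' l')" "i' \<le> i" "j' \<le> j" "k' \<le> k" "l' \<le> l"
proof -
  obtain m' m'' where m: "minimal_bad m'" "mo i j k l = m' + m''"
    using exists_minimal_bad[OF assms] by blast
  obtain i' j' k' l' where m': "m' = mo i' j' k' l'" by (rule mo_cases)
  obtain i2 j2 k2 l2 where m'': "m'' = mo i2 j2 k2 l2" by (rule mo_cases)
  show ?thesis using that[of i' j' k' l'] m by (simp add: m' m'')
qed

text \<open>Exponents below those of the minimal bad pure powers rule out pure powers; this forces
  the minimal bad divisors found later to be mixed.\<close>

lemma bad_not_pure: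
  assumes "bad (mo i j k l)" "j < a 2" "k < a 3" "l < c4"
  shows "\<not> (i = 0 \<and> k = 0 \<and> l = 0)" "\<not> (i = 0 \<and> j = 0 \<and> l = 0)" "\<not> (i = 0 \<and> j = 0 \<and> k = 0)"
  using assms(1) not_bad_less_crit[OF assms(2)] not_bad_less_crit[OF assms(3)] not_bad_less_c4[OF assms(4)]
  by (intro notI; elim conjE; simp add: single_eq_mo)+

text \<open>The weight of x1 is strictly least, so replacing x1 by other variables at equal weight
  loses degree.\<close>

lemma not_bad_1:
  assumes "a 1 \<noteq> a 2"
  shows "\<not> bad (mo i 0 0 0)"
proof
  assume "bad (mo i 0 0 0)"
  then obtain m' where m': "m' \<noteq> mo i 0 0 0" "wt m' = wt (mo i 0 0 0)" "mon_degree (mo i 0 0 0) \<le> mon_degree m'"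
    by (auto simp: bad_def)
  obtain i' j' k' l' where eq: "m' = mo i' j' k' l'" by (rule mo_cases)
  have wt: "i * n 1 = i' * n 1 + j' * n 2 + k' * n 3 + l' * n 4" using m'(2) by (simp add: eq)
  have "i * n 1 \<le> (i' + j' + k' + l') * n 1" using m'(3) by (simp add: eq)
  then have le: "i * n 1 \<le> i' * n 1 + j' * n 1 + k' * n 1 + l' * n 1" by (simp add: distrib_right)
  have *: "x * n 1 \<le> x * n y \<and> (x * n y \<le> x * n 1 \<longrightarrow> x = 0)" if "y \<noteq> 1" for x y
    using a1_neq_a2D[OF assms that] by auto
  have *: "x * n 1 \<le> x * n y" "x * n y \<le> x * n 1 \<Longrightarrow> x = 0" if "y \<noteq> 1" for x y
    using *[OF that, of x] by blast+
  have le4: "j' * n 1 \<le> j' * n 2" "k' * n 1 \<le> k' * n 3" "l' * n 1 \<le> l' * n 4"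
    by (rule *(1), simp)+
  have "j' = 0" using wt le le4 by (intro *(2)[of 2]) (simp, linarith)
  moreover have "k' = 0" using wt le le4 by (intro *(2)[of 3]) (simp, linarith)
  moreover have "l' = 0" using wt le le4 by (intro *(2)[of 4]) (simp, linarith)
  ultimately show False using m'(1) wt n_pos[of 1] by (simp add: eq)
qed

text \<open>For a power of x4 up to \<open>a 4 + u 4\<close> only two exchanges are possible, apart
  from the first binomial: x4^(a 4) for x3^(a 3), which loses degree, and x4^(a 4 + u 4) for x1^(u
  1) x2^(u 2) x3^(a 3 - u 3), which loses degree because the inequality fails.\<close>

lemma c4_greater:
  assumes "\<not> tame"
  shows "a 4 + u 4 < c4"
proof (rule ccontr)
  assume "\<not> a 4 + u 4 < c4"
  then have c4: "c4 \<le> a 4 + u 4" by simp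
  obtain m' where m': "m' \<noteq> mo 0 0 0 c4" "wt m' = wt (mo 0 0 0 c4)" "mon_degree (mo 0 0 0 c4) \<le> mon_degree m'"
    using bad_c4 by (auto simp: bad_def)
  obtain i' j' k' l' where eq: "m' = mo i' j' k' l'" by (rule mo_cases)
  obtain z t s where eqs:
    "int i' = int 0 + z * int (u 1) - t * int (a 1)"
    "int j' = int 0 + z * int (u 2) + t * int (a 2)"
    "int k' = int 0 - z * int (u 3) + s * int (a 3)"
    "int l' = int c4 - z * int (u 4) - s * int (a 4)"
    using lattice[of 0 0 0 c4 i' j' k' l'] m'(2) eq by metis
  have deg: "c4 \<le> i' + j' + k' + l'" using m'(3) by (simp add: eq)
  note mc = mult_cases[of z "u 1"] mult_cases[of z "u 2"] mult_cases[of z "u 3"] mult_cases[of z "u 4"]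
    mult_cases[of t "a 1"] mult_cases[of t "a 2"] mult_cases[of s "a 3"] mult_cases[of s "a 4"]
  consider "z \<le> -1" | "z = 0" | "1 \<le> z" by linarith
  then show False
  proof cases
    case 1
    have "t \<le> -1" using 1 eqs(1) mc(1,5) u1_pos by linarith
    then show False using 1 eqs(2) mc(2,6) a_pos[of 2] by linarith
  next
    case 2
    then have eqs': "int i' = - t * int (a 1)" "int j' = t * int (a 2)" "int k' = s * int (a 3)"
      "int l' = int c4 - s * int (a 4)" using eqs by simp_all
    have "t = 0" using eqs'(1,2) mc(5,6) a_pos[of 1] a_pos[of 2] by linarith
    then have ij: "i' = 0" "j' = 0" using eqs' by simp_all
    have "0 \<le> s" using eqs'(3) mc(7) a_pos[of 3] by linarith
    show False
    proof (cases "s = 0")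
      case True
      then show False using m'(1) eqs' ij by (simp add: eq)
    next
      case False
      then have "s * int (a 3) < s * int (a 4)" using \<open>0 \<le> s\<close> a34 by (intro mult_strict_left_mono) auto
      then show False using deg ij eqs'(3,4) by linarith
    qed
  next
    case 3
    have s: "1 \<le> s" using 3 eqs(3) mc(3,7) u3_pos by linarith
    \<comment> \<open>The exponent \<open>l'\<close> is nonnegative and \<open>c4\<close> is at most
      \<open>a 4 + u 4\<close>, which leaves no room for \<open>z\<close> or \<open>s\<close> above
      1.\<close>
    have "(z - 1) * int (u 4) = z * int (u 4) - int (u 4)" "(s - 1) * int (a 4) = s * int (a 4) - int (a 4)"
      by (simp_all add: left_diff_distrib)
    then have z1: "z = 1" and s1: "s = 1"
      using mult_cases[of "z - 1" "u 4"] mult_cases[of "s - 1" "a 4"] 3 s c4 eqs(4) u4_pos a_pos[of 4]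
      by linarith+
    have "0 \<le> t" using eqs(2) mc(6) u2_less z1 by auto
    then have "t * int (a 2) \<le> t * int (a 1)" using a2_le_a1 by (intro mult_left_mono) auto
    moreover have "int i' = int (u 1) - t * int (a 1)" "int j' = int (u 2) + t * int (a 2)"
      "int k' = int (a 3) - int (u 3)" "int l' = int c4 - int (u 4) - int (a 4)"
      using eqs z1 s1 by simp_all
    ultimately show False using deg assms c4 unfolding tame_def by linarith
  qed
qed

lemma bad_lattice_34: "u 3 + u 4 \<le> u 1 + u 2 \<Longrightarrow> bad (mo 0 0 (u 3) (u 4))"
  unfolding bad_def using rel1234 u1_pos by (intro exI[of _ "mo (u 1) (u 2) 0 0"]) simp

text \<open>This class is a singleton unless the first two weights agree; then the first two variables are
  interchangeable modulo the tangent ideal.\<close>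

definition corner :: "(4 \<Rightarrow>\<^sub>0 nat) set" where
  "corner = {m. wt12 m = u 1 * n 1 + u 2 * n 2 \<and>
     Poly_Mapping.lookup m 1 + Poly_Mapping.lookup m 2 = u 1 + u 2 \<and>
     Poly_Mapping.lookup m 3 = a 3 - u 3 \<and> Poly_Mapping.lookup m 4 = 0}"

lemma mem_corner [simp]: "mo i j k l \<in> corner \<longleftrightarrow>
    i * n 1 + j * n 2 = u 1 * n 1 + u 2 * n 2 \<and> i + j = u 1 + u 2 \<and> k = a 3 - u 3 \<and> l = 0"
  by (simp add: corner_def)

lemma corner_not_maximal:
  assumes "\<not> tame" "m \<in> corner"
  shows "\<not> maximal m"
proof -
  obtain i j k l where m: "m = mo i j k l" by (rule mo_cases)
  have "maximal m = maximal (mo (u 1) (u 2) (a 3 - u 3) 0)"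
    using assms(2) by (intro maximal_fib_cong) (auto simp: m)
  then show ?thesis using not_tame_maximal(2)[OF assms(1)] by simp
qed

text \<open>Sum and weighted sum determine the first two exponents unless
  \<open>n 1 = n 2\<close>.\<close>

lemma corner_second_exponent:
  assumes "mo i j k l \<in> corner"
  shows "a 1 = a 2 \<or> j = u 2"
proof (rule disjCI)
  assume "j \<noteq> u 2"
  have "i * n 1 + j * n 2 = u 1 * n 1 + u 2 * n 2" and sum: "i + j = u 1 + u 2" using assms by simp_all
  then have "int (i * n 1 + j * n 2) = int (u 1 * n 1 + u 2 * n 2)" by (simp only:)
  then have "int i * int (n 1) + int j * int (n 2) = int (u 1) * int (n 1) + int (u 2) * int (n 2)"
    by (simp only: of_nat_add of_nat_mult)
  moreover have "int i = int (u 1) + int (u 2) - int j" using sum by linarith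
  ultimately have "(int j - int (u 2)) * (int (n 2) - int (n 1)) = 0" by (simp add: algebra_simps)
  then have "n 1 = n 2" using \<open>j \<noteq> u 2\<close> by simp
  then show "a 1 = a 2" using a1_neq_a2D[of 2] by force
qed

text \<open>The alternatives describe a corner monomial after division by x1 or x2, respectively by
  x3. In the first too little weight remains in x1, x2 for a negative \<open>z\<close>. In the
  second z = -1 is possible but consumes all of x1 and x2, and u 3 + u 4 < u 1 + u 2 makes the
  degree drop. Positive \<open>z\<close> would make the exponent of x3 or x4 negative.\<close>

lemma corner_shift_maximal:
  assumes "u 3 < a 3" "u 3 + u 4 < u 1 + u 2" "a 1 = a 2 \<or> j < a 2"
    and AB: "i * n 1 + j * n 2 < u 1 * n 1 + u 2 * n 2 \<and> k = a 3 - u 3 \<or>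
      i * n 1 + j * n 2 = u 1 * n 1 + u 2 * n 2 \<and> i + j = u 1 + u 2 \<and> Suc k = a 3 - u 3"
    and wt: "wt (mo i j k 0) = wt (mo i' j' k' l')"
  shows "i' + j' + k' + l' \<le> i + j + k"
    "i' + j' + k' + l' = i + j + k \<Longrightarrow> i' * n 1 + j' * n 2 = i * n 1 + j * n 2 \<and> k' = k \<and> l' = 0"
proof -
  obtain z t s where eqs:
    "int i' = int i + z * int (u 1) - t * int (a 1)"
    "int j' = int j + z * int (u 2) + t * int (a 2)"
    "int k' = int k - z * int (u 3) + s * int (a 3)"
    "int l' = int 0 - z * int (u 4) - s * int (a 4)"
    "int (i' * n 1 + j' * n 2) = int (i * n 1 + j * n 2) + z * int (u 1 * n 1 + u 2 * n 2)"
    using lattice[OF wt] by metis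
  define w where "w = u 1 * n 1 + u 2 * n 2"
  have w: "0 < w" "int (i' * n 1 + j' * n 2) = int (i * n 1 + j * n 2) + z * int w"
    using w_pos eqs(5) by (simp_all add: w_def)
  note mc = mult_cases[of z "u 3"] mult_cases[of z "u 4"] mult_cases[of s "a 3"] mult_cases[of s "a 4"]
    mult_cases[of t "a 2"] mult_cases[of z w]
  have k: "k \<le> a 3 - u 3" using AB by auto
  have s0: "0 \<le> z \<Longrightarrow> 0 \<le> s" using eqs(3) mc(1,3) k u3_pos u3_le by linarith
  have "0 \<le> z \<Longrightarrow> \<not> 1 \<le> s" using eqs(4) mc(2,4) a_pos[of 4] by linarith
  with s0 have s: "0 \<le> z \<Longrightarrow> s = 0" by linarith
  have z: "z \<le> 0"
  proof (rule ccontr)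
    assume "\<not> z \<le> 0"
    then have "1 \<le> z" "s = 0" using s by auto
    then show False using eqs(4) mc(2,4) u4_pos by linarith
  qed
  have zero: "i' + j' + k' + l' \<le> i + j + k \<and> i' * n 1 + j' * n 2 = i * n 1 + j * n 2 \<and> k' = k \<and> l' = 0"
    if "z = 0"
  proof -
    have "s = 0" using s that by simp
    with that have eqs': "int i' = int i - t * int (a 1)" "int j' = int j + t * int (a 2)" "k' = k" "l' = 0"
      using eqs by simp_all
    have "t * int (a 2) \<le> t * int (a 1)"
    proof (cases "a 1 = a 2")
      case False
      then have "0 \<le> t" using assms(3) eqs'(2) mc(5) by linarith
      then show ?thesis using a2_le_a1 by (intro mult_left_mono) auto
    qed simp
    then have "i' + j' + k' + l' \<le> i + j + k" using eqs' by linarith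
    moreover have "i' * n 1 + j' * n 2 = i * n 1 + j * n 2"
      using w(2) that by (simp only: mult_zero_left add_0_right of_nat_eq_iff)
    ultimately show ?thesis using eqs' by blast
  qed
  have neg: "i' + j' + k' + l' < i + j + k" if "z \<noteq> 0"
  proof -
    have z1: "z \<le> -1" using that z by linarith
    have le: "i * n 1 + j * n 2 \<le> w" using AB by (auto simp: w_def)
    have "\<not> i * n 1 + j * n 2 < w" using z1 w mc(6) by linarith
    then have B: "i * n 1 + j * n 2 = w" "i + j = u 1 + u 2" "Suc k = a 3 - u 3" using AB by (auto simp: w_def)
    have "(z + 1) * int w = z * int w + int w" by (simp add: distrib_right)
    then have "z = -1" using mult_cases[of "z + 1" w] z1 w B(1) by linarith
    then have "z * int w = - int w" by simp
    then have "i' * n 1 + j' * n 2 = 0" using w(2) B(1) by linarith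
    then have ij: "i' = 0" "j' = 0" using n_pos[of 1] n_pos[of 2] by auto
    have eqs': "int k' = int k + int (u 3) + s * int (a 3)" "int l' = int (u 4) - s * int (a 4)"
      using eqs(3,4) \<open>z = -1\<close> by simp_all
    have "0 \<le> s" using eqs'(1) B(3) mc(3) by linarith
    then have "s * int (a 3) \<le> s * int (a 4)" using a34 by (intro mult_left_mono) auto
    then show ?thesis using eqs' ij B(2) assms(2) by linarith
  qed
  show "i' + j' + k' + l' \<le> i + j + k" using zero neg by linarith
  show "i' + j' + k' + l' = i + j + k \<Longrightarrow> i' * n 1 + j' * n 2 = i * n 1 + j * n 2 \<and> k' = k \<and> l' = 0"
    using zero neg by auto
qed

text \<open>Division of the corner by a variable leaves either nothing, as for x4, or the full class
  of a maximal monomial.\<close>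

lemma crit_set_corner:
  assumes "u 3 < a 3" "u 3 + u 4 < u 1 + u 2"
  shows "crit_set corner"
  unfolding crit_set_def
proof
  fix x :: 4
  let ?S = "{m. Poly_Mapping.single x 1 + m \<in> corner}"
  show "?S \<in> insert {} max_fibs"
  proof (cases "?S = {}")
    case False
    then obtain m1 where m1: "Poly_Mapping.single x 1 + m1 \<in> corner" by blast
    obtain i j k l where m1_eq: "m1 = mo i j k l" by (rule mo_cases)
    have tcond: "a 1 = a 2 \<or> j < a 2"
    proof (cases x rule: exhaust_4')
      case 1
      then show ?thesis using m1 corner_second_exponent[of "Suc i" j k l] u2_less by (auto simp: m1_eq single_eq_mo)
    next
      case 2
      then show ?thesis using m1 corner_second_exponent[of i "Suc j" k l] u2_less by (auto simp: m1_eq single_eq_mo)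
    next
      case 3
      then show ?thesis using m1 corner_second_exponent[of i j "Suc k" l] u2_less by (auto simp: m1_eq single_eq_mo)
    next
      case 4
      then show ?thesis using m1 by (simp add: m1_eq single_eq_mo)
    qed
    have AB: "i * n 1 + j * n 2 < u 1 * n 1 + u 2 * n 2 \<and> k = a 3 - u 3 \<or>
      i * n 1 + j * n 2 = u 1 * n 1 + u 2 * n 2 \<and> i + j = u 1 + u 2 \<and> Suc k = a 3 - u 3" and l: "l = 0"
    proof -
      have "(i * n 1 + j * n 2 < u 1 * n 1 + u 2 * n 2 \<and> k = a 3 - u 3 \<or>
        i * n 1 + j * n 2 = u 1 * n 1 + u 2 * n 2 \<and> i + j = u 1 + u 2 \<and> Suc k = a 3 - u 3) \<and> l = 0"
      proof (cases x rule: exhaust_4')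
        case 1
        then show ?thesis using m1 n_pos[of 1] by (simp add: m1_eq single_eq_mo)
      next
        case 2
        then show ?thesis using m1 n_pos[of 2] by (simp add: m1_eq single_eq_mo)
      next
        case 3
        then show ?thesis using m1 by (simp add: m1_eq single_eq_mo)
      next
        case 4
        then show ?thesis using m1 by (simp add: m1_eq single_eq_mo)
      qed
      then show "i * n 1 + j * n 2 < u 1 * n 1 + u 2 * n 2 \<and> k = a 3 - u 3 \<or>
        i * n 1 + j * n 2 = u 1 * n 1 + u 2 * n 2 \<and> i + j = u 1 + u 2 \<and> Suc k = a 3 - u 3" "l = 0" by auto
    qed
    note K = corner_shift_maximal[OF assms tcond AB]
    have "maximal m1"
      unfolding maximal_def
    proof (intro allI impI)
      fix m' assume "wt m' = wt m1"
      moreover obtain i' j' k' l' where "m' = mo i' j' k' l'" by (rule mo_cases)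
      ultimately show "mon_degree m' \<le> mon_degree m1" using K(1)[of i' j' k' l'] by (simp add: m1_eq l)
    qed
    moreover have "?S = fib m1"
    proof (rule Set.set_eqI)
      fix m
      obtain i' j' k' l' where m: "m = mo i' j' k' l'" by (rule mo_cases)
      have fib: "m \<in> fib m1 \<longleftrightarrow> i' * n 1 + j' * n 2 = i * n 1 + j * n 2 \<and> i' + j' = i + j \<and> k' = k \<and> l' = 0"
      proof
        assume *: "m \<in> fib m1"
        then have "i' * n 1 + j' * n 2 = i * n 1 + j * n 2 \<and> k' = k \<and> l' = 0"
          by (intro K(2)) (simp_all add: fib_def m m1_eq l)
        with * show "i' * n 1 + j' * n 2 = i * n 1 + j * n 2 \<and> i' + j' = i + j \<and> k' = k \<and> l' = 0"
          by (simp add: fib_def m m1_eq l)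
      qed (simp add: fib_def m m1_eq l)
      show "m \<in> ?S \<longleftrightarrow> m \<in> fib m1"
      proof (cases x rule: exhaust_4')
        case 1
        then show ?thesis using m1 unfolding fib by (auto simp: m m1_eq single_eq_mo)
      next
        case 2
        then show ?thesis using m1 unfolding fib by (auto simp: m m1_eq single_eq_mo)
      next
        case 3
        then show ?thesis using m1 unfolding fib by (auto simp: m m1_eq single_eq_mo)
      next
        case 4
        then show ?thesis using m1 by (simp add: m1_eq single_eq_mo)
      qed
    qed
    ultimately show ?thesis by (auto simp: max_fibs_def)
  qed simp
qed

text \<open>To the pure powers are added the corner and a minimal bad divisor of x3^(u 3) x4^(u 4).
  The divisor involves both variables since smaller pure powers are not bad. The corner is unrelated
  to the rest because it has no maximal elements.\<close>

lemma five_le_min_num_gens_corner: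
  assumes "\<not> tame" "u 3 < a 3" "u 3 + u 4 < u 1 + u 2"
  shows "5 \<le> min_num_gens poly4_ring (tangent_ideal :: 'k::field poly4 set)"
proof -
  have "bad (mo 0 0 (u 3) (u 4))" using assms(3) by (intro bad_lattice_34) simp
  then obtain i j k l where N: "minimal_bad (mo i j k l)" "i \<le> 0" "j \<le> 0" "k \<le> u 3" "l \<le> u 4"
    by (rule minimal_bad_divisor)
  have ij: "i = 0" "j = 0" using N by auto
  have k: "k < a 3" and l: "l < c4" using N assms(2) c4_greater[OF assms(1)] by auto
  have "bad (mo i j k l)" using N(1) by (simp add: minimal_bad_def)
  from bad_not_pure[OF this _ k l] a_pos[of 2] have kl: "0 < k" "0 < l" by (auto simp: ij)
  let ?Ts = "[corner, {mo 0 0 (a 3) 0}, {mo 0 (a 2) 0 0}, {mo 0 0 0 c4}, {mo 0 0 k l}]"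
  have "enat (length ?Ts) \<le> min_num_gens poly4_ring (tangent_ideal :: 'k poly4 set)"
  proof (rule min_num_gens_ge_admissible)
    have "mo (u 1) (u 2) (a 3 - u 3) 0 \<in> corner" by simp
    then have "admissible corner"
      using crit_set_corner[OF assms(2,3)] corner_not_maximal[OF assms(1)] unfolding admissible_def by blast
    then show "admissible T" if "T \<in> set ?Ts" for T
      using that minimal_bad_admissible[OF minimal_bad_2] minimal_bad_admissible[OF minimal_bad_3]
        minimal_bad_admissible[OF minimal_bad_4] minimal_bad_admissible[OF N(1)] by (auto simp: ij)
    have uc: "unrelated corner T" if "\<And>m. m \<in> T \<Longrightarrow> m \<notin> corner" for T
      using that corner_not_maximal[OF assms(1)] by (intro unrelated_if_not_maximal) auto
    have "unrelated {mo 0 (a 2) 0 0} {mo 0 0 0 c4}" "unrelated {mo 0 (a 2) 0 0} {mo 0 0 k l}"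
      using two_le_c4 a_pos[of 2] kl by (auto intro!: unrelated_2)
    moreover have "unrelated {mo 0 0 0 c4} {mo 0 0 k l}"
      by (rule unrelated_share[of _ _ 4]) (use minimal_bad_4 N(1) ij kl two_le_c4 in auto)
    ultimately show "sorted_wrt unrelated ?Ts"
      using a_pos[of 3] u1_pos k assms(2) by (auto intro!: unrelated_3 uc)
  qed
  then show ?thesis by (simp add: numeral_eq_enat eval_nat_numeral)
qed

text \<open>Two mixed minimal bad monomials join the pure powers. As x2^(a 2) and x3^(a 3) are not
  maximal here, only x4^c4 and the two new monomials can interfere with each other.\<close>

lemma five_le_min_num_gens_pair:
  assumes ne: "a 1 \<noteq> a 2" and N: "minimal_bad m" "minimal_bad m'"
    and pure: "m \<notin> {mo 0 0 (a 3) 0, mo 0 (a 2) 0 0, mo 0 0 0 c4}" "m' \<notin> {mo 0 0 (a 3) 0, mo 0 (a 2) 0 0, mo 0 0 0 c4}"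
    and unrel: "unrelated {mo 0 0 0 c4} {m}" "unrelated {mo 0 0 0 c4} {m'}" "unrelated {m} {m'}"
  shows "5 \<le> min_num_gens poly4_ring (tangent_ideal :: 'k::field poly4 set)"
proof -
  let ?Ts = "[{mo 0 0 (a 3) 0}, {mo 0 (a 2) 0 0}, {mo 0 0 0 c4}, {m}, {m'}]"
  have "enat (length ?Ts) \<le> min_num_gens poly4_ring (tangent_ideal :: 'k poly4 set)"
  proof (rule min_num_gens_ge_admissible)
    show "admissible T" if "T \<in> set ?Ts" for T
      using that minimal_bad_admissible[OF minimal_bad_2] minimal_bad_admissible[OF minimal_bad_3]
        minimal_bad_admissible[OF minimal_bad_4] minimal_bad_admissible[OF N(1)]
        minimal_bad_admissible[OF N(2)] by auto
    have "\<not> maximal (mo 0 (a 2) 0 0)" using maximal_2D ne by blast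
    then have "unrelated {mo 0 (a 2) 0 0} T" if "mo 0 (a 2) 0 0 \<notin> T" for T
      using that by (intro unrelated_if_not_maximal) auto
    then show "sorted_wrt unrelated ?Ts"
      using a_pos[of 2] a_pos[of 3] pure unrel by (auto intro!: unrelated_3)
  qed
  then show ?thesis by (simp add: numeral_eq_enat eval_nat_numeral)
qed

lemma unrelated_degree: "mon_degree m \<noteq> mon_degree m' \<Longrightarrow> unrelated {m} {m'}"
  by (auto simp: unrelated_def)

text \<open>A power of x1 is not bad, so every other monomial of its weight has smaller degree and
  is bad.\<close>

lemma degree_less_pure_1:
  assumes "a 1 \<noteq> a 2" "wt (mo i 0 0 0) = wt (mo 0 j k l)" "0 < j + k + l"
  shows "bad (mo 0 j k l)"
proof -
  have "0 < wt (mo 0 j k l)" using assms(3) n_pos[of 2] n_pos[of 3] n_pos[of 4] by auto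
  then have "wt (mo i 0 0 0) \<noteq> 0" unfolding assms(2) by linarith
  then have "i \<noteq> 0" by (intro notI) simp
  have "\<not> bad (mo i 0 0 0)" by (rule not_bad_1[OF assms(1)])
  then have "\<not> mon_degree (mo i 0 0 0) \<le> mon_degree (mo 0 j k l)"
    using assms(2) \<open>i \<noteq> 0\<close> unfolding bad_def by (metis mo_eq_iff)
  then show ?thesis
    unfolding bad_def using assms(2) \<open>i \<noteq> 0\<close> by (intro exI[of _ "mo i 0 0 0"]) auto
qed

text \<open>Now x1^(u 1) x2^(u 2) has smaller degree than another monomial of its weight, so it has
  a mixed minimal bad divisor in x1, x2. The second new monomial comes from eliminating x2 between
  this relation and the first binomial.\<close>

lemma five_le_min_num_gens_wild:
  assumes "\<not> tame" and ne: "a 1 \<noteq> a 2" and wild: "u 3 = a 3 \<or> u 1 + u 2 < u 3 + u 4"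
  shows "5 \<le> min_num_gens poly4_ring (tangent_ideal :: 'k::field poly4 set)"
proof -
  note c4 = c4_greater[OF assms(1)]
  have less: "u 1 + u 2 < a 4 + u 4" using assms(1) wild u3_le a34 unfolding tame_def by auto
  have "bad (mo (u 1) (u 2) 0 0)"
  proof (rule disjE[OF wild])
    assume "u 3 = a 3"
    then have "wt (mo 0 0 0 (a 4 + u 4)) = wt (mo (u 1) (u 2) 0 0)" using wt_a4_u4 by simp
    then show ?thesis unfolding bad_def using less u1_pos by (intro exI[of _ "mo 0 0 0 (a 4 + u 4)"]) auto
  next
    assume "u 1 + u 2 < u 3 + u 4"
    then show ?thesis unfolding bad_def using rel1234 u1_pos by (intro exI[of _ "mo 0 0 (u 3) (u 4)"]) auto
  qed
  then obtain i j k l where N: "minimal_bad (mo i j k l)" "i \<le> u 1" "j \<le> u 2" "k \<le> 0" "l \<le> 0"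
    by (rule minimal_bad_divisor)
  have kl: "k = 0" "l = 0" using N by auto
  have badN: "bad (mo i j 0 0)" using N(1) kl by (simp add: minimal_bad_def)
  have ij: "0 < i" "0 < j"
  proof -
    have "j < a 2" "0 < a 3" "0 < c4" using N(3) u2_less a_pos[of 3] two_le_c4 by auto
    from bad_not_pure(1)[OF badN this] show "0 < i" by simp
    show "0 < j" using badN not_bad_1[OF ne, of i] by (cases j) auto
  qed
  have u2: "0 < u 2" using ij N(3) by simp
  \<comment> \<open>The exponents of that competing monomial: x4^(a 4 + u 4) if
    \<open>u 3 = a 3\<close>, and x3^(u 3) x4^(u 4) otherwise.\<close>
  define k5 l5 where "k5 = (if u 3 = a 3 then 0 else u 3)" and "l5 = (if u 3 = a 3 then a 4 + u 4 else u 4)"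
  have wt5: "k5 * n 3 + l5 * n 4 = u 1 * n 1 + u 2 * n 2"
    using wt_a4_u4 rel1234 by (simp add: k5_def l5_def)
  have bounds5: "k5 < a 3" "l5 < c4" using u3_le a_pos[of 3] c4 by (auto simp: k5_def l5_def)
  \<comment> \<open>Multiplying by x2^(a 2 - u 2) completes x2^(u 2) to x2^(a 2), which is exchanged
    for x1^(a 1); the other side becomes a pure power of x1.\<close>
  have "bad (mo 0 (a 2 - u 2) k5 l5)"
  proof (rule degree_less_pure_1[OF ne])
    have "(a 2 - u 2) * n 2 + u 2 * n 2 = a 2 * n 2" using u2_less by (simp flip: distrib_right)
    then show "wt (mo (u 1 + a 1) 0 0 0) = wt (mo 0 (a 2 - u 2) k5 l5)"
      using wt5 rel12 by (simp add: distrib_right)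
    show "0 < a 2 - u 2 + k5 + l5" using u2_less by simp
  qed
  then obtain i' j' k' l' where M: "minimal_bad (mo i' j' k' l')" "i' \<le> 0" "j' \<le> a 2 - u 2" "k' \<le> k5" "l' \<le> l5"
    by (rule minimal_bad_divisor)
  have i': "i' = 0" and j': "j' < a 2" and k': "k' < a 3" and l': "l' < c4" using M u2 u2_less bounds5 by auto
  have badM: "bad (mo 0 j' k' l')" using M(1) i' by (simp add: minimal_bad_def)
  note mixed = bad_not_pure[OF badM j' k' l']
  \<comment> \<open>Otherwise x4 would be at least as heavy as x1 and x2 and lighter than x3, so the
    monomial x1^(u 1) x2^(u 2) of smaller degree would also have smaller weight.\<close>
  have "n 4 < n 2"
  proof (rule ccontr)
    assume "\<not> n 4 < n 2"
    then have n2: "n 2 \<le> n 4" by simp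
    have "u 1 * n 1 + u 2 * n 2 \<le> u 1 * n 4 + u 2 * n 4" using n1_min[of 4] n2 by (intro add_mono mult_le_mono) auto
    also have "\<dots> = (u 1 + u 2) * n 4" by (simp add: distrib_right)
    also have "\<dots> < (k5 + l5) * n 4" using wild less n_pos[of 4] by (auto simp: k5_def l5_def)
    also have "\<dots> \<le> k5 * n 3 + l5 * n 4" using n4_less_n3 by (simp add: distrib_right)
    finally show False using wt5 by simp
  qed
  show ?thesis
  proof (rule five_le_min_num_gens_pair[OF ne])
    show "minimal_bad (mo i j 0 0)" using N(1) kl by simp
    show "minimal_bad (mo 0 j' k' l')" using M(1) i' by simp
    show "mo i j 0 0 \<notin> {mo 0 0 (a 3) 0, mo 0 (a 2) 0 0, mo 0 0 0 c4}" using ij by simp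
    show "mo 0 j' k' l' \<notin> {mo 0 0 (a 3) 0, mo 0 (a 2) 0 0, mo 0 0 0 c4}" using j' k' l' by simp
    show "unrelated {mo 0 0 0 c4} {mo i j 0 0}"
      using N(2,3) less c4 by (intro unrelated_degree) simp
    show "unrelated {mo 0 0 0 c4} {mo 0 j' k' l'}"
    proof (cases "l' = 0")
      case False
      then show ?thesis using minimal_bad_4 M(1) i' l' two_le_c4 by (intro unrelated_share[of _ _ 4]) auto
    next
      case True
      have "\<not> (c4 * n 4 = j' * n 2 + k' * n 3 \<and> c4 = j' + k')"
      proof
        assume *: "c4 * n 4 = j' * n 2 + k' * n 3 \<and> c4 = j' + k'"
        then have "j' * n 4 + k' * n 4 = j' * n 2 + k' * n 3" by (metis distrib_right)
        moreover have "0 < j'" using mixed True by auto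
        then have "j' * n 4 < j' * n 2" using \<open>n 4 < n 2\<close> by simp
        moreover have "k' * n 4 \<le> k' * n 3" using n4_less_n3 by simp
        ultimately show False by linarith
      qed
      then show ?thesis using True l' by (auto simp: unrelated_def)
    qed
    show "unrelated {mo i j 0 0} {mo 0 j' k' l'}"
    proof (cases "j' = 0")
      case False
      then show ?thesis using N(1) kl M(1) i' ij by (intro unrelated_share[of _ _ 2]) auto
    next
      case True
      then have "0 < k'" "0 < l'" using mixed by auto
      then have k5: "u 3 \<noteq> a 3" "k' \<le> u 3" "l' \<le> u 4" "u 1 + u 2 < u 3 + u 4"
        using M(4,5) wild by (auto simp: k5_def l5_def split: if_splits)
      \<comment> \<open>A coincidence of weights forces both divisors to be the full terms of the
        third binomial, and their degrees differ.\<close>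
      have "\<not> (wt (mo 0 0 k' l') = wt (mo i j 0 0) \<and> i + j = k' + l')"
      proof
        assume *: "wt (mo 0 0 k' l') = wt (mo i j 0 0) \<and> i + j = k' + l'"
        define w where "w = u 1 * n 1 + u 2 * n 2"
        obtain z where z: "int (i * n 1 + j * n 2) = int (0 * n 1 + 0 * n 2) + z * int w"
          unfolding w_def using lattice[of 0 0 k' l' i j 0 0] * by metis
        have "0 < i * n 1 + j * n 2" using ij n_pos[of 1] by simp
        then have "w \<le> i * n 1 + j * n 2" using z mult_cases[of z w] by linarith
        moreover have le: "i * n 1 \<le> u 1 * n 1" "j * n 2 \<le> u 2 * n 2" using N(2,3) by simp_all
        ultimately have "i * n 1 = u 1 * n 1" "j * n 2 = u 2 * n 2" unfolding w_def by linarith+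
        then have "i = u 1" "j = u 2" using n_pos[of 1] n_pos[of 2] by simp_all
        moreover have "k' * n 3 \<le> u 3 * n 3" "l' * n 4 \<le> u 4 * n 4" using k5 by simp_all
        moreover have "k' * n 3 + l' * n 4 = u 3 * n 3 + u 4 * n 4" using * rel1234 \<open>i = u 1\<close> \<open>j = u 2\<close> by simp
        ultimately have "k' * n 3 = u 3 * n 3" "l' * n 4 = u 4 * n 4" by linarith+
        then have "k' = u 3" "l' = u 4" using n_pos[of 3] n_pos[of 4] by simp_all
        then show False using * k5(4) \<open>i = u 1\<close> \<open>j = u 2\<close> by simp
      qed
      then show ?thesis using True ij by (auto simp: unrelated_def)
    qed
  qed
qed

text \<open>One mixed monomial divides x3^(u 3) x4^(u 4). The other divides whichever of two further
  monomials of equal weight does not exceed the other in degree.\<close>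

lemma five_le_min_num_gens_homogeneous:
  assumes "\<not> tame" and ne: "a 1 \<noteq> a 2" and u3: "u 3 < a 3" and hom: "u 1 + u 2 = u 3 + u 4"
  shows "5 \<le> min_num_gens poly4_ring (tangent_ideal :: 'k::field poly4 set)"
proof -
  note c4 = c4_greater[OF assms(1)]
  have "bad (mo 0 0 (u 3) (u 4))" using hom by (intro bad_lattice_34) simp
  then obtain i j k l where N: "minimal_bad (mo i j k l)" "i \<le> 0" "j \<le> 0" "k \<le> u 3" "l \<le> u 4"
    by (rule minimal_bad_divisor)
  have ij: "i = 0" "j = 0" using N by auto
  have k: "k < a 3" and l: "l < c4" using N u3 c4 by auto
  have badN: "bad (mo 0 0 k l)" using N(1) ij by (simp add: minimal_bad_def)
  have kl: "0 < k" "0 < l" using bad_not_pure[OF badN _ k l] a_pos[of 2] by auto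
  have u2: "0 < u 2"
  proof (rule ccontr)
    assume "\<not> 0 < u 2"
    then have "bad (mo (u 1) 0 0 0)"
      unfolding bad_def using rel1234 hom u1_pos by (intro exI[of _ "mo 0 0 (u 3) (u 4)"]) auto
    then show False using not_bad_1[OF ne] by blast
  qed
  \<comment> \<open>The relation between x4^(a 4 + u 4) and x1^(u 1) x2^(u 2) x3^(a 3 - u 3),
    multiplied by x2^(a 2 - u 2), with x2^(a 2) exchanged for x1^(a 1).\<close>
  let ?P = "mo 0 (a 2 - u 2) 0 (a 4 + u 4)" and ?Q = "mo (u 1 + a 1) 0 (a 3 - u 3) 0"
  have "(a 2 - u 2) * n 2 + u 2 * n 2 = a 2 * n 2" using u2_less by (simp flip: distrib_right)
  then have wt: "wt ?P = wt ?Q" using wt_a4_u4 rel12 by (simp add: distrib_right)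
  show ?thesis
  proof (cases "mon_degree ?P \<le> mon_degree ?Q")
    case True
    then have "bad ?P" unfolding bad_def using wt u1_pos by (intro exI[of _ ?Q]) auto
    then obtain i' j' k' l' where M: "minimal_bad (mo i' j' k' l')" "i' \<le> 0" "j' \<le> a 2 - u 2" "k' \<le> 0" "l' \<le> a 4 + u 4"
      by (rule minimal_bad_divisor)
    have ik: "i' = 0" "k' = 0" and j': "j' < a 2" and l': "l' < c4" using M u2 u2_less c4 by auto
    have badM: "bad (mo 0 j' 0 l')" using M(1) ik by (simp add: minimal_bad_def)
    have jl: "0 < j'" "0 < l'" using bad_not_pure[OF badM j' _ l'] a_pos[of 3] by auto
    show ?thesis
    proof (rule five_le_min_num_gens_pair[OF ne])
      show "minimal_bad (mo 0 0 k l)" using N(1) ij by simp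
      show "minimal_bad (mo 0 j' 0 l')" using M(1) ik by simp
      show "unrelated {mo 0 0 0 c4} {mo 0 0 k l}"
        by (rule unrelated_share[of _ _ 4]) (use minimal_bad_4 N(1) ij kl two_le_c4 in auto)
      show "unrelated {mo 0 0 0 c4} {mo 0 j' 0 l'}"
        by (rule unrelated_share[of _ _ 4]) (use minimal_bad_4 M(1) ik jl two_le_c4 in auto)
      show "unrelated {mo 0 0 k l} {mo 0 j' 0 l'}"
        by (rule unrelated_share[of _ _ 4]) (use M(1) ik jl N(1) ij kl in auto)
    qed (use kl jl in auto)
  next
    case False
    then have "bad ?Q" unfolding bad_def using wt u1_pos by (intro exI[of _ ?P]) auto
    then obtain i' j' k' l' where M: "minimal_bad (mo i' j' k' l')" "i' \<le> u 1 + a 1" "j' \<le> 0" "k' \<le> a 3 - u 3" "l' \<le> 0"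
      by (rule minimal_bad_divisor)
    have jl: "j' = 0" "l' = 0" and k': "k' < a 3" using M u3_pos u3_le by auto
    have badM: "bad (mo i' 0 k' 0)" using M(1) jl by (simp add: minimal_bad_def)
    have ik: "0 < i'" "0 < k'"
    proof -
      have "0 < a 2" "0 < c4" using a_pos[of 2] two_le_c4 by auto
      from bad_not_pure(2)[OF badM this(1) k' this(2)] show "0 < i'" by simp
      show "0 < k'" using badM not_bad_1[OF ne, of i'] by (cases k') auto
    qed
    show ?thesis
    proof (rule five_le_min_num_gens_pair[OF ne])
      show "minimal_bad (mo 0 0 k l)" using N(1) ij by simp
      show "minimal_bad (mo i' 0 k' 0)" using M(1) jl by simp
      show "unrelated {mo 0 0 0 c4} {mo 0 0 k l}"
        by (rule unrelated_share[of _ _ 4]) (use minimal_bad_4 N(1) ij kl two_le_c4 in auto)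
      show "unrelated {mo 0 0 k l} {mo i' 0 k' 0}"
        by (rule unrelated_share[of _ _ 3]) (use M(1) jl ik N(1) ij kl in auto)
      \<comment> \<open>Since x2 is absent from both monomials, \<open>z\<close> and
        \<open>t\<close> have opposite signs. The bound on \<open>i'\<close> leaves only z = 1, and
        then \<open>u 2\<close> would be a positive multiple of \<open>a 2\<close>.\<close>
      have "wt (mo 0 0 0 c4) \<noteq> wt (mo i' 0 k' 0)"
      proof
        assume "wt (mo 0 0 0 c4) = wt (mo i' 0 k' 0)"
        then obtain z t where eqs:
          "int i' = int 0 + z * int (u 1) - t * int (a 1)" "int 0 = int 0 + z * int (u 2) + t * int (a 2)"
          using lattice by metis
        note mc = mult_cases[of z "u 1"] mult_cases[of z "u 2"] mult_cases[of t "a 1"] mult_cases[of t "a 2"]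
        have "1 \<le> z" "t \<le> -1" using eqs mc ik(1) u2 u1_pos a_pos[of 1] a_pos[of 2] by linarith+
        moreover have "(z - 1) * int (u 1) = z * int (u 1) - int (u 1)" "(t + 1) * int (a 1) = t * int (a 1) + int (a 1)"
          by (simp_all add: algebra_simps)
        ultimately have "z = 1"
          using mult_cases[of "z - 1" "u 1"] mult_cases[of "t + 1" "a 1"] eqs(1) M(2) u1_pos by linarith
        then have "int (u 2) = - (t * int (a 2))" using eqs(2) by simp
        then show False using mc(4) \<open>t \<le> -1\<close> u2_less by linarith
      qed
      then show "unrelated {mo 0 0 0 c4} {mo i' 0 k' 0}" using ik by (auto simp: unrelated_def)
    qed (use kl ik in auto)
  qed
qed

text \<open>If \<open>a 1 = a 2\<close>, the equalities \<open>n 1 = n 2\<close> and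
  \<open>u 2 = 0\<close> imply both conditions of the corner case. Otherwise the degrees of the two
  terms of the third binomial decide.\<close>

lemma not_tame_min_num_gens:
  assumes "\<not> tame"
  shows "5 \<le> min_num_gens poly4_ring (tangent_ideal :: 'k::field poly4 set)"
proof (cases "a 1 = a 2")
  case True
  have u2: "u 2 = 0" by (rule a1_eq_a2D[OF True])
  have le: "x * n 1 \<le> x * n 4" for x using n1_min[of 4] by simp
  have "u 3 < a 3"
  proof (rule ccontr)
    assume "\<not> u 3 < a 3"
    then have "u 3 = a 3" using u3_le by simp
    then have "u 1 * n 1 = (a 4 + u 4) * n 4" using wt_a4_u4 u2 by simp
    then have "(a 4 + u 4) * n 1 \<le> u 1 * n 1" using le by simp
    then have "a 4 + u 4 \<le> u 1" using n_pos[of 1] by simp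
    then show False using assms \<open>u 3 = a 3\<close> by (simp add: tame_def)
  qed
  moreover have "u 3 + u 4 < u 1 + u 2"
  proof -
    have "(u 3 + u 4) * n 1 \<le> u 3 * n 4 + u 4 * n 4" using le[of "u 3 + u 4"] by (simp add: distrib_right)
    also have "\<dots> < u 3 * n 3 + u 4 * n 4" using u3_pos n4_less_n3 by simp
    also have "\<dots> = u 1 * n 1" using rel1234 u2 by simp
    finally show ?thesis by simp
  qed
  ultimately show ?thesis by (rule five_le_min_num_gens_corner[OF assms])
next
  case False
  consider "u 3 = a 3 \<or> u 1 + u 2 < u 3 + u 4" | "u 3 < a 3" "u 1 + u 2 = u 3 + u 4"
    | "u 3 < a 3" "u 3 + u 4 < u 1 + u 2"
    using u3_le by linarith
  then show ?thesis
  proof cases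
    case 1
    then show ?thesis by (rule five_le_min_num_gens_wild[OF assms False])
  next
    case 2
    then show ?thesis by (rule five_le_min_num_gens_homogeneous[OF assms False])
  next
    case 3
    then show ?thesis by (rule five_le_min_num_gens_corner[OF assms])
  qed
qed

lemma tame_iff_min_num_gens:
  "tame \<longleftrightarrow> min_num_gens poly4_ring (tangent_ideal :: 'k::field poly4 set) = 3 \<or>
    min_num_gens poly4_ring (tangent_ideal :: 'k poly4 set) = 4"
proof
  assume "tame"
  then show "min_num_gens poly4_ring (tangent_ideal :: 'k poly4 set) = 3 \<or>
    min_num_gens poly4_ring (tangent_ideal :: 'k poly4 set) = 4"
    using tame_min_num_gens[where 'k = 'k] three_le_min_num_gens[where 'k = 'k]
    by (cases "min_num_gens poly4_ring (tangent_ideal :: 'k poly4 set)") (auto simp: numeral_eq_enat)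
next
  assume "min_num_gens poly4_ring (tangent_ideal :: 'k poly4 set) = 3 \<or>
    min_num_gens poly4_ring (tangent_ideal :: 'k poly4 set) = 4"
  then have "\<not> 5 \<le> min_num_gens poly4_ring (tangent_ideal :: 'k poly4 set)"
    by (auto simp: numeral_eq_enat)
  then show tame using not_tame_min_num_gens by blast
qed

end

section \<open>The relations of the curve\<close>

context monomial_curve
begin

lemma pmon_diff_toricD:
  assumes "(pmon m - pmon m' :: 'k::field poly4) \<in> toric_ideal n"
  shows "wt m = wt m'"
proof -
  have "coeff_sum {x. wt x = wt m} (pmon m - pmon m' :: 'k poly4) = 0"
    using assms by (auto simp: toric_ideal_eq coeff_null_def)
  then show ?thesis by (auto simp: coeff_sum_diff split: if_splits)
qed

text \<open>The trivial relation with the weight of any other variable shows that the minimum in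
  \<open>crit_exponent\<close> is attained.\<close>

lemma crit_exponent_exists: "\<exists>a>0. \<exists>c. a * n x = (\<Sum>j\<in>UNIV - {x}. c j * n j)"
proof -
  obtain y :: 4 where y: "y \<noteq> x" by (metis one_neq_zero)
  have "(\<Sum>j\<in>UNIV - {x}. (if j = y then n x else 0) * n j) = (\<Sum>j\<in>UNIV - {x}. if j = y then n x * n y else 0)"
    by (intro sum.cong) auto
  also have "\<dots> = n x * n y" using y by simp
  finally have "n y * n x = (\<Sum>j\<in>UNIV - {x}. (if j = y then n x else 0) * n j)" by (simp add: mult.commute)
  then show ?thesis using n_pos[of y]
    by (intro exI[of _ "n y"] conjI exI[of _ "\<lambda>j. if j = y then n x else 0"])
qed

lemma crit_exponent_pos: "0 < crit_exponent n x"
  using LeastI_ex[OF crit_exponent_exists[of x]] by (simp add: crit_exponent_def)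

text \<open>Cancelling the power of the variable \<open>x\<close> leaves either a relation below the
  critical exponent or no other variable at all.\<close>

lemma crit_exponent_unique:
  assumes "c < crit_exponent n x" "wt m = c * n x"
  shows "m = Poly_Mapping.single x c"
proof -
  define e where "e = Poly_Mapping.lookup m x"
  have wt: "wt m = e * n x + (\<Sum>j\<in>UNIV - {x}. Poly_Mapping.lookup m j * n j)"
    unfolding wt_def e_def by (subst sum.remove[of _ x]) auto
  show ?thesis
  proof (cases "e < c")
    case True
    then obtain d where d: "c = e + d" "0 < d" by (metis less_imp_add_positive)
    then have "d * n x = (\<Sum>j\<in>UNIV - {x}. Poly_Mapping.lookup m j * n j)"
      using wt assms(2) by (simp add: distrib_right)
    moreover have "d < crit_exponent n x" using assms(1) d by simp
    ultimately show ?thesis using d(2) not_less_Least[of d] unfolding crit_exponent_def by blast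
  next
    case False
    then have "c * n x \<le> e * n x" by simp
    then have "e * n x = c * n x" and rest: "(\<Sum>j\<in>UNIV - {x}. Poly_Mapping.lookup m j * n j) = 0"
      using wt assms(2) by linarith+
    then have e: "e = c" using n_pos[of x] by simp
    have "Poly_Mapping.lookup m j = 0" if "j \<noteq> x" for j
      using rest that n_pos[of j] by (force simp: sum_eq_0_iff)
    then show ?thesis
      using e by (intro poly_mapping_eqI) (auto simp: lookup_single when_def e_def)
  qed
qed

text \<open>The weight of the part in the first two variables is invariant modulo the weight of the third
  binomial under each of the three generators.\<close>

lemma weight12_cong_if_generated:
  assumes gen: "toric_ideal n = genideal poly4_ring
      {pmon (mo a1 0 0 0) - pmon (mo 0 a2 0 0), pmon (mo 0 0 a3 0) - pmon (mo 0 0 0 a4),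
       pmon (mo u1 u2 0 0) - pmon (mo 0 0 u3 u4) :: 'k::field poly4}"
    and wt: "wt (mo i j k l) = wt (mo i' j' k' l')"
  shows "\<exists>z::int. int (i' * n 1 + j' * n 2) = int (i * n 1 + j * n 2) + z * int (u1 * n 1 + u2 * n 2)"
proof -
  define w where "w = int (u1 * n 1 + u2 * n 2)"
  define v where "v m = int (Poly_Mapping.lookup m 1 * n 1 + Poly_Mapping.lookup m 2 * n 2)" for m :: "4 \<Rightarrow>\<^sub>0 nat"
  have v_add: "v (x + y) = v x + v y" for x y by (simp add: v_def lookup_add algebra_simps)
  have v_mo: "v (mo i j k l) = int (i * n 1 + j * n 2)" for i j k l by (simp add: v_def)
  \<comment> \<open>Weight classes, split further by the residue of \<open>v\<close> modulo
    \<open>w\<close>. These finer classes still define an ideal, and it contains the three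
    generators.\<close>
  define T where "T m = {x. wt x = wt m \<and> w dvd v x - v m}" for m
  have T_eq: "T x = T y" if "wt x = wt y" "w dvd v x - v y" for x y
  proof -
    have "w dvd v z - v x \<longleftrightarrow> w dvd v z - v y" for z
    proof -
      have "v z - v y = (v z - v x) + (v x - v y)" by simp
      then show ?thesis using that(2) by (metis dvd_add_left_iff)
    qed
    then show ?thesis using that(1) by (simp add: T_def)
  qed
  define N where "N = (coeff_null (range T) :: 'k poly4 set)"
  have ideal: "tc_ideal N"
    unfolding N_def
  proof (rule tc_ideal_coeff_null)
    fix S x assume "S \<in> range T"
    then obtain m where S: "S = T m" by blast
    show "{y. x + y \<in> S} = {} \<or> {y. x + y \<in> S} \<in> range T"
    proof (cases "{y. x + y \<in> S} = {}")
      case False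
      then obtain y0 where "x + y0 \<in> T m" using S by blast
      then have "S = T (x + y0)" unfolding S by (intro T_eq[symmetric]) (auto simp: T_def)
      then have "{y. x + y \<in> S} = T y0" by (auto simp: T_def v_add)
      then show ?thesis by blast
    qed blast
  qed
  have mem: "pmon x - pmon y \<in> N" if "wt x = wt y" "w dvd v x - v y" for x y
  proof -
    have "x \<in> T m \<longleftrightarrow> y \<in> T m" for m
    proof -
      have "v x - v m = (v x - v y) + (v y - v m)" by simp
      then have "w dvd v x - v m \<longleftrightarrow> w dvd v y - v m" using that(2) by (metis dvd_add_right_iff)
      then show ?thesis using that(1) by (simp add: T_def)
    qed
    then show ?thesis by (auto simp: N_def coeff_null_def coeff_sum_diff)
  qed
  have gens: "{pmon (mo a1 0 0 0) - pmon (mo 0 a2 0 0), pmon (mo 0 0 a3 0) - pmon (mo 0 0 0 a4),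
       pmon (mo u1 u2 0 0) - pmon (mo 0 0 u3 u4) :: 'k poly4} \<subseteq> toric_ideal n"
    unfolding gen by (rule genideal_roa_superset)
  then have wts: "wt (mo a1 0 0 0) = wt (mo 0 a2 0 0)" "wt (mo 0 0 a3 0) = wt (mo 0 0 0 a4)"
    "wt (mo u1 u2 0 0) = wt (mo 0 0 u3 u4)"
    using pmon_diff_toricD by blast+
  have "toric_ideal n \<subseteq> N"
    unfolding gen
  proof (rule genideal_roa_least[OF ideal])
    have "pmon (mo a1 0 0 0) - pmon (mo 0 a2 0 0) \<in> N"
      using wts(1) by (intro mem) (simp_all add: v_mo)
    moreover have "pmon (mo 0 0 a3 0) - pmon (mo 0 0 0 a4) \<in> N"
      using wts(2) by (intro mem) (simp_all add: v_mo)
    moreover have "pmon (mo u1 u2 0 0) - pmon (mo 0 0 u3 u4) \<in> N"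
      using wts(3) by (intro mem) (simp_all add: v_mo w_def)
    ultimately show "{pmon (mo a1 0 0 0) - pmon (mo 0 a2 0 0), pmon (mo 0 0 a3 0) - pmon (mo 0 0 0 a4),
       pmon (mo u1 u2 0 0) - pmon (mo 0 0 u3 u4) :: 'k poly4} \<subseteq> N" by blast
  qed
  then have "pmon (mo i j k l) - pmon (mo i' j' k' l') \<in> N" using pmon_diff_toric[OF wt] by blast
  then have "coeff_sum (T (mo i j k l)) (pmon (mo i j k l) - pmon (mo i' j' k' l') :: 'k poly4) = 0"
    by (auto simp: N_def coeff_null_def)
  then have "mo i' j' k' l' \<in> T (mo i j k l)" by (auto simp: coeff_sum_diff T_def split: if_splits)
  then have "w dvd v (mo i' j' k' l') - v (mo i j k l)" by (simp add: T_def)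
  then obtain z where "v (mo i' j' k' l') - v (mo i j k l) = w * z" ..
  then show ?thesis by (intro exI[of _ z]) (simp add: v_mo w_def mult.commute)
qed

end

theorem theorem2p1:
  fixes n a u :: "4 \<Rightarrow> nat"
  assumes "\<And>i. 0 < n i"
    and "gcd (n 1) (gcd (n 2) (gcd (n 3) (n 4))) = 1"
    and "\<And>i. a i = crit_exponent n i"
    and "minimally_generated_by poly4_ring (toric_ideal n :: 'k::field poly4 set)
           {xvar 1 ^ a 1 - xvar 2 ^ a 2,
            xvar 3 ^ a 3 - xvar 4 ^ a 4,
            xvar 1 ^ u 1 * xvar 2 ^ u 2 - xvar 3 ^ u 3 * xvar 4 ^ u 4}"
    and "n 1 = Min {n 1, n 2, n 3, n 4}"
    and "a 3 < a 4"
    and "u 2 \<le> a 2"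
    and "u 3 \<le> a 3"
    and "0 < u 3"
    and "0 < u 4"
  shows "cm_tangent_cone TYPE('k) n \<longleftrightarrow>
           complete_intersection3 (initial_ideal (toric_ideal n :: 'k poly4 set)) \<or>
           almost_complete_intersection3 (initial_ideal (toric_ideal n :: 'k poly4 set))"
proof -
  have "n 1 \<le> n i" for i
  proof -
    have "n i \<in> {n 1, n 2, n 3, n 4}" by (cases i rule: exhaust_4') simp_all
    then show ?thesis by (subst assms(5)) (intro Min_le, auto)
  qed
  then interpret monomial_curve n using assms(1) by unfold_locales
  have xvar_power: "xvar i ^ k = (pmon (Poly_Mapping.single i k) :: 'k poly4)" for i k
    unfolding xvar_def by (rule pmon_single_power)
  have gen: "toric_ideal n = genideal poly4_ring
      {pmon (mo (a 1) 0 0 0) - pmon (mo 0 (a 2) 0 0), pmon (mo 0 0 (a 3) 0) - pmon (mo 0 0 0 (a 4)),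
       pmon (mo (u 1) (u 2) 0 0) - pmon (mo 0 0 (u 3) (u 4)) :: 'k poly4}"
    using assms(4) unfolding minimally_generated_by_def xvar_power pmon_mult by (simp add: single_eq_mo)
  have "{pmon (mo (a 1) 0 0 0) - pmon (mo 0 (a 2) 0 0), pmon (mo 0 0 (a 3) 0) - pmon (mo 0 0 0 (a 4)),
       pmon (mo (u 1) (u 2) 0 0) - pmon (mo 0 0 (u 3) (u 4)) :: 'k poly4} \<subseteq> toric_ideal n"
    unfolding gen by (rule genideal_roa_superset)
  then have "wt (mo (a 1) 0 0 0) = wt (mo 0 (a 2) 0 0)" "wt (mo 0 0 (a 3) 0) = wt (mo 0 0 0 (a 4))"
    "wt (mo (u 1) (u 2) 0 0) = wt (mo 0 0 (u 3) (u 4))"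
    using pmon_diff_toricD by blast+
  then have rel: "a 1 * n 1 = a 2 * n 2" "a 3 * n 3 = a 4 * n 4"
    "u 1 * n 1 + u 2 * n 2 = u 3 * n 3 + u 4 * n 4" by simp_all
  have a_pos: "0 < a x" for x unfolding assms(3) by (rule crit_exponent_pos)
  have crit: "m = Poly_Mapping.single x c" if "c < a x" "wt m = c * n x" for c x m
    using that unfolding assms(3) by (rule crit_exponent_unique)
  \<comment> \<open>If u 2 = a 2, the first binomial is used to trade the power of the second variable for one of
    the first variable; the weight of the third binomial does not change.\<close>
  define v :: "4 \<Rightarrow> nat" where
    "v = (if u 2 < a 2 then u else u(1 := u 1 + a 1, 2 := 0))"
  have v34: "v 3 = u 3" "v 4 = u 4" by (simp_all add: v_def)
  have v_wt: "v 1 * n 1 + v 2 * n 2 = u 1 * n 1 + u 2 * n 2"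
    using rel(1) assms(7) by (auto simp: v_def distrib_right)
  interpret complete_intersection_curve n a v
  proof
    show "0 < v 1"
    proof (cases "u 2 < a 2")
      case True
      \<comment> \<open>Otherwise the third binomial would express x2^(u 2), with \<open>u 2\<close>
        below the critical exponent, in x3 and x4.\<close>
      have "u 1 \<noteq> 0"
      proof
        assume "u 1 = 0"
        then have "wt (mo 0 0 (u 3) (u 4)) = u 2 * n 2" using rel(3) by simp
        then have "mo 0 0 (u 3) (u 4) = mo 0 (u 2) 0 0" using crit[OF True, of "mo 0 0 (u 3) (u 4)"] by (simp add: single_eq_mo)
        then show False using assms(9) by simp
      qed
      then show ?thesis using True by (simp add: v_def)
    qed (use a_pos[of 1] in \<open>simp add: v_def\<close>)
    show "v 2 < a 2" using a_pos[of 2] by (simp add: v_def)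
    show "\<exists>z::int. int (i' * n 1 + j' * n 2) = int (i * n 1 + j * n 2) + z * int (v 1 * n 1 + v 2 * n 2)"
      if "wt (mo i j k l) = wt (mo i' j' k' l')" for i j k l i' j' k' l'
      unfolding v_wt by (rule weight12_cong_if_generated[OF gen that])
    show "v 1 * n 1 + v 2 * n 2 = v 3 * n 3 + v 4 * n 4" using rel(3) v_wt v34 by simp
  qed (use a_pos crit rel assms v34 in auto)
  have "cm_tangent_cone TYPE('k) n \<longleftrightarrow> tame"
    using cohen_macaulay_iff_tame[where 'k = 'k]
    by (simp add: cm_tangent_cone_def tangent_cone_def initial_ideal_toric_eq)
  then show ?thesis
    unfolding complete_intersection3_def almost_complete_intersection3_def initial_ideal_toric_eq
    using tame_iff_min_num_gens[where 'k = 'k] by simp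
qed

end
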